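(* Consider the problem of minimizing over $u(\cdot)\in\mathcal U[0,T]$ $$J(u(\cdot))=\tfrac12\,\mathbb E\Big[(X^u_T)^\intercal\Gamma X^u_T+\int_0^T\big[(X^u_t)^\intercal A_tX^u_t+u_t^\intercal B_tu_t\big]dt\Big]$$ subject to $$dX^u_t=\big(b_1(t)X^u_t+b_2(t)\big)dt+\sigma(t,u_t)dW_t,\quad t\in[0,T],\qquad X^u_0=x_0,$$ where $x_0\in\mathbb R^n$, $\Gamma\in\mathbb S^{n\times n}$, $b_1$ ($n\times n$-valued), $b_2$ ($\mathbb R^n$-valued), $A$ (symmetric $n\times n$-valued), $B$ (symmetric $k\times k$-valued) are bounded deterministic functions on $[0,T]$, and $\sigma=(\sigma^1,\dots,\sigma^d):[0,T]\times U\to\mathbb R^{n\times d}$ is measurable, continuous in $u$, and satisfies $|\sigma(t,u)|\le L_1(1+|u|)$ for a constant $L_1>0$. Assume that this problem admits an optimal control $\bar u(\cdot)\in\mathcal U[0,T]$. Then the augmented Hamiltonian in the modified method of successive approximations may be taken to be $\tilde{\mathcal H}=\mathcal H$ (i.e. $\rho=0$), so that the control update becomes $$u^m_t\in\arg\min_{u\in U}\mathcal H(t,X^m_t,p^m_t,q^m_t,P_t,u,u^{m-1}_t),\quad t\in[0,T],$$ and, for the resulting sequence of controls $(u^m(\cdot))_{m\ge0}$ started from any $u^0(\cdot)\in\mathcal U[0,T]$, there exists a positive integer $m_0$ such that for all $m\ge m_0$, $$0\le J(u^{m-1}(\cdot))-J(\bar u(\cdot))\le\frac{C_1}{m},\qquad\text{where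 } C_1=\max\{J(u^{m_0-1}(\cdot))-J(\bar u(\cdot)),\,1\}.$$
   Context: Fix $T>0$ and positive integers $n,d,k$. $(\Omega,\mathcal F,\mathbb P)$ is a complete probability space with a standard $d$-dimensional Brownian motion $W=(W^1,\dots,W^d)^\intercal$, and $\mathbb F$ is the $\mathbb P$-augmented natural filtration of $W$. $\mathbb S^{n\times n}$ is the set of symmetric $n\times n$ matrices. $U\subset\mathbb R^k$ is nonempty, and $\mathcal U[0,T]$ (admissible controls) is the set of $\mathbb F$-adapted $U$-valued processes $u(\cdot)$ with $\sup_{t\in[0,T]}\mathbb E[|u_t|^8]<\infty$. For $u(\cdot)\in\mathcal U[0,T]$ the first-order adjoint processes $(p^u,q^u)$ (values in $\mathbb R^n$ and $\mathbb R^{n\times d}$; $(q^u)^i$ is the $i$th column of $q^u$) are the unique square-integrable solution of $$p^u_t=\Gamma X^u_T+\int_t^T\big(b_1^\intercal(s)p^u_s+A_sX^u_s\big)ds-\sum_{i=1}^d\int_t^T(q^u_s)^idW^i_s,\quad t\in[0,T],$$ and the second-order adjoint process $P$ (deterministic, symmetric, independent of $u$) solves $$P_t=\Gamma+\int_t^T\big[b_1^\intercal(s)P_s+P_sb_1(s)+A_s\big]ds,\quad t\in[0,T].$$ The Hamiltonian is $$\mathcal H(t,x,p,q,P,v,u)=p^\intercal[b_1(t)x+b_2(t)]+\sum_{i=1}^d(q^i)^\intercal\sigma^i(t,v)+\tfrac12\big(x^\intercal A_tx+v^\intercal B_tv\big)+\tfrac12\sum_{i=1}^d(\sigma^i(t,v)-\sigma^i(t,u))^\intercal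 P(\sigma^i(t,v)-\sigma^i(t,u)).$$ Modified method of successive approximations: start from $u^0(\cdot)\in\mathcal U[0,T]$; for $m\ge1$ let $X^m$ and $(p^m,q^m)$ be the state and first-order adjoint processes corresponding to $u^{m-1}(\cdot)$, and let $u^m(\cdot)\in\mathcal U[0,T]$ be obtained by the minimization displayed in the claim (the iterates are taken to be admissible controls; the infinite sequence is considered, ignoring any stopping rule). In general the algorithm minimizes an augmented Hamiltonian $\tilde{\mathcal H}$ equal to $\mathcal H$ plus $\frac{\rho}{2}$ times a sum of squared differences, with parameter $\rho\ge0$; $\rho=0$ gives $\tilde{\mathcal H}=\mathcal H$. *)

theory Defs
  imports "HOL-Probability.Probability"
begin

definition natural_filtration ::
  "'w measure \<Rightarrow> (real \<Rightarrow> 'w \<Rightarrow> 'a::topological_space) \<Rightarrow> real \<Rightarrow> 'w measure" where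
  "natural_filtration M W t =
     sigma (space M) {W s -` S \<inter> space M | s S. s \<in> {0..t} \<and> S \<in> sets borel}"

definition augmented_filtration ::
  "'w measure \<Rightarrow> (real \<Rightarrow> 'w \<Rightarrow> 'a::topological_space) \<Rightarrow> real \<Rightarrow> 'w measure" where
  "augmented_filtration M W t =
     sigma (space M) (sets (natural_filtration M W t) \<union> null_sets M)"

definition standard_brownian_motion ::
  "'w measure \<Rightarrow> real \<Rightarrow> (real \<Rightarrow> 'w \<Rightarrow> real^'d) \<Rightarrow> bool" where
  "standard_brownian_motion M T W \<longleftrightarrow>
     (\<forall>t\<in>{0..T}. W t \<in> borel_measurable M) \<and>
     (AE \<omega> in M. W 0 \<omega> = 0) \<and>
     (AE \<omega> in M. continuous_on {0..T} (\<lambda>t. W t \<omega>)) \<and>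
     (\<forall>s t. 0 \<le> s \<and> s < t \<and> t \<le> T \<longrightarrow>
        prob_space.indep_set M (sets (natural_filtration M W s))
          {(\<lambda>\<omega>. W t \<omega> - W s \<omega>) -` S \<inter> space M | S. S \<in> sets borel} \<and>
        prob_space.indep_vars M (\<lambda>_. borel) (\<lambda>i \<omega>. (W t \<omega> - W s \<omega>) $ i) UNIV \<and>
        (\<forall>i. distributed M lborel (\<lambda>\<omega>. (W t \<omega> - W s \<omega>) $ i)
               (\<lambda>x. ennreal (normal_density 0 (sqrt (t - s)) x))))"

text \<open>Adapted processes are also required to be jointly measurable in time and scenario,
  the usual convention that makes their time integrals meaningful.\<close>

definition adapted_process ::
  "'w measure \<Rightarrow> (real \<Rightarrow> 'w measure) \<Rightarrow> real \<Rightarrow> real \<Rightarrow>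
   (real \<Rightarrow> 'w \<Rightarrow> 'a::topological_space) \<Rightarrow> bool" where
  "adapted_process M F a b H \<longleftrightarrow>
     (\<lambda>(t, \<omega>). H t \<omega>) \<in> borel_measurable (restrict_space borel {a..b} \<Otimes>\<^sub>M M) \<and>
     (\<forall>t\<in>{a..b}. H t \<in> borel_measurable (F t))"

definition square_integrable_process ::
  "'w measure \<Rightarrow> (real \<Rightarrow> 'w measure) \<Rightarrow> real \<Rightarrow> real \<Rightarrow>
   (real \<Rightarrow> 'w \<Rightarrow> 'a::real_normed_vector) \<Rightarrow> bool" where
  "square_integrable_process M F a b H \<longleftrightarrow>
     adapted_process M F a b H \<and>
     (\<integral>\<^sup>+ \<omega>. (\<integral>\<^sup>+ t\<in>{a..b}. ennreal ((norm (H t \<omega>))\<^sup>2) \<partial>lborel) \<partial>M) < \<infinity>"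

text \<open>An elementary process on \<open>{a..b}\<close> is given by a partition
  \<open>a = \<tau> 0 \<le> \<dots> \<le> \<tau> N = b\<close> and a bounded weight \<open>\<xi> j\<close> on each interval
  \<open>{\<tau> j<..\<tau> (Suc j)}\<close>, known at the left endpoint.\<close>

definition elementary_data ::
  "'w measure \<Rightarrow> (real \<Rightarrow> 'w measure) \<Rightarrow> real \<Rightarrow> real \<Rightarrow>
   nat \<Rightarrow> (nat \<Rightarrow> real) \<Rightarrow> (nat \<Rightarrow> 'w \<Rightarrow> 'a::real_normed_vector) \<Rightarrow> bool" where
  "elementary_data M F a b N \<tau> \<xi> \<longleftrightarrow>
     \<tau> 0 = a \<and> \<tau> N = b \<and> (\<forall>j<N. \<tau> j \<le> \<tau> (Suc j)) \<and>
     (\<forall>j<N. \<xi> j \<in> borel_measurable (F (\<tau> j)) \<and> bounded (\<xi> j ` space M))"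

definition elementary_process ::
  "nat \<Rightarrow> (nat \<Rightarrow> real) \<Rightarrow> (nat \<Rightarrow> 'w \<Rightarrow> 'a::real_normed_vector) \<Rightarrow> real \<Rightarrow> 'w \<Rightarrow> 'a" where
  "elementary_process N \<tau> \<xi> t \<omega> =
     (\<Sum>j<N. indicator {\<tau> j<..\<tau> (Suc j)} t *\<^sub>R \<xi> j \<omega>)"

definition elementary_integral ::
  "(real \<Rightarrow> 'w \<Rightarrow> real) \<Rightarrow> nat \<Rightarrow> (nat \<Rightarrow> real) \<Rightarrow>
   (nat \<Rightarrow> 'w \<Rightarrow> 'a::real_normed_vector) \<Rightarrow> 'w \<Rightarrow> 'a" where
  "elementary_integral w N \<tau> \<xi> \<omega> =
     (\<Sum>j<N. (w (\<tau> (Suc j)) \<omega> - w (\<tau> j) \<omega>) *\<^sub>R \<xi> j \<omega>)"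

text \<open>\<open>has_ito_integral M F w a b H Z\<close>: the random variable \<open>Z\<close> is (a version of) the It\^o
  integral of the square-integrable adapted process \<open>H\<close> over \<open>{a..b}\<close> against the scalar
  Brownian motion \<open>w\<close>, i.e. the \<open>L\<^sup>2\<close> limit of the integrals of elementary processes that
  approximate \<open>H\<close> in \<open>L\<^sup>2\<close>. It determines \<open>Z\<close> almost surely.\<close>

definition has_ito_integral ::
  "'w measure \<Rightarrow> (real \<Rightarrow> 'w measure) \<Rightarrow> (real \<Rightarrow> 'w \<Rightarrow> real) \<Rightarrow> real \<Rightarrow> real \<Rightarrow>
   (real \<Rightarrow> 'w \<Rightarrow> 'a::euclidean_space) \<Rightarrow> ('w \<Rightarrow> 'a) \<Rightarrow> bool" where
  "has_ito_integral M F w a b H Z \<longleftrightarrow>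
     square_integrable_process M F a b H \<and> Z \<in> borel_measurable M \<and>
     (\<exists>N \<tau> \<xi>. (\<forall>m::nat. elementary_data M F a b (N m) (\<tau> m) (\<xi> m)) \<and>
        (\<lambda>m. \<integral>\<^sup>+ \<omega>. (\<integral>\<^sup>+ t\<in>{a..b}.
               ennreal ((norm (elementary_process (N m) (\<tau> m) (\<xi> m) t \<omega> - H t \<omega>))\<^sup>2)
               \<partial>lborel) \<partial>M) \<longlonglongrightarrow> 0 \<and>
        (\<lambda>m. \<integral>\<^sup>+ \<omega>. ennreal ((norm (elementary_integral w (N m) (\<tau> m) (\<xi> m) \<omega> - Z \<omega>))\<^sup>2)
               \<partial>M) \<longlonglongrightarrow> 0)"

text \<open>An \<open>n \<times> d\<close> matrix such as \<open>\<sigma> t v\<close> or \<open>q t \<omega>\<close> has type \<open>real^'d^'n\<close>; its norm is the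
  Frobenius norm.\<close>

definition admissible_controls ::
  "'w measure \<Rightarrow> real \<Rightarrow> (real \<Rightarrow> 'w \<Rightarrow> real^'d) \<Rightarrow> (real^'k) set \<Rightarrow>
   (real \<Rightarrow> 'w \<Rightarrow> real^'k) set" where
  "admissible_controls M T W U =
     {u. adapted_process M (augmented_filtration M W) 0 T u \<and>
         (\<forall>t\<in>{0..T}. \<forall>\<omega>\<in>space M. u t \<omega> \<in> U) \<and>
         (SUP t\<in>{0..T}. \<integral>\<^sup>+ \<omega>. ennreal ((norm (u t \<omega>)) ^ 8) \<partial>M) < \<infinity>}"

definition state_process ::
  "'w measure \<Rightarrow> real \<Rightarrow> (real \<Rightarrow> 'w \<Rightarrow> real^'d) \<Rightarrow> real^'n \<Rightarrow> (real \<Rightarrow> real^'n^'n) \<Rightarrow>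
   (real \<Rightarrow> real^'n) \<Rightarrow> (real \<Rightarrow> real^'k \<Rightarrow> real^'d^'n) \<Rightarrow> (real \<Rightarrow> 'w \<Rightarrow> real^'k) \<Rightarrow>
   (real \<Rightarrow> 'w \<Rightarrow> real^'n) \<Rightarrow> bool" where
  "state_process M T W x0 b1 b2 \<sigma> u X \<longleftrightarrow>
     square_integrable_process M (augmented_filtration M W) 0 T X \<and>
     (AE \<omega> in M. continuous_on {0..T} (\<lambda>t. X t \<omega>)) \<and>
     (\<forall>t\<in>{0..T}. \<exists>I.
        (\<forall>i. has_ito_integral M (augmented_filtration M W) (\<lambda>s \<omega>. W s \<omega> $ i) 0 t
               (\<lambda>s \<omega>. column i (\<sigma> s (u s \<omega>))) (I i)) \<and>
        (AE \<omega> in M. X t \<omega> =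
           x0 + (LINT s:{0..t}|lborel. b1 s *v X s \<omega> + b2 s) + (\<Sum>i\<in>UNIV. I i \<omega>)))"

definition cost_of_pair ::
  "'w measure \<Rightarrow> real \<Rightarrow> (real \<Rightarrow> real^'n^'n) \<Rightarrow> (real \<Rightarrow> real^'k^'k) \<Rightarrow> real^'n^'n \<Rightarrow>
   (real \<Rightarrow> 'w \<Rightarrow> real^'n) \<Rightarrow> (real \<Rightarrow> 'w \<Rightarrow> real^'k) \<Rightarrow> real" where
  "cost_of_pair M T A B \<Gamma> X u =
     (1/2) * (LINT \<omega>|M. X T \<omega> \<bullet> (\<Gamma> *v X T \<omega>) +
       (LINT t:{0..T}|lborel. X t \<omega> \<bullet> (A t *v X t \<omega>) + u t \<omega> \<bullet> (B t *v u t \<omega>)))"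

text \<open>The state process is unique up to modification, so the choice below does not affect
  the cost.\<close>

definition cost_functional ::
  "'w measure \<Rightarrow> real \<Rightarrow> (real \<Rightarrow> 'w \<Rightarrow> real^'d) \<Rightarrow> real^'n \<Rightarrow> (real \<Rightarrow> real^'n^'n) \<Rightarrow>
   (real \<Rightarrow> real^'n) \<Rightarrow> (real \<Rightarrow> real^'k \<Rightarrow> real^'d^'n) \<Rightarrow> (real \<Rightarrow> real^'n^'n) \<Rightarrow>
   (real \<Rightarrow> real^'k^'k) \<Rightarrow> real^'n^'n \<Rightarrow> (real \<Rightarrow> 'w \<Rightarrow> real^'k) \<Rightarrow> real" where
  "cost_functional M T W x0 b1 b2 \<sigma> A B \<Gamma> u =
     cost_of_pair M T A B \<Gamma> (SOME X. state_process M T W x0 b1 b2 \<sigma> u X) u"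

definition first_adjoint ::
  "'w measure \<Rightarrow> real \<Rightarrow> (real \<Rightarrow> 'w \<Rightarrow> real^'d) \<Rightarrow> (real \<Rightarrow> real^'n^'n) \<Rightarrow>
   (real \<Rightarrow> real^'n^'n) \<Rightarrow> real^'n^'n \<Rightarrow> (real \<Rightarrow> 'w \<Rightarrow> real^'n) \<Rightarrow>
   (real \<Rightarrow> 'w \<Rightarrow> real^'n) \<Rightarrow> (real \<Rightarrow> 'w \<Rightarrow> real^'d^'n) \<Rightarrow> bool" where
  "first_adjoint M T W b1 A \<Gamma> X p q \<longleftrightarrow>
     square_integrable_process M (augmented_filtration M W) 0 T p \<and>
     square_integrable_process M (augmented_filtration M W) 0 T q \<and>
     (AE \<omega> in M. continuous_on {0..T} (\<lambda>t. p t \<omega>)) \<and>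
     (\<forall>t\<in>{0..T}. \<exists>I.
        (\<forall>i. has_ito_integral M (augmented_filtration M W) (\<lambda>s \<omega>. W s \<omega> $ i) t T
               (\<lambda>s \<omega>. column i (q s \<omega>)) (I i)) \<and>
        (AE \<omega> in M. p t \<omega> =
           \<Gamma> *v X T \<omega> +
           (LINT s:{t..T}|lborel. transpose (b1 s) *v p s \<omega> + A s *v X s \<omega>) -
           (\<Sum>i\<in>UNIV. I i \<omega>)))"

definition second_adjoint ::
  "real \<Rightarrow> (real \<Rightarrow> real^'n^'n) \<Rightarrow> (real \<Rightarrow> real^'n^'n) \<Rightarrow> real^'n^'n \<Rightarrow>
   (real \<Rightarrow> real^'n^'n) \<Rightarrow> bool" where
  "second_adjoint T b1 A \<Gamma> P \<longleftrightarrow>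
     continuous_on {0..T} P \<and> (\<forall>t\<in>{0..T}. transpose (P t) = P t) \<and>
     (\<forall>t\<in>{0..T}. P t =
        \<Gamma> + (LINT s:{t..T}|lborel. transpose (b1 s) ** P s + P s ** b1 s + A s))"

definition hamiltonian ::
  "(real \<Rightarrow> real^'n^'n) \<Rightarrow> (real \<Rightarrow> real^'n) \<Rightarrow> (real \<Rightarrow> real^'k \<Rightarrow> real^'d^'n) \<Rightarrow>
   (real \<Rightarrow> real^'n^'n) \<Rightarrow> (real \<Rightarrow> real^'k^'k) \<Rightarrow>
   real \<Rightarrow> real^'n \<Rightarrow> real^'n \<Rightarrow> real^'d^'n \<Rightarrow> real^'n^'n \<Rightarrow> real^'k \<Rightarrow> real^'k \<Rightarrow> real" where
  "hamiltonian b1 b2 \<sigma> A B t x p q P v u =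
     p \<bullet> (b1 t *v x + b2 t) +
     (\<Sum>i\<in>UNIV. column i q \<bullet> column i (\<sigma> t v)) +
     (1/2) * (x \<bullet> (A t *v x) + v \<bullet> (B t *v v)) +
     (1/2) * (\<Sum>i\<in>UNIV. (column i (\<sigma> t v) - column i (\<sigma> t u)) \<bullet>
                (P *v (column i (\<sigma> t v) - column i (\<sigma> t u))))"

end

theory Submission
  imports Defs
begin

text \<open>The control enters only the diffusion coefficient and the running cost, so for two controls the gap
  \<open>J v - J u\<close> is exactly the expected time integral of \<open>H(v, u) - H(u, u)\<close>: in the expansion around the
  state of \<open>u\<close> the terms linear in \<open>D = X\<^sup>v - X\<^sup>u\<close> are absorbed by the first-order adjoint
  \<open>(p, q)\<close> and the quadratic ones by \<open>P\<close>. Minimizing the Hamiltonian pointwise therefore minimizes the cost in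
  a single step, \<open>J (u m) = J ubar\<close> for all \<open>m \<ge> 1\<close>, and \<open>m0 = 2\<close> works.

  The identity needs no Ito formula. After \<open>D\<close> is split into drift and martingale part, Fubini on the
  triangle \<open>s \<le> r\<close> reduces it to the Ito isometry and to the orthogonality of later stochastic
  increments to the past.\<close>

section \<open>Square-integrable functions\<close>

text \<open>The expansion of the cost around the state of \<open>u\<close> stops at second order
  without remainder: the difference \<open>D\<close> of two states has the drift
  \<open>b1 t *v D t\<close>, free of the control, and the state enters the cost quadratically. The
  gap formula is therefore global rather than a local estimate, and no penalty on the distance
  between iterates has to force descent. The update and the optimal control are never compared
  directly: both costs are measured from the previous control, with its adjoint pair, so adjoints of
  the other two controls do not appear.

  The obstacle is that \<open>has_ito_integral\<close> supplies one random variable per interval, an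
  L2 limit fixed up to null sets. It gives no integral process with regular paths, hence no product
  rule for \<open>p\<close> and \<open>D\<close>. For this reason statements about stochastic
  integrals take the form of expectations of bilinear pairings, which pass to L2 limits, and the
  pathwise arguments involve ordinary time integrals only.\<close>

definition sq_int :: "'x measure \<Rightarrow> ('x \<Rightarrow> 'a::euclidean_space) \<Rightarrow> bool" where
  "sq_int N f \<longleftrightarrow> f \<in> borel_measurable N \<and> integrable N (\<lambda>x. (norm (f x))\<^sup>2)"

lemma sq_int_measurable: "sq_int N f \<Longrightarrow> f \<in> borel_measurable N"
  by (simp add: sq_int_def)

lemma sq_int_integrable_norm: "sq_int N f \<Longrightarrow> integrable N (\<lambda>x. (norm (f x))\<^sup>2)"
  by (simp add: sq_int_def)

lemma sq_int_nn_integral: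
  assumes "f \<in> borel_measurable N" "(\<integral>\<^sup>+ x. ennreal ((norm (f x))\<^sup>2) \<partial>N) < \<infinity>"
  shows "sq_int N f"
  using assms by (auto simp: sq_int_def integrable_iff_bounded)

lemma sq_int_bound:
  assumes "sq_int N f" "g \<in> borel_measurable N" "AE x in N. norm (g x) \<le> C * norm (f x)"
  shows "sq_int N g"
  unfolding sq_int_def
proof
  have [measurable]: "g \<in> borel_measurable N" by fact
  have "integrable N (\<lambda>x. C\<^sup>2 * (norm (f x))\<^sup>2)"
    using assms(1) by (simp add: sq_int_def)
  then show "integrable N (\<lambda>x. (norm (g x))\<^sup>2)"
  proof (rule Bochner_Integration.integrable_bound)
    show "AE x in N. norm ((norm (g x))\<^sup>2) \<le> norm (C\<^sup>2 * (norm (f x))\<^sup>2)"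
      using assms(3)
    proof eventually_elim
      case (elim x)
      from power_mono[OF this, of 2] show ?case by (simp add: power_mult_distrib)
    qed
  qed measurable
qed fact

lemma sq_int_norm: "sq_int N f \<Longrightarrow> sq_int N (\<lambda>x. norm (f x))"
  by (auto simp: sq_int_def)

lemma sq_int_add:
  assumes "sq_int N f" "sq_int N g" shows "sq_int N (\<lambda>x. f x + g x)"
  unfolding sq_int_def
proof
  have [measurable]: "f \<in> borel_measurable N" "g \<in> borel_measurable N"
    using assms by (auto simp: sq_int_def)
  show "(\<lambda>x. f x + g x) \<in> borel_measurable N" by measurable
  have "integrable N (\<lambda>x. 2 * (norm (f x))\<^sup>2 + 2 * (norm (g x))\<^sup>2)"
    using assms by (simp add: sq_int_def)
  then show "integrable N (\<lambda>x. (norm (f x + g x))\<^sup>2)"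
  proof (rule Bochner_Integration.integrable_bound)
    have "(norm (f x + g x))\<^sup>2 \<le> 2 * (norm (f x))\<^sup>2 + 2 * (norm (g x))\<^sup>2" for x
    proof -
      have "(norm (f x + g x))\<^sup>2 \<le> (norm (f x) + norm (g x))\<^sup>2"
        by (intro power_mono norm_triangle_ineq) auto
      also have "\<dots> \<le> 2 * (norm (f x))\<^sup>2 + 2 * (norm (g x))\<^sup>2"
        using sum_squares_bound[of "norm (f x)" "norm (g x)"] by (simp add: power2_sum)
      finally show ?thesis .
    qed
    then show "AE x in N. norm ((norm (f x + g x))\<^sup>2) \<le> norm (2 * (norm (f x))\<^sup>2 + 2 * (norm (g x))\<^sup>2)"
      by (intro AE_I2) auto
  qed measurable
qed

lemma sq_int_scaleR: "sq_int N f \<Longrightarrow> sq_int N (\<lambda>x. c *\<^sub>R f x)"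
  by (auto simp: sq_int_def power_mult_distrib)

lemma sq_int_diff:
  assumes "sq_int N f" "sq_int N g" shows "sq_int N (\<lambda>x. f x - g x)"
  using sq_int_add[OF assms(1) sq_int_scaleR[OF assms(2), of "-1"]] by simp

lemma sq_int_zero: "sq_int N (\<lambda>x. 0)"
  by (auto simp: sq_int_def)

lemma sq_int_sum: "(\<And>i. i \<in> S \<Longrightarrow> sq_int N (f i)) \<Longrightarrow> sq_int N (\<lambda>x. \<Sum>i\<in>S. f i x)"
  by (induction S rule: infinite_finite_induct) (auto intro: sq_int_add sq_int_zero)

lemma sq_int_cong_AE:
  assumes "sq_int N f" "g \<in> borel_measurable N" "AE x in N. f x = g x"
  shows "sq_int N g"
  using assms(1,2) by (rule sq_int_bound[where C=1]) (use assms(3) in \<open>auto elim: eventually_mono\<close>)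

lemma (in finite_measure) sq_int_const: "sq_int M (\<lambda>x. c)"
  by (auto simp: sq_int_def)

lemma (in finite_measure) sq_int_bounded:
  assumes "g \<in> borel_measurable M" "\<And>x. x \<in> space M \<Longrightarrow> norm (g x) \<le> C"
  shows "sq_int M g"
  using sq_int_const[of "1::real"] assms(1)
  by (rule sq_int_bound[where C=C]) (use assms(2) in auto)

lemma bounded_bilinear_measurable:
  fixes B :: "'a::euclidean_space \<Rightarrow> 'b::euclidean_space \<Rightarrow> 'c::euclidean_space"
  assumes "bounded_bilinear B" "f \<in> borel_measurable N" "g \<in> borel_measurable N"
  shows "(\<lambda>x. B (f x) (g x)) \<in> borel_measurable N"
proof -
  have "continuous_on UNIV (\<lambda>z. B (fst z) (snd z))"
    by (intro bounded_bilinear.continuous_on[OF assms(1)] continuous_intros)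
  from measurable_compose[OF borel_measurable_Pair[OF assms(2,3)] borel_measurable_continuous_onI[OF this]]
  show ?thesis by simp
qed

lemma sq_int_prod_integrable:
  fixes f g :: "'x \<Rightarrow> real"
  assumes "sq_int N f" "sq_int N g"
  shows "integrable N (\<lambda>x. f x * g x)"
proof -
  have [measurable]: "f \<in> borel_measurable N" "g \<in> borel_measurable N"
    using assms by (auto simp: sq_int_def)
  have "integrable N (\<lambda>x. (f x)\<^sup>2 + (g x)\<^sup>2)"
    using assms by (simp add: sq_int_def)
  then show ?thesis
  proof (rule Bochner_Integration.integrable_bound)
    have "norm (f x * g x) \<le> norm ((f x)\<^sup>2 + (g x)\<^sup>2)" for x
      using sum_squares_bound[of "\<bar>f x\<bar>" "\<bar>g x\<bar>"] mult_nonneg_nonneg[of "\<bar>f x\<bar>" "\<bar>g x\<bar>"]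
      by (simp add: abs_mult del: mult_nonneg_nonneg)
    then show "AE x in N. norm (f x * g x) \<le> norm ((f x)\<^sup>2 + (g x)\<^sup>2)" by simp
  qed measurable
qed

lemma sq_int_bilinear_integrable:
  fixes B :: "'a::euclidean_space \<Rightarrow> 'b::euclidean_space \<Rightarrow> 'c::euclidean_space"
  assumes B: "bounded_bilinear B" and "sq_int N f" "sq_int N g"
  shows "integrable N (\<lambda>x. B (f x) (g x))"
proof -
  obtain K where K: "\<And>a b. norm (B a b) \<le> norm a * norm b * K"
    using bounded_bilinear.bounded[OF B] by blast
  have "integrable N (\<lambda>x. norm (f x) * norm (g x) * K)"
    using sq_int_prod_integrable[OF sq_int_norm[OF assms(2)] sq_int_norm[OF assms(3)]] by simp
  then show ?thesis
  proof (rule Bochner_Integration.integrable_bound)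
    show "(\<lambda>x. B (f x) (g x)) \<in> borel_measurable N"
      by (rule bounded_bilinear_measurable[OF B sq_int_measurable[OF assms(2)] sq_int_measurable[OF assms(3)]])
    show "AE x in N. norm (B (f x) (g x)) \<le> norm (norm (f x) * norm (g x) * K)"
      using K by (intro AE_I2) (metis abs_ge_self order_trans real_norm_def)
  qed
qed

lemmas sq_int_inner_integrable = sq_int_bilinear_integrable[OF bounded_bilinear_inner]

lemma sq_int_Cauchy_Schwarz:
  fixes f :: "'x \<Rightarrow> 'a::euclidean_space" and g :: "'x \<Rightarrow> 'b::euclidean_space"
  assumes "sq_int N f" "sq_int N g"
  shows "(\<integral>x. norm (f x) * norm (g x) \<partial>N)\<^sup>2 \<le> (\<integral>x. (norm (f x))\<^sup>2 \<partial>N) * (\<integral>x. (norm (g x))\<^sup>2 \<partial>N)"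
proof -
  have [measurable]: "f \<in> borel_measurable N" "g \<in> borel_measurable N"
    using assms by (auto simp: sq_int_def)
  have i: "integrable N (\<lambda>x. norm (f x) * norm (g x))"
    by (rule sq_int_prod_integrable[OF sq_int_norm[OF assms(1)] sq_int_norm[OF assms(2)]])
  have "(\<integral>\<^sup>+x. ennreal (norm (f x)) * ennreal (norm (g x)) \<partial>N)\<^sup>2
     \<le> (\<integral>\<^sup>+x. (ennreal (norm (f x)))\<^sup>2 \<partial>N) * (\<integral>\<^sup>+x. (ennreal (norm (g x)))\<^sup>2 \<partial>N)"
    by (rule Cauchy_Schwarz_nn_integral) auto
  also have "(\<integral>\<^sup>+x. ennreal (norm (f x)) * ennreal (norm (g x)) \<partial>N) = ennreal (\<integral>x. norm (f x) * norm (g x) \<partial>N)"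
    using i by (subst nn_integral_eq_integral[symmetric]) (auto simp: ennreal_mult)
  also have "(\<integral>\<^sup>+x. (ennreal (norm (f x)))\<^sup>2 \<partial>N) = ennreal (\<integral>x. (norm (f x))\<^sup>2 \<partial>N)"
    using assms by (subst nn_integral_eq_integral[symmetric]) (auto simp: ennreal_power sq_int_def)
  also have "(\<integral>\<^sup>+x. (ennreal (norm (g x)))\<^sup>2 \<partial>N) = ennreal (\<integral>x. (norm (g x))\<^sup>2 \<partial>N)"
    using assms by (subst nn_integral_eq_integral[symmetric]) (auto simp: ennreal_power sq_int_def)
  finally show ?thesis
    by (simp add: ennreal_power ennreal_mult[symmetric])
qed

lemma sq_int_bilinear_bound:
  fixes B :: "'a::euclidean_space \<Rightarrow> 'b::euclidean_space \<Rightarrow> real"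
  assumes B: "bounded_bilinear B" and K: "\<And>a b. norm (B a b) \<le> norm a * norm b * K" and K0: "K \<ge> 0"
    and f: "sq_int N f" and g: "sq_int N g"
  shows "\<bar>\<integral>x. B (f x) (g x) \<partial>N\<bar> \<le> K * sqrt ((\<integral>x. (norm (f x))\<^sup>2 \<partial>N) * (\<integral>x. (norm (g x))\<^sup>2 \<partial>N))"
proof -
  have i: "integrable N (\<lambda>x. norm (f x) * norm (g x))"
    by (rule sq_int_prod_integrable[OF sq_int_norm[OF f] sq_int_norm[OF g]])
  have "\<bar>\<integral>x. B (f x) (g x) \<partial>N\<bar> \<le> (\<integral>x. norm (B (f x) (g x)) \<partial>N)"
    using integral_norm_bound[of N "\<lambda>x. B (f x) (g x)"] by simp
  also have "\<dots> \<le> (\<integral>x. (norm (f x) * norm (g x)) * K \<partial>N)"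
    using i K sq_int_bilinear_integrable[OF B f g]
    by (intro integral_mono) (auto simp del: real_norm_def)
  also have "\<dots> = K * (\<integral>x. norm (f x) * norm (g x) \<partial>N)" by simp
  finally have *: "\<bar>\<integral>x. B (f x) (g x) \<partial>N\<bar> \<le> K * (\<integral>x. norm (f x) * norm (g x) \<partial>N)" .
  show ?thesis
    by (intro order_trans[OF *] mult_left_mono real_le_rsqrt sq_int_Cauchy_Schwarz f g K0)
qed

lemma (in finite_measure) sq_int_integrable:
  assumes "sq_int M f" shows "integrable M f"
  using sq_int_bilinear_integrable[OF bounded_bilinear_scaleR sq_int_const[of "1::real"] assms] by simp

section \<open>Convergence in L2\<close>

definition l2_tendsto :: "'x measure \<Rightarrow> (nat \<Rightarrow> 'x \<Rightarrow> 'a::euclidean_space) \<Rightarrow> ('x \<Rightarrow> 'a) \<Rightarrow> bool" where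
  "l2_tendsto N f l \<longleftrightarrow> (\<forall>m. sq_int N (f m)) \<and> sq_int N l \<and>
     (\<lambda>m. \<integral>x. (norm (f m x - l x))\<^sup>2 \<partial>N) \<longlonglongrightarrow> 0"

text \<open>Square integrability of the limit is a consequence: some \<open>f m\<close> lies at
  finite L2 distance from \<open>l\<close>, and \<open>l\<close> is \<open>f m\<close> minus that
  difference. The hypothesis uses nonnegative integrals because \<open>has_ito_integral\<close>
  states its convergence in this form.\<close>

lemma l2_tendstoI_nn:
  assumes f: "\<And>m. sq_int N (f m)" and [measurable]: "l \<in> borel_measurable N"
    and lim: "(\<lambda>m. \<integral>\<^sup>+x. ennreal ((norm (f m x - l x))\<^sup>2) \<partial>N) \<longlonglongrightarrow> 0"
  shows "l2_tendsto N f l"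
proof -
  have [measurable]: "f m \<in> borel_measurable N" for m using f by (auto simp: sq_int_def)
  have "\<forall>\<^sub>F m in sequentially. (\<integral>\<^sup>+x. ennreal ((norm (f m x - l x))\<^sup>2) \<partial>N) < \<infinity>"
    using lim by (rule order_tendstoD) simp
  then obtain m where "(\<integral>\<^sup>+x. ennreal ((norm (f m x - l x))\<^sup>2) \<partial>N) < \<infinity>"
    by (auto simp: eventually_sequentially)
  then have "sq_int N (\<lambda>x. f m x - l x)" by (intro sq_int_nn_integral) auto
  from sq_int_diff[OF f[of m] this] have l: "sq_int N l" by simp
  have "(\<integral>\<^sup>+x. ennreal ((norm (f m x - l x))\<^sup>2) \<partial>N) = ennreal (\<integral>x. (norm (f m x - l x))\<^sup>2 \<partial>N)" for m
    using sq_int_diff[OF f[of m] l] by (intro nn_integral_eq_integral) (auto simp: sq_int_def)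
  with lim have "(\<lambda>m. ennreal (\<integral>x. (norm (f m x - l x))\<^sup>2 \<partial>N)) \<longlonglongrightarrow> ennreal 0" by simp
  then have "(\<lambda>m. \<integral>x. (norm (f m x - l x))\<^sup>2 \<partial>N) \<longlonglongrightarrow> 0"
    by (rule tendsto_ennrealD) auto
  with f l show ?thesis by (simp add: l2_tendsto_def)
qed

text \<open>The error is split into the pairings of \<open>f - f'\<close> with
  \<open>g - g'\<close>, of \<open>f - f'\<close> with \<open>g'\<close>, and of \<open>f'\<close>
  with \<open>g - g'\<close>, each bounded by Cauchy-Schwarz. Identities for stochastic integrals
  are obtained on step processes and carried to the limit by this lemma.\<close>

lemma l2_tendsto_bilinear:
  fixes B :: "'a::euclidean_space \<Rightarrow> 'b::euclidean_space \<Rightarrow> real"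
  assumes B: "bounded_bilinear B" and f: "l2_tendsto N f f'" and g: "l2_tendsto N g g'"
  shows "(\<lambda>m. \<integral>x. B (f m x) (g m x) \<partial>N) \<longlonglongrightarrow> (\<integral>x. B (f' x) (g' x) \<partial>N)"
proof -
  interpret bounded_bilinear B by fact
  obtain K where K0: "K \<ge> 0" and K: "\<And>a b. norm (B a b) \<le> norm a * norm b * K" using nonneg_bounded by blast
  have sq: "sq_int N (f m)" "sq_int N f'" "sq_int N (g m)" "sq_int N g'" for m
    using f g by (auto simp: l2_tendsto_def)
  have sd: "sq_int N (\<lambda>x. f m x - f' x)" "sq_int N (\<lambda>x. g m x - g' x)" for m
    by (intro sq_int_diff sq)+
  note int = sq_int_bilinear_integrable[OF B]
  define a where "a m = (\<integral>x. (norm (f m x - f' x))\<^sup>2 \<partial>N)" for m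
  define b where "b m = (\<integral>x. (norm (g m x - g' x))\<^sup>2 \<partial>N)" for m
  define F where "F = (\<integral>x. (norm (f' x))\<^sup>2 \<partial>N)"
  define G where "G = (\<integral>x. (norm (g' x))\<^sup>2 \<partial>N)"
  have ab: "a \<longlonglongrightarrow> 0" "b \<longlonglongrightarrow> 0" using f g by (auto simp: l2_tendsto_def a_def[abs_def] b_def[abs_def])
  have "norm ((\<integral>x. B (f m x) (g m x) \<partial>N) - (\<integral>x. B (f' x) (g' x) \<partial>N))
      \<le> K * sqrt (a m * b m) + K * sqrt (a m * G) + K * sqrt (F * b m)" for m
  proof -
    have "(\<integral>x. B (f m x) (g m x) \<partial>N) - (\<integral>x. B (f' x) (g' x) \<partial>N)
      = (\<integral>x. B (f m x - f' x) (g m x - g' x) + B (f m x - f' x) (g' x) + B (f' x) (g m x - g' x) \<partial>N)"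
      by (subst Bochner_Integration.integral_diff[symmetric])
         (auto intro!: int sq sd Bochner_Integration.integral_cong simp: diff_left diff_right)
    also have "\<dots> = (\<integral>x. B (f m x - f' x) (g m x - g' x) \<partial>N) + (\<integral>x. B (f m x - f' x) (g' x) \<partial>N)
        + (\<integral>x. B (f' x) (g m x - g' x) \<partial>N)"
      by (simp add: int sq sd)
    finally show ?thesis
      using sq_int_bilinear_bound[OF B K K0 sd(1)[of m] sd(2)[of m]]
        sq_int_bilinear_bound[OF B K K0 sd(1)[of m] sq(4)]
        sq_int_bilinear_bound[OF B K K0 sq(2) sd(2)[of m]]
      unfolding a_def b_def F_def G_def by simp
  qed
  moreover
  have "(\<lambda>m. K * sqrt (a m * b m) + K * sqrt (a m * G) + K * sqrt (F * b m)) \<longlonglongrightarrow>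
      K * sqrt (0 * 0) + K * sqrt (0 * G) + K * sqrt (F * 0)"
    by (intro tendsto_intros ab)
  then have "(\<lambda>m. K * sqrt (a m * b m) + K * sqrt (a m * G) + K * sqrt (F * b m)) \<longlonglongrightarrow> 0" by simp
  ultimately have "(\<lambda>m. (\<integral>x. B (f m x) (g m x) \<partial>N) - (\<integral>x. B (f' x) (g' x) \<partial>N)) \<longlonglongrightarrow> 0"
    by (rule Lim_null_comparison[OF always_eventually, OF allI])
  then show ?thesis by (simp add: LIM_zero_iff)
qed

lemma l2_tendsto_const: "sq_int N f \<Longrightarrow> l2_tendsto N (\<lambda>_. f) f"
  by (simp add: l2_tendsto_def)

text \<open>Carries a limit over to a second sequence at vanishing L2 distance; it serves where two
  unrelated approximating sequences have to be reconciled.\<close>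

lemma l2_tendsto_close:
  assumes f: "l2_tendsto N f l" and g: "\<And>m. sq_int N (g m)"
    and fg: "(\<lambda>m. \<integral>x. (norm (g m x - f m x))\<^sup>2 \<partial>N) \<longlonglongrightarrow> 0"
  shows "l2_tendsto N g l"
proof -
  have sq: "sq_int N (f m)" "sq_int N l" for m using f by (auto simp: l2_tendsto_def)
  have "(\<integral>x. (norm (g m x - l x))\<^sup>2 \<partial>N) \<le> 2 * (\<integral>x. (norm (g m x - f m x))\<^sup>2 \<partial>N) + 2 * (\<integral>x. (norm (f m x - l x))\<^sup>2 \<partial>N)" for m
  proof -
    have "(norm (g m x - l x))\<^sup>2 \<le> 2 * (norm (g m x - f m x))\<^sup>2 + 2 * (norm (f m x - l x))\<^sup>2" for x
    proof -
      have "(norm (g m x - l x))\<^sup>2 \<le> (norm (g m x - f m x) + norm (f m x - l x))\<^sup>2"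
        by (intro power_mono) (auto intro: order_trans[OF _ norm_triangle_ineq])
      also have "\<dots> \<le> 2 * (norm (g m x - f m x))\<^sup>2 + 2 * (norm (f m x - l x))\<^sup>2"
        using sum_squares_bound[of "norm (g m x - f m x)" "norm (f m x - l x)"] by (simp add: power2_sum)
      finally show ?thesis .
    qed
    moreover have i: "integrable N (\<lambda>x. (norm (g m x - f m x))\<^sup>2)" "integrable N (\<lambda>x. (norm (f m x - l x))\<^sup>2)"
      "integrable N (\<lambda>x. (norm (g m x - l x))\<^sup>2)"
      by (intro sq_int_integrable_norm sq_int_diff sq g)+
    ultimately have "(\<integral>x. (norm (g m x - l x))\<^sup>2 \<partial>N) \<le> (\<integral>x. 2 * (norm (g m x - f m x))\<^sup>2 + 2 * (norm (f m x - l x))\<^sup>2 \<partial>N)"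
      by (intro integral_mono) auto
    with i show ?thesis by simp
  qed
  then have "norm (\<integral>x. (norm (g m x - l x))\<^sup>2 \<partial>N) \<le> 2 * (\<integral>x. (norm (g m x - f m x))\<^sup>2 \<partial>N) + 2 * (\<integral>x. (norm (f m x - l x))\<^sup>2 \<partial>N)" for m
    by simp
  moreover
  have "(\<lambda>m. 2 * (\<integral>x. (norm (g m x - f m x))\<^sup>2 \<partial>N) + 2 * (\<integral>x. (norm (f m x - l x))\<^sup>2 \<partial>N)) \<longlonglongrightarrow> 2 * 0 + 2 * 0"
    using f by (intro tendsto_intros fg) (auto simp: l2_tendsto_def)
  then have "(\<lambda>m. 2 * (\<integral>x. (norm (g m x - f m x))\<^sup>2 \<partial>N) + 2 * (\<integral>x. (norm (f m x - l x))\<^sup>2 \<partial>N)) \<longlonglongrightarrow> 0" by simp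
  ultimately have "(\<lambda>m. \<integral>x. (norm (g m x - l x))\<^sup>2 \<partial>N) \<longlonglongrightarrow> 0"
    by (rule Lim_null_comparison[OF always_eventually, OF allI])
  with sq g show ?thesis by (simp add: l2_tendsto_def)
qed

section \<open>Brownian increments\<close>

lemma natural_filtration_generators:
  "{W s -` S \<inter> space M | s S. s \<in> {0..t} \<and> S \<in> sets borel} \<subseteq> Pow (space M)"
  by auto

lemma space_natural_filtration [simp]: "space (natural_filtration M W t) = space M"
  by (simp add: natural_filtration_def space_measure_of_conv)

lemma space_augmented_filtration [simp]: "space (augmented_filtration M W t) = space M"
  by (simp add: augmented_filtration_def space_measure_of_conv)

lemma sets_natural_filtration:
  "sets (natural_filtration M W t) =
     sigma_sets (space M) {W s -` S \<inter> space M | s S. s \<in> {0..t} \<and> S \<in> sets borel}"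
  unfolding natural_filtration_def by (rule sets_measure_of[OF natural_filtration_generators])

lemma sets_augmented_filtration:
  "sets (augmented_filtration M W t) =
     sigma_sets (space M) (sets (natural_filtration M W t) \<union> null_sets M)"
  unfolding augmented_filtration_def
proof (rule sets_measure_of)
  show "sets (natural_filtration M W t) \<union> null_sets M \<subseteq> Pow (space M)"
    using sets.sets_into_space[of _ "natural_filtration M W t"] sets.sets_into_space[of _ M]
    by (auto simp: null_sets_def)
qed

lemma sets_augmented_filtration_mono:
  assumes "s \<le> t"
  shows "sets (augmented_filtration M W s) \<subseteq> sets (augmented_filtration M W t)"
proof -
  have "sets (natural_filtration M W s) \<subseteq> sets (natural_filtration M W t)"
    unfolding sets_natural_filtration
    by (rule sigma_sets_mono') (use assms in force)
  then show ?thesis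
    unfolding sets_augmented_filtration by (intro sigma_sets_mono') auto
qed

lemma vec_nth_borel_measurable [measurable]: "(\<lambda>x :: 'a::euclidean_space^'n. x $ i) \<in> borel_measurable borel"
  by (intro borel_measurable_continuous_onI continuous_intros)

lemma measurable_from_subalgebra:
  assumes "f \<in> measurable N K" "space N = space N'" "sets N \<subseteq> sets N'"
  shows "f \<in> measurable N' K"
  using assms by (auto simp: measurable_def)

section \<open>Augmented filtration and independence of increments\<close>

locale brownian = prob_space M for M :: "'w measure" +
  fixes T :: real and W :: "real \<Rightarrow> 'w \<Rightarrow> real^'d"
  assumes T_pos: "T > 0" and BM: "standard_brownian_motion M T W"
begin

abbreviation F :: "real \<Rightarrow> 'w measure" where
  "F t \<equiv> augmented_filtration M W t"

lemma W_measurable: "t \<in> {0..T} \<Longrightarrow> W t \<in> borel_measurable M"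
  using BM by (auto simp: standard_brownian_motion_def)

lemma sets_natural_filtration_subset:
  assumes "t \<le> T" shows "sets (natural_filtration M W t) \<subseteq> sets M"
  unfolding sets_natural_filtration
proof (rule sets.sigma_sets_subset, safe)
  fix s S assume "s \<in> {0..t}" "(S :: (real^'d) set) \<in> sets borel"
  then show "W s -` S \<inter> space M \<in> sets M"
    using W_measurable[of s] assms by (auto intro: measurable_sets)
qed

lemma sets_F_subset: "t \<le> T \<Longrightarrow> sets (F t) \<subseteq> sets M"
  unfolding sets_augmented_filtration
  by (rule sets.sigma_sets_subset) (use sets_natural_filtration_subset in \<open>auto simp: null_sets_def\<close>)

lemma F_measurable_mono:
  assumes "f \<in> measurable (F s) K" "s \<le> t"
  shows "f \<in> measurable (F t) K"
  by (rule measurable_from_subalgebra[OF assms(1) _ sets_augmented_filtration_mono[OF assms(2)]]) simp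

lemma F_measurable_M:
  assumes "f \<in> measurable (F s) K" "s \<le> T"
  shows "f \<in> measurable M K"
  by (rule measurable_from_subalgebra[OF assms(1) _ sets_F_subset[OF assms(2)]]) simp

lemma W_F_measurable: "0 \<le> s \<Longrightarrow> s \<le> t \<Longrightarrow> W s \<in> borel_measurable (F t)"
proof (rule measurableI)
  fix S :: "(real^'d) set" assume "0 \<le> s" "s \<le> t" "S \<in> sets borel"
  then have "W s -` S \<inter> space M \<in> sets (natural_filtration M W t)"
    unfolding sets_natural_filtration by (intro sigma_sets.Basic) auto
  then show "W s -` S \<inter> space (F t) \<in> sets (F t)"
    unfolding sets_augmented_filtration by (auto intro: sigma_sets.Basic)
qed auto

text \<open>The definition of Brownian motion grants independence from the natural filtration only.
  Null sets are independent of every event, and adjoining them leaves a family that is stable under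
  intersection, so independence extends to the sigma-algebra which it generates.\<close>

lemma indep_set_F_increment:
  assumes "0 \<le> s" "s < t" "t \<le> T"
  shows "indep_set (sets (F s))
    (sigma_sets (space M) {(\<lambda>\<omega>. W t \<omega> - W s \<omega>) -` S \<inter> space M | S. S \<in> sets borel})"
    (is "indep_set _ (sigma_sets _ ?I)")
  unfolding sets_augmented_filtration
proof (rule indep_set_sigma_sets)
  let ?N = "sets (natural_filtration M W s)"
  have ind: "indep_set ?N ?I"
    using BM assms by (auto simp: standard_brownian_motion_def)
  show "indep_set (?N \<union> null_sets M) ?I"
  proof (rule indep_setI)
    show "?N \<union> null_sets M \<subseteq> events" using indep_setD_ev1[OF ind] by (auto simp: null_sets_def)
    show I: "?I \<subseteq> events" by (rule indep_setD_ev2[OF ind])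
    fix a b assume a: "a \<in> ?N \<union> null_sets M" and b: "b \<in> ?I"
    show "prob (a \<inter> b) = prob a * prob b"
    proof (cases "a \<in> ?N")
      case True then show ?thesis using indep_setD[OF ind _ b] by auto
    next
      case False
      then have "a \<in> null_sets M" using a by auto
      moreover from this have "a \<inter> b \<in> null_sets M" using I b by (intro null_set_Int2) auto
      ultimately show ?thesis by (simp add: measure_eq_0_null_sets)
    qed
  qed
  show "Int_stable (?N \<union> null_sets M)"
  proof (rule Int_stableI)
    fix a b assume ab: "a \<in> ?N \<union> null_sets M" "b \<in> ?N \<union> null_sets M"
    have "?N \<subseteq> events" by (rule indep_setD_ev1[OF ind])
    with ab have ev: "a \<in> events" "b \<in> events" by (auto simp: null_sets_def)
    consider "a \<in> ?N" "b \<in> ?N" | "a \<in> null_sets M" | "b \<in> null_sets M" using ab by auto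
    then show "a \<inter> b \<in> ?N \<union> null_sets M"
      using ev by cases (auto intro: null_set_Int1 null_set_Int2)
  qed
  show "Int_stable ?I"
  proof (rule Int_stableI, safe)
    fix S S' :: "(real^'d) set" assume "S \<in> sets borel" "S' \<in> sets borel"
    then show "\<exists>S''. (\<lambda>\<omega>. W t \<omega> - W s \<omega>) -` S \<inter> space M \<inter> ((\<lambda>\<omega>. W t \<omega> - W s \<omega>) -` S' \<inter> space M) =
      (\<lambda>\<omega>. W t \<omega> - W s \<omega>) -` S'' \<inter> space M \<and> S'' \<in> sets borel"
      by (intro exI[of _ "S \<inter> S'"]) auto
  qed
qed

text \<open>\<open>g\<close> will be a coordinate, or a product of two coordinates, of the
  increment; these choices yield the first and second conditional moments.\<close>

lemma indep_var_F_increment: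
  fixes f :: "'w \<Rightarrow> real" and g :: "real^'d \<Rightarrow> real"
  assumes st: "0 \<le> s" "s < t" "t \<le> T"
    and f: "f \<in> borel_measurable (F s)" and g: "g \<in> borel_measurable borel"
  shows "indep_var borel f borel (\<lambda>\<omega>. g (W t \<omega> - W s \<omega>))"
  unfolding indep_var_eq
proof (intro conjI)
  show "f \<in> borel_measurable M" using F_measurable_M[OF f] st by simp
  have [measurable]: "W t \<in> borel_measurable M" "W s \<in> borel_measurable M" "g \<in> borel_measurable borel"
    using W_measurable st g by auto
  show "(\<lambda>\<omega>. g (W t \<omega> - W s \<omega>)) \<in> borel_measurable M" by measurable
  note ind = indep_set_F_increment[OF st]
  let ?I = "{(\<lambda>\<omega>. W t \<omega> - W s \<omega>) -` S \<inter> space M | S. S \<in> sets borel}"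
  have 1: "sigma_sets (space M) {f -` A \<inter> space M |A. A \<in> sets borel} \<subseteq> sets (F s)"
    using sets.sigma_sets_subset[of "{f -` A \<inter> space M |A. A \<in> sets borel}" "F s"] measurable_sets[OF f]
    by auto
  have 2: "sigma_sets (space M) {(\<lambda>\<omega>. g (W t \<omega> - W s \<omega>)) -` A \<inter> space M |A. A \<in> sets borel} \<subseteq> sigma_sets (space M) ?I"
  proof (rule sigma_sets_mono', safe)
    fix A :: "real set" assume "A \<in> sets borel"
    then have "g -` A \<in> sets borel" using measurable_sets[OF g] by simp
    then show "\<exists>S. (\<lambda>\<omega>. g (W t \<omega> - W s \<omega>)) -` A \<inter> space M = (\<lambda>\<omega>. W t \<omega> - W s \<omega>) -` S \<inter> space M \<and> S \<in> sets borel"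
      by (intro exI[of _ "g -` A"]) auto
  qed
  show "indep_set (sigma_sets (space M) {f -` A \<inter> space M |A. A \<in> sets borel})
     (sigma_sets (space M) {(\<lambda>\<omega>. g (W t \<omega> - W s \<omega>)) -` A \<inter> space M |A. A \<in> sets borel})"
  proof (rule indep_setI)
    show "sigma_sets (space M) {f -` A \<inter> space M |A. A \<in> sets borel} \<subseteq> events"
      using 1 sets_F_subset[of s] st by auto
    show "sigma_sets (space M) {(\<lambda>\<omega>. g (W t \<omega> - W s \<omega>)) -` A \<inter> space M |A. A \<in> sets borel} \<subseteq> events"
      using 2 indep_setD_ev2[OF ind] by auto
  qed (use 1 2 indep_setD[OF ind] in blast)
qed

section \<open>Moments and covariances of increments\<close>

definition dW :: "'d \<Rightarrow> real \<Rightarrow> real \<Rightarrow> 'w \<Rightarrow> real" where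
  "dW i s t \<omega> = W t \<omega> $ i - W s \<omega> $ i"

lemma dW_same [simp]: "dW i s s \<omega> = 0" by (simp add: dW_def)

lemma dW_F_measurable:
  assumes "0 \<le> s" "s \<le> r" "0 \<le> t" "t \<le> r"
  shows "dW i s t \<in> borel_measurable (F r)"
  unfolding dW_def[abs_def]
  by (rule borel_measurable_diff; rule measurable_compose[OF W_F_measurable vec_nth_borel_measurable]; fact)

text \<open>\<open>s < t\<close> makes the standard deviation positive, so that the normal moment
  formulas apply; empty intervals are treated apart through \<open>dW_same\<close>.\<close>

lemma dW_moments:
  assumes st: "0 \<le> s" "s < t" "t \<le> T"
  shows "integrable M (dW i s t)" "integrable M (\<lambda>\<omega>. (dW i s t \<omega>)\<^sup>2)"
    "(\<integral>\<omega>. dW i s t \<omega> \<partial>M) = 0" "(\<integral>\<omega>. (dW i s t \<omega>)\<^sup>2 \<partial>M) = t - s"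
proof -
  have D: "distributed M lborel (dW i s t) (\<lambda>x. ennreal (normal_density 0 (sqrt (t - s)) x))"
    using BM st unfolding standard_brownian_motion_def dW_def[abs_def] by auto
  have pos: "0 < sqrt (t - s)" using st by simp
  show "integrable M (dW i s t)"
    using distributed_integrable[OF D, of "\<lambda>x. x"] integrable_normal_moment_nz_1[OF pos, of 0] by simp
  show "integrable M (\<lambda>\<omega>. (dW i s t \<omega>)\<^sup>2)"
    using distributed_integrable[OF D, of "\<lambda>x. x\<^sup>2"] integrable_normal_moment[OF pos, of 0 2] by simp
  show "(\<integral>\<omega>. dW i s t \<omega> \<partial>M) = 0"
    using distributed_integral[OF D, of "\<lambda>x. x"] integral_normal_moment_nz_1[OF pos, of 0] by simp
  show "(\<integral>\<omega>. (dW i s t \<omega>)\<^sup>2 \<partial>M) = t - s"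
    using distributed_integral[OF D, of "\<lambda>x. x\<^sup>2"] integral_normal_moment_even[OF pos, of 0 1] st by simp
qed

lemma sq_int_dW:
  assumes "0 \<le> s" "s \<le> t" "t \<le> T" shows "sq_int M (dW i s t)"
proof (cases "s = t")
  case True
  then have "dW i s t = (\<lambda>_. 0)" by auto
  then show ?thesis by (simp add: sq_int_zero)
next
  case False
  then show ?thesis using assms dW_moments(2)[of s t i] F_measurable_M[OF dW_F_measurable[of s t t i]]
    by (auto simp: sq_int_def)
qed

lemma dW_cov:
  assumes st: "0 \<le> s" "s < t" "t \<le> T" and ij: "i \<noteq> j"
  shows "(\<integral>\<omega>. dW i s t \<omega> * dW j s t \<omega> \<partial>M) = 0"
proof -
  have "indep_vars (\<lambda>_. borel) (\<lambda>i \<omega>. (W t \<omega> - W s \<omega>) $ i) UNIV"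
    using BM st unfolding standard_brownian_motion_def by auto
  from indep_vars_subset[OF this, of "{i, j}"] have "indep_vars (\<lambda>_. borel) (\<lambda>i. dW i s t) {i, j}"
    by (simp add: dW_def[abs_def])
  from indep_vars_lebesgue_integral[OF _ this] show ?thesis
    using ij dW_moments[OF st] by simp
qed

text \<open>Independence factors the expectation, and the increment is centred. Integrability of the
  product also comes from independence, with \<open>f\<close> merely integrable.\<close>

lemma integral_F_dW:
  assumes st: "0 \<le> s" "s \<le> t" "t \<le> T"
    and f: "f \<in> borel_measurable (F s)" "integrable M f"
  shows "integrable M (\<lambda>\<omega>. f \<omega> * dW i s t \<omega>)" "(\<integral>\<omega>. f \<omega> * dW i s t \<omega> \<partial>M) = 0"
proof -
  have "integrable M (\<lambda>\<omega>. f \<omega> * dW i s t \<omega>) \<and> (\<integral>\<omega>. f \<omega> * dW i s t \<omega> \<partial>M) = 0"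
  proof (cases "s = t")
    case False
    with st have st': "s < t" by simp
    have iv: "indep_var borel f borel (dW i s t)"
      using indep_var_F_increment[OF st(1) st' st(3) f(1), of "\<lambda>x. x $ i"]
      by (simp add: dW_def[abs_def])
    show ?thesis
      using indep_var_integrable[OF iv f(2) dW_moments(1)[OF st(1) st' st(3)]]
        indep_var_lebesgue_integral[OF iv f(2) dW_moments(1)[OF st(1) st' st(3)]]
        dW_moments(3)[OF st(1) st' st(3)] by simp
  qed auto
  then show "integrable M (\<lambda>\<omega>. f \<omega> * dW i s t \<omega>)" "(\<integral>\<omega>. f \<omega> * dW i s t \<omega> \<partial>M) = 0" by auto
qed

lemma integral_F_dW_dW:
  assumes st: "0 \<le> s" "s \<le> t" "t \<le> T"
    and f: "f \<in> borel_measurable (F s)" "integrable M f"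
  shows "(\<integral>\<omega>. f \<omega> * (dW i s t \<omega> * dW j s t \<omega>) \<partial>M) = (if i = j then t - s else 0) * (\<integral>\<omega>. f \<omega> \<partial>M)"
proof (cases "s = t")
  case False
  with st have st': "s < t" by simp
  have iv: "indep_var borel f borel (\<lambda>\<omega>. dW i s t \<omega> * dW j s t \<omega>)"
    using indep_var_F_increment[OF st(1) st' st(3) f(1), of "\<lambda>x. x $ i * x $ j"]
    by (simp add: dW_def[abs_def])
  have "integrable M (\<lambda>\<omega>. dW i s t \<omega> * dW j s t \<omega>)"
    by (intro sq_int_prod_integrable sq_int_dW st)
  from indep_var_lebesgue_integral[OF iv f(2) this] show ?thesis
    using dW_moments(4)[OF st(1) st' st(3), of i] dW_cov[OF st(1) st' st(3), of i j]
    by (auto simp: power2_eq_square)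
qed auto

lemma dW_add: "dW i a c \<omega> = dW i a b \<omega> + dW i b c \<omega>" by (simp add: dW_def)

lemma integrable_bounded_mult:
  fixes f g :: "'w \<Rightarrow> real"
  assumes "f \<in> borel_measurable M" "\<And>\<omega>. \<omega> \<in> space M \<Longrightarrow> \<bar>f \<omega>\<bar> \<le> C" "integrable M g"
  shows "integrable M (\<lambda>\<omega>. f \<omega> * g \<omega>)"
proof -
  have "integrable M (\<lambda>\<omega>. C * g \<omega>)" using assms by simp
  then show ?thesis
  proof (rule Bochner_Integration.integrable_bound)
    show "(\<lambda>\<omega>. f \<omega> * g \<omega>) \<in> borel_measurable M" using assms by measurable
    show "AE \<omega> in M. norm (f \<omega> * g \<omega>) \<le> norm (C * g \<omega>)"
      using assms(2) by (intro AE_I2) (auto simp: abs_mult intro!: mult_right_mono intro: order_trans[OF _ abs_ge_self[of C]])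
  qed
qed

text \<open>Cutting the two intervals at the larger left and the smaller right endpoint yields the
  isometry for step processes over different partitions without a common refinement.\<close>

lemma integral_F_dW_dW_intervals_aux:
  assumes ab: "0 \<le> a" "a \<le> b" "b \<le> T" and cd: "a \<le> c" "c \<le> d" "d \<le> T"
    and f: "f \<in> borel_measurable (F c)" and bd: "\<And>\<omega>. \<omega> \<in> space M \<Longrightarrow> \<bar>f \<omega>\<bar> \<le> C"
  shows "(\<integral>\<omega>. f \<omega> * (dW i a b \<omega> * dW j c d \<omega>) \<partial>M) =
    (if i = j then max 0 (min b d - max a c) else 0) * (\<integral>\<omega>. f \<omega> \<partial>M)"
proof -
  have fM: "f \<in> borel_measurable M" using F_measurable_M[OF f] cd by simp
  have fb: "integrable M (\<lambda>\<omega>. f \<omega> * g \<omega>)" if "integrable M g" for g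
    using fM bd that by (rule integrable_bounded_mult)
  have fi: "integrable M f" using fb[of "\<lambda>_. 1"] by simp
  have fdd: "integrable M (\<lambda>\<omega>. f \<omega> * (dW k s t \<omega> * dW l x y \<omega>))"
    if "0 \<le> s" "s \<le> t" "t \<le> T" "0 \<le> x" "x \<le> y" "y \<le> T" for k l s t x y
    using that by (intro fb sq_int_prod_integrable sq_int_dW)
  \<comment> \<open>The increment over \<open>{x..y}\<close> begins when the other two factors are
    already known, so \<open>integral_F_dW\<close> makes the expectation vanish.\<close>
  have early: "(\<integral>\<omega>. f \<omega> * (dW k s t \<omega> * dW l x y \<omega>) \<partial>M) = 0"
    if "0 \<le> s" "s \<le> t" "t \<le> x" "c \<le> x" "x \<le> y" "y \<le> T" for k l s t x y
  proof -
    have "(\<lambda>\<omega>. f \<omega> * dW k s t \<omega>) \<in> borel_measurable (F x)"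
      using that F_measurable_mono[OF f \<open>c \<le> x\<close>] by (intro borel_measurable_times dW_F_measurable) auto
    moreover have "integrable M (\<lambda>\<omega>. f \<omega> * dW k s t \<omega>)"
      using that by (intro fb sq_int_integrable sq_int_dW) auto
    ultimately show ?thesis
      using integral_F_dW(2)[of x y "\<lambda>\<omega>. f \<omega> * dW k s t \<omega>" l] that by (simp add: mult.assoc)
  qed
  show ?thesis
  proof (cases "b \<le> c")
    case True
    then show ?thesis using early[of a b c d i j] ab cd by simp
  next
    case False
    define m where "m = min b d"
    have m: "c \<le> m" "m \<le> b" "m \<le> d" using False cd by (auto simp: m_def)
    \<comment> \<open>Cuts at \<open>c\<close>, which is the larger left endpoint because
      \<open>a \<le> c\<close>, and at \<open>m\<close>. Only the common interval
      \<open>{c..m}\<close> will contribute, and its length is the overlap.\<close>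
    have eq: "f \<omega> * (dW i a b \<omega> * dW j c d \<omega>) = f \<omega> * (dW i a c \<omega> * dW j c d \<omega>)
       + f \<omega> * (dW i c m \<omega> * dW j c m \<omega>) + f \<omega> * (dW i c m \<omega> * dW j m d \<omega>)
       + f \<omega> * (dW i m b \<omega> * dW j c d \<omega>)" for \<omega>
      unfolding dW_add[of i a b \<omega> c] dW_add[of i c b \<omega> m] dW_add[of j c d \<omega> m]
      by (simp add: algebra_simps)
    have "(\<integral>\<omega>. f \<omega> * (dW i a b \<omega> * dW j c d \<omega>) \<partial>M) = (\<integral>\<omega>. f \<omega> * (dW i a c \<omega> * dW j c d \<omega>) \<partial>M)
       + (\<integral>\<omega>. f \<omega> * (dW i c m \<omega> * dW j c m \<omega>) \<partial>M) + (\<integral>\<omega>. f \<omega> * (dW i c m \<omega> * dW j m d \<omega>) \<partial>M)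
       + (\<integral>\<omega>. f \<omega> * (dW i m b \<omega> * dW j c d \<omega>) \<partial>M)"
      unfolding eq using ab cd m False
      by (simp add: fdd)
    also have "(\<integral>\<omega>. f \<omega> * (dW i a c \<omega> * dW j c d \<omega>) \<partial>M) = 0" using ab cd by (intro early) auto
    also have "(\<integral>\<omega>. f \<omega> * (dW i c m \<omega> * dW j m d \<omega>) \<partial>M) = 0" using ab cd m by (intro early) auto
    \<comment> \<open>The piece \<open>{m..b}\<close> is either empty or starts where
      \<open>{c..d}\<close> ends; in the second case the two increments exchange roles in
      \<open>early\<close>.\<close>
    also have "(\<integral>\<omega>. f \<omega> * (dW i m b \<omega> * dW j c d \<omega>) \<partial>M) = 0"
    proof (cases "m = b")
      case False
      then have "m = d" by (auto simp: m_def)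
      then show ?thesis using early[of c d m b j i] ab cd m by (simp add: mult.commute)
    qed simp
    also have "(\<integral>\<omega>. f \<omega> * (dW i c m \<omega> * dW j c m \<omega>) \<partial>M) = (if i = j then m - c else 0) * (\<integral>\<omega>. f \<omega> \<partial>M)"
      using ab cd m f fi by (intro integral_F_dW_dW) auto
    finally show ?thesis using m cd by (simp add: m_def)
  qed
qed

lemma integral_F_dW_dW_intervals:
  assumes ab: "0 \<le> a" "a \<le> b" "b \<le> T" and cd: "0 \<le> c" "c \<le> d" "d \<le> T"
    and f: "f \<in> borel_measurable (F (max a c))" and bd: "\<And>\<omega>. \<omega> \<in> space M \<Longrightarrow> \<bar>f \<omega>\<bar> \<le> C"
  shows "(\<integral>\<omega>. f \<omega> * (dW i a b \<omega> * dW j c d \<omega>) \<partial>M) =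
    (if i = j then max 0 (min b d - max a c) else 0) * (\<integral>\<omega>. f \<omega> \<partial>M)"
proof (cases "a \<le> c")
  case True
  then show ?thesis using integral_F_dW_dW_intervals_aux[OF ab True cd(2,3), of f C i j] f bd by simp
next
  case False
  then show ?thesis using integral_F_dW_dW_intervals_aux[OF cd, of a b f C j i] ab f bd
    by (simp add: mult.commute[of "dW i a b _"] min.commute max.commute[of c] eq_commute[of i] max_def split: if_splits)
qed

section \<open>The product of time and scenarios, and step processes on it\<close>

abbreviation \<mu> :: "real measure" where "\<mu> \<equiv> restrict_space lborel {0..T}"

abbreviation \<mu>M :: "(real \<times> 'w) measure" where "\<mu>M \<equiv> \<mu> \<Otimes>\<^sub>M M"

lemma space_\<mu> [simp]: "space \<mu> = {0..T}" by simp

lemma emeasure_\<mu>: "A \<in> sets borel \<Longrightarrow> A \<subseteq> {0..T} \<Longrightarrow> emeasure \<mu> A = emeasure lborel A"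
  by (subst emeasure_restrict_space) auto

lemma finite_measure_\<mu>: "finite_measure \<mu>"
  using T_pos by (intro finite_measureI) (simp add: emeasure_\<mu>)

sublocale time: finite_measure \<mu> by (rule finite_measure_\<mu>)

sublocale TM: pair_sigma_finite \<mu> M ..

lemma finite_measure_\<mu>M: "finite_measure \<mu>M"
  by (rule finite_measure_pair_measure[OF finite_measure_axioms finite_measure_\<mu>])

sublocale TM: finite_measure \<mu>M by (rule finite_measure_\<mu>M)

text \<open>Processes are declared measurable over \<open>restrict_space borel\<close>, while
  integrals in time use \<open>lborel\<close>; the two have the same measurable sets.\<close>

lemma measurable_\<mu>_eq: "measurable \<mu> N = measurable (restrict_space borel {0..T}) N"
  by (intro measurable_cong_sets sets_restrict_space_cong) auto

lemma measurable_\<mu>M_eq: "measurable \<mu>M N = measurable (restrict_space borel {0..T} \<Otimes>\<^sub>M M) N"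
  by (intro measurable_cong_sets sets_pair_measure_cong sets_restrict_space_cong) auto

lemma id_\<mu>_measurable: "(\<lambda>x. x) \<in> borel_measurable \<mu>"
  by (intro measurable_restrict_space1) simp

lemma fst_\<mu>M_measurable [measurable]: "fst \<in> borel_measurable \<mu>M"
  using measurable_compose[OF measurable_fst id_\<mu>_measurable, of M] by simp

lemma measure_\<mu>_interval:
  assumes "0 \<le> a" "b \<le> T"
  shows "measure \<mu> {a<..b} = max 0 (b - a)"
  using assms by (simp add: measure_def emeasure_\<mu> subset_eq max_def)

text \<open>The intervals need not form a partition, so that truncating all of them at a time \<open>r\<close>
  stays within the class.\<close>

definition step_family :: "nat \<Rightarrow> (nat \<Rightarrow> real) \<Rightarrow> (nat \<Rightarrow> real) \<Rightarrow> (nat \<Rightarrow> 'w \<Rightarrow> 'a::euclidean_space) \<Rightarrow> bool" where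
  "step_family N a b \<xi> \<longleftrightarrow> (\<forall>j<N. 0 \<le> a j \<and> a j \<le> b j \<and> b j \<le> T \<and>
     \<xi> j \<in> borel_measurable (F (a j)) \<and> bounded (\<xi> j ` space M))"

definition step_integral :: "'d \<Rightarrow> nat \<Rightarrow> (nat \<Rightarrow> real) \<Rightarrow> (nat \<Rightarrow> real) \<Rightarrow> (nat \<Rightarrow> 'w \<Rightarrow> 'a::euclidean_space) \<Rightarrow> 'w \<Rightarrow> 'a" where
  "step_integral i N a b \<xi> \<omega> = (\<Sum>j<N. dW i (a j) (b j) \<omega> *\<^sub>R \<xi> j \<omega>)"

definition step_process :: "nat \<Rightarrow> (nat \<Rightarrow> real) \<Rightarrow> (nat \<Rightarrow> real) \<Rightarrow> (nat \<Rightarrow> 'w \<Rightarrow> 'a::euclidean_space) \<Rightarrow> real \<times> 'w \<Rightarrow> 'a" where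
  "step_process N a b \<xi> z = (\<Sum>j<N. indicator {a j<..b j} (fst z) *\<^sub>R \<xi> j (snd z))"

lemma step_familyD:
  assumes "step_family N a b \<xi>" "j < N"
  shows "0 \<le> a j" "a j \<le> b j" "b j \<le> T" "\<xi> j \<in> borel_measurable (F (a j))"
    "\<xi> j \<in> borel_measurable M" "\<exists>C. \<forall>\<omega>\<in>space M. norm (\<xi> j \<omega>) \<le> C"
  using assms F_measurable_M[of "\<xi> j" "a j" borel]
  by (auto simp: step_family_def bounded_iff)

lemma sq_int_bounded_scale:
  fixes f :: "'x \<Rightarrow> real"
  assumes "sq_int N f" "g \<in> borel_measurable N" "\<forall>\<omega>\<in>space N. norm (g \<omega>) \<le> C"
  shows "sq_int N (\<lambda>\<omega>. f \<omega> *\<^sub>R g \<omega>)"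
proof (rule sq_int_bound[OF assms(1)])
  show "(\<lambda>\<omega>. f \<omega> *\<^sub>R g \<omega>) \<in> borel_measurable N"
    by (intro borel_measurable_scaleR sq_int_measurable assms(1) assms(2))
  show "AE x in N. norm (f x *\<^sub>R g x) \<le> C * norm (f x)"
    using assms(3) by (intro AE_I2) (simp add: mult.commute[of C] mult_left_mono)
qed

lemma sq_int_dW_scale:
  assumes "0 \<le> s" "s \<le> t" "t \<le> T" "g \<in> borel_measurable M" "\<forall>\<omega>\<in>space M. norm (g \<omega>) \<le> C"
  shows "sq_int M (\<lambda>\<omega>. dW i s t \<omega> *\<^sub>R g \<omega>)"
  by (rule sq_int_bounded_scale[OF sq_int_dW[OF assms(1-3)] assms(4,5)])

lemma step_integral_sq_int:
  assumes "step_family N a b \<xi>"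
  shows "sq_int M (step_integral i N a b \<xi>)"
  unfolding step_integral_def[abs_def]
proof (rule sq_int_sum)
  fix j assume "j \<in> {..<N}"
  then have j: "j < N" by simp
  obtain C where C: "\<forall>\<omega>\<in>space M. norm (\<xi> j \<omega>) \<le> C" using step_familyD(6)[OF assms j] by auto
  show "sq_int M (\<lambda>\<omega>. dW i (a j) (b j) \<omega> *\<^sub>R \<xi> j \<omega>)"
    by (rule sq_int_dW_scale[OF step_familyD(1,2,3,5)[OF assms j] C])
qed

lemma indicator_fst_measurable [measurable]: "A \<in> sets borel \<Longrightarrow> (\<lambda>z. indicator A (fst z) :: real) \<in> borel_measurable \<mu>M"
  by (rule measurable_compose[OF fst_\<mu>M_measurable]) simp

lemma sq_int_indicator_scale:
  fixes f :: "real \<times> 'w \<Rightarrow> 'a::euclidean_space"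
  assumes "sq_int \<mu>M f" "A \<in> sets borel"
  shows "sq_int \<mu>M (\<lambda>z. indicator A (fst z) *\<^sub>R f z)"
proof (rule sq_int_bound[OF assms(1), where C=1])
  show "(\<lambda>z. indicator A (fst z) *\<^sub>R f z) \<in> borel_measurable \<mu>M"
    by (intro borel_measurable_scaleR sq_int_measurable assms(1) indicator_fst_measurable assms(2))
qed (auto simp: indicator_def)

lemma step_process_sq_int:
  assumes "step_family N a b \<xi>"
  shows "sq_int \<mu>M (step_process N a b \<xi>)"
  unfolding step_process_def[abs_def]
proof (rule sq_int_sum)
  fix j assume "j \<in> {..<N}"
  then have j: "j < N" by simp
  obtain C where C: "\<forall>\<omega>\<in>space M. norm (\<xi> j \<omega>) \<le> C" using step_familyD(6)[OF assms j] by auto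
  have "sq_int \<mu>M (\<lambda>z. \<xi> j (snd z))"
  proof (rule TM.sq_int_bounded)
    show "(\<lambda>z. \<xi> j (snd z)) \<in> borel_measurable \<mu>M"
      by (rule measurable_compose[OF measurable_snd step_familyD(5)[OF assms j]])
  qed (use C in \<open>auto simp: space_pair_measure\<close>)
  then show "sq_int \<mu>M (\<lambda>z. indicator {a j<..b j} (fst z) *\<^sub>R \<xi> j (snd z))"
    by (rule sq_int_indicator_scale) simp
qed

text \<open>Half-open intervals intersect in a half-open interval, whose length
  \<open>max 0 (min b d - max a c)\<close> is the very factor found for increments in
  \<open>integral_F_dW_dW_intervals\<close>. The isometry can thus be checked summand by
  summand.\<close>

lemma integral_indicators_times:
  fixes f :: "'w \<Rightarrow> real"
  assumes ab: "0 \<le> a" "b \<le> T" and cd: "0 \<le> c" "d \<le> T" and f: "integrable M f"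
  shows "integrable \<mu>M (\<lambda>z. indicator {a<..b} (fst z) * indicator {c<..d} (fst z) * f (snd z))"
    "(\<integral>z. indicator {a<..b} (fst z) * indicator {c<..d} (fst z) * f (snd z) \<partial>\<mu>M)
      = max 0 (min b d - max a c) * (\<integral>\<omega>. f \<omega> \<partial>M)"
proof -
  have eq: "indicator {a<..b} x * indicator {c<..d} x = (indicator {max a c<..min b d} x :: real)" for x
    by (auto simp: indicator_def)
  have fm: "f \<in> borel_measurable M" using f by simp
  have m: "(\<lambda>z. indicator {max a c<..min b d} (fst z) * f (snd z)) \<in> borel_measurable \<mu>M"
    by (intro borel_measurable_times indicator_fst_measurable measurable_compose[OF measurable_snd fm]) simp
  have "integrable \<mu>M (\<lambda>z. indicator {max a c<..min b d} (fst z) * f (snd z))"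
  proof (rule TM.Fubini_integrable[OF m])
    have "integrable \<mu> (\<lambda>x. indicator {max a c<..min b d} x * (\<integral>y. \<bar>f y\<bar> \<partial>M))"
      by (intro integrable_mult_left time.integrable_const_bound[where B=1] measurable_compose[OF id_\<mu>_measurable])
         auto
    then show "integrable \<mu> (\<lambda>x. \<integral>y. norm (indicator {max a c<..min b d} (fst (x, y)) * f (snd (x, y))) \<partial>M)"
      by (simp add: abs_mult)
  qed (use f in auto)
  note i = this
  then show "integrable \<mu>M (\<lambda>z. indicator {a<..b} (fst z) * indicator {c<..d} (fst z) * f (snd z))"
    by (simp add: eq)
  have "(\<integral>z. indicator {max a c<..min b d} (fst z) * f (snd z) \<partial>\<mu>M)
     = (\<integral>x. \<integral>y. indicator {max a c<..min b d} x * f y \<partial>M \<partial>\<mu>)"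
    using TM.integral_fst'[OF i] by simp
  also have "\<dots> = (\<integral>x. indicator {max a c<..min b d} x \<partial>\<mu>) * (\<integral>\<omega>. f \<omega> \<partial>M)"
    by simp
  also have "(\<integral>x. indicator {max a c<..min b d} x \<partial>\<mu>) = measure \<mu> {max a c<..min b d}"
    using ab cd by (subst Bochner_Integration.integral_indicator) (auto intro!: arg_cong[where f="measure \<mu>"])
  also have "\<dots> = max 0 (min b d - max a c)"
    using ab cd by (intro measure_\<mu>_interval) auto
  finally show "(\<integral>z. indicator {a<..b} (fst z) * indicator {c<..d} (fst z) * f (snd z) \<partial>\<mu>M)
      = max 0 (min b d - max a c) * (\<integral>\<omega>. f \<omega> \<partial>M)" by (simp add: eq)
qed

text \<open>Both pairings expand into double sums over
  \<open>B (\<xi> j \<omega>) (\<xi>' k \<omega>)\<close>, a bounded variable known at the later of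
  the two left endpoints, and on both sides each summand carries the overlap length of its two
  intervals. \<open>B\<close> is an arbitrary bounded bilinear form because the quadratic form of a
  matrix is wanted later, besides the inner product.\<close>

lemma step_isometry:
  fixes B :: "'a::euclidean_space \<Rightarrow> 'b::euclidean_space \<Rightarrow> real"
  assumes B: "bounded_bilinear B" and f: "step_family N a b \<xi>" and g: "step_family N' a' b' \<xi>'"
  shows "(\<integral>\<omega>. B (step_integral i N a b \<xi> \<omega>) (step_integral i' N' a' b' \<xi>' \<omega>) \<partial>M) =
    (if i = i' then (\<integral>z. B (step_process N a b \<xi> z) (step_process N' a' b' \<xi>' z) \<partial>\<mu>M) else 0)"
proof -
  interpret bounded_bilinear B by fact
  define h where "h j k \<omega> = B (\<xi> j \<omega>) (\<xi>' k \<omega>)" for j k \<omega>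
  note fD = step_familyD[OF f] and gD = step_familyD[OF g]
  let ?w = "\<lambda>j k \<omega>. dW i (a j) (b j) \<omega> * dW i' (a' k) (b' k) \<omega>"
    and ?l = "\<lambda>j k. max 0 (min (b j) (b' k) - max (a j) (a' k))"
  have hF: "h j k \<in> borel_measurable (F (max (a j) (a' k)))" if "j < N" "k < N'" for j k
    unfolding h_def[abs_def]
    using F_measurable_mono[OF fD(4)[OF that(1)], of "max (a j) (a' k)"] F_measurable_mono[OF gD(4)[OF that(2)], of "max (a j) (a' k)"]
    by (intro bounded_bilinear_measurable[OF B]) auto
  have hb: "\<exists>C. \<forall>\<omega>\<in>space M. \<bar>h j k \<omega>\<bar> \<le> C" if "j < N" "k < N'" for j k
  proof -
    obtain C where C: "\<forall>\<omega>\<in>space M. norm (\<xi> j \<omega>) \<le> C" using fD(6) \<open>j < N\<close> by blast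
    obtain D where D: "\<forall>\<omega>\<in>space M. norm (\<xi>' k \<omega>) \<le> D" using gD(6) \<open>k < N'\<close> by blast
    obtain K where K: "0 \<le> K" "\<And>a b. norm (B a b) \<le> norm a * norm b * K" using nonneg_bounded by blast
    have "\<bar>h j k \<omega>\<bar> \<le> C * D * K" if "\<omega> \<in> space M" for \<omega>
    proof -
      have "\<bar>h j k \<omega>\<bar> \<le> norm (\<xi> j \<omega>) * norm (\<xi>' k \<omega>) * K" using K(2) by (simp add: h_def)
      also have "\<dots> \<le> C * D * K"
        using C D K(1) that by (intro mult_right_mono mult_mono) (auto intro: order_trans[OF norm_ge_zero])
      finally show ?thesis .
    qed
    then show ?thesis by blast
  qed
  have hM: "h j k \<in> borel_measurable M" if "j < N" "k < N'" for j k
    using F_measurable_M[OF hF[OF that]] fD(2,3)[OF that(1)] gD(2,3)[OF that(2)] by simp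
  have hi: "integrable M (\<lambda>\<omega>. h j k \<omega> * g \<omega>)" if "j < N" "k < N'" "integrable M g" for j k g
    using hb[OF that(1,2)] integrable_bounded_mult[OF hM[OF that(1,2)] _ that(3)] by blast
  have hi1: "integrable M (h j k)" if "j < N" "k < N'" for j k
    using hi[OF that, of "\<lambda>_. 1"] by simp
  have "(\<integral>\<omega>. B (step_integral i N a b \<xi> \<omega>) (step_integral i' N' a' b' \<xi>' \<omega>) \<partial>M) =
     (\<integral>\<omega>. (\<Sum>j<N. \<Sum>k<N'. h j k \<omega> * ?w j k \<omega>) \<partial>M)"
    unfolding step_integral_def sum_left unfolding sum_right scaleR_left scaleR_right h_def
    by (intro Bochner_Integration.integral_cong refl sum.cong) (simp add: ac_simps)
  also have "\<dots> = (\<Sum>j<N. \<Sum>k<N'. (\<integral>\<omega>. h j k \<omega> * ?w j k \<omega> \<partial>M))"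
  proof -
    have I: "integrable M (\<lambda>\<omega>. h j k \<omega> * ?w j k \<omega>)"
      if "j < N" "k < N'" for j k
      using fD(1-3)[OF that(1)] gD(1-3)[OF that(2)] that
      by (intro hi sq_int_prod_integrable sq_int_dW) auto
    have "integrable M (\<lambda>\<omega>. \<Sum>k<N'. h j k \<omega> * ?w j k \<omega>)" if "j < N" for j
      using I that by (intro Bochner_Integration.integrable_sum) auto
    then have "(\<integral>\<omega>. (\<Sum>j<N. \<Sum>k<N'. h j k \<omega> * ?w j k \<omega>) \<partial>M)
      = (\<Sum>j<N. (\<integral>\<omega>. (\<Sum>k<N'. h j k \<omega> * ?w j k \<omega>) \<partial>M))"
      by (intro Bochner_Integration.integral_sum) auto
    also have "\<dots> = (\<Sum>j<N. \<Sum>k<N'. (\<integral>\<omega>. h j k \<omega> * ?w j k \<omega> \<partial>M))"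
      using I by (intro sum.cong refl Bochner_Integration.integral_sum) auto
    finally show ?thesis .
  qed
  also have "\<dots> = (\<Sum>j<N. \<Sum>k<N'. (if i = i' then ?l j k else 0) * (\<integral>\<omega>. h j k \<omega> \<partial>M))"
  proof (intro sum.cong refl)
    fix j k assume "j \<in> {..<N}" "k \<in> {..<N'}"
    then have jk: "j < N" "k < N'" by auto
    from hb[OF this] obtain C where C: "\<And>\<omega>. \<omega> \<in> space M \<Longrightarrow> \<bar>h j k \<omega>\<bar> \<le> C" by blast
    show "(\<integral>\<omega>. h j k \<omega> * ?w j k \<omega> \<partial>M) =
      (if i = i' then ?l j k else 0) * (\<integral>\<omega>. h j k \<omega> \<partial>M)"
      by (rule integral_F_dW_dW_intervals[OF fD(1-3)[OF jk(1)] gD(1-3)[OF jk(2)] hF[OF jk] C])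
  qed
  also have "\<dots> = (if i = i' then (\<Sum>j<N. \<Sum>k<N'. ?l j k * (\<integral>\<omega>. h j k \<omega> \<partial>M)) else 0)"
    by simp
  also have "(\<Sum>j<N. \<Sum>k<N'. ?l j k * (\<integral>\<omega>. h j k \<omega> \<partial>M)) =
     (\<integral>z. B (step_process N a b \<xi> z) (step_process N' a' b' \<xi>' z) \<partial>\<mu>M)"
  proof -
    let ?g = "\<lambda>j k z. indicator {a j<..b j} (fst z) * indicator {a' k<..b' k} (fst z) * h j k (snd z)"
    have I: "integrable \<mu>M (?g j k)" "(\<integral>z. ?g j k z \<partial>\<mu>M) = ?l j k * (\<integral>\<omega>. h j k \<omega> \<partial>M)"
      if "j < N" "k < N'" for j k
      using integral_indicators_times[OF fD(1,3)[OF that(1)] gD(1,3)[OF that(2)] hi1[OF that]] by auto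
    have J: "integrable \<mu>M (\<lambda>z. \<Sum>k<N'. ?g j k z)" if "j < N" for j
      using I(1) that by (intro Bochner_Integration.integrable_sum) auto
    have "(\<integral>z. B (step_process N a b \<xi> z) (step_process N' a' b' \<xi>' z) \<partial>\<mu>M) = (\<integral>z. (\<Sum>j<N. \<Sum>k<N'. ?g j k z) \<partial>\<mu>M)"
      unfolding step_process_def sum_left unfolding sum_right scaleR_left scaleR_right h_def
      by (intro Bochner_Integration.integral_cong refl sum.cong) (simp add: ac_simps)
    also have "\<dots> = (\<Sum>j<N. (\<integral>z. (\<Sum>k<N'. ?g j k z) \<partial>\<mu>M))"
      using J by (intro Bochner_Integration.integral_sum) auto
    also have "\<dots> = (\<Sum>j<N. \<Sum>k<N'. (\<integral>z. ?g j k z \<partial>\<mu>M))"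
      using I(1) by (intro sum.cong refl Bochner_Integration.integral_sum) auto
    also have "\<dots> = (\<Sum>j<N. \<Sum>k<N'. ?l j k * (\<integral>\<omega>. h j k \<omega> \<partial>M))"
      using I(2) by (intro sum.cong refl) auto
    finally show ?thesis by simp
  qed
  finally show ?thesis .
qed

lemma sq_norm_diff_integral:
  fixes f g :: "'x \<Rightarrow> 'a::euclidean_space"
  assumes f: "sq_int N f" and g: "sq_int N g"
  shows "(\<integral>x. (norm (f x - g x))\<^sup>2 \<partial>N) =
    (\<integral>x. f x \<bullet> f x \<partial>N) - 2 * (\<integral>x. f x \<bullet> g x \<partial>N) + (\<integral>x. g x \<bullet> g x \<partial>N)"
proof -
  have "(\<integral>x. (norm (f x - g x))\<^sup>2 \<partial>N) = (\<integral>x. f x \<bullet> f x - 2 * (f x \<bullet> g x) + g x \<bullet> g x \<partial>N)"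
    by (simp add: power2_norm_eq_inner inner_diff inner_commute algebra_simps)
  also have "\<dots> = (\<integral>x. f x \<bullet> f x \<partial>N) - 2 * (\<integral>x. f x \<bullet> g x \<partial>N) + (\<integral>x. g x \<bullet> g x \<partial>N)"
    using sq_int_inner_integrable[OF f f] sq_int_inner_integrable[OF f g] sq_int_inner_integrable[OF g g] by simp
  finally show ?thesis .
qed

text \<open>Two families over different partitions are not merged into a difference family;
  expanding the square reduces the distance to three pairings, to which \<open>step_isometry\<close>
  applies.\<close>

lemma step_isometry_diff:
  fixes \<xi> \<xi>' :: "nat \<Rightarrow> 'w \<Rightarrow> 'a::euclidean_space"
  assumes f: "step_family N a b \<xi>" and g: "step_family N' a' b' \<xi>'"
  shows "(\<integral>\<omega>. (norm (step_integral i N a b \<xi> \<omega> - step_integral i N' a' b' \<xi>' \<omega>))\<^sup>2 \<partial>M) =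
    (\<integral>z. (norm (step_process N a b \<xi> z - step_process N' a' b' \<xi>' z))\<^sup>2 \<partial>\<mu>M)"
  unfolding sq_norm_diff_integral[OF step_integral_sq_int[OF f] step_integral_sq_int[OF g]]
    sq_norm_diff_integral[OF step_process_sq_int[OF f] step_process_sq_int[OF g]]
  using step_isometry[OF bounded_bilinear_inner f f, of i i] step_isometry[OF bounded_bilinear_inner f g, of i i]
    step_isometry[OF bounded_bilinear_inner g g, of i i] by simp

text \<open>An interval that starts at or after \<open>r\<close> collapses to the point
  \<open>r\<close>, yet its weight may be known only later than \<open>r\<close>. Replacing that
  weight by zero keeps the truncated family adapted and does not affect the integral, as the
  increment over the collapsed interval is zero.\<close>

definition trunc_weight :: "real \<Rightarrow> (nat \<Rightarrow> real) \<Rightarrow> (nat \<Rightarrow> 'w \<Rightarrow> 'a::euclidean_space) \<Rightarrow> nat \<Rightarrow> 'w \<Rightarrow> 'a" where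
  "trunc_weight r a \<xi> j = (if a j < r then \<xi> j else (\<lambda>_. 0))"

lemma step_family_trunc:
  assumes "step_family N a b \<xi>" "0 \<le> r"
  shows "step_family N (\<lambda>j. min (a j) r) (\<lambda>j. min (b j) r) (trunc_weight r a \<xi>)"
  unfolding step_family_def
proof (intro allI impI)
  fix j assume j: "j < N"
  note D = step_familyD[OF assms(1) j]
  have "bounded (\<xi> j ` space M)" using assms(1) j by (auto simp: step_family_def)
  then show "0 \<le> min (a j) r \<and> min (a j) r \<le> min (b j) r \<and> min (b j) r \<le> T \<and>
         trunc_weight r a \<xi> j \<in> borel_measurable (F (min (a j) r)) \<and> bounded (trunc_weight r a \<xi> j ` space M)"
    using D(1-4) assms(2) by (auto simp: trunc_weight_def bounded_iff)
qed

lemma step_process_trunc: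
  "step_process N (\<lambda>j. min (a j) r) (\<lambda>j. min (b j) r) (trunc_weight r a \<xi>) z = indicator {..r} (fst z) *\<^sub>R step_process N a b \<xi> z"
  unfolding step_process_def scaleR_sum_right
  by (intro sum.cong refl) (auto simp: trunc_weight_def indicator_def)

text \<open>The part of an interval beyond \<open>r\<close> has zero expectation against a variable
  \<open>\<eta>\<close> known at \<open>r\<close>: this is the martingale property at the level of
  step processes.\<close>

lemma step_integral_trunc_integral:
  assumes f: "step_family N a b \<xi>" and r: "0 \<le> r" "r \<le> T"
    and \<eta>: "\<eta> \<in> borel_measurable (F r)" "sq_int M \<eta>"
  shows "(\<integral>\<omega>. \<eta> \<omega> \<bullet> step_integral i N a b \<xi> \<omega> \<partial>M) =
    (\<integral>\<omega>. \<eta> \<omega> \<bullet> step_integral i N (\<lambda>j. min (a j) r) (\<lambda>j. min (b j) r) (trunc_weight r a \<xi>) \<omega> \<partial>M)"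
proof -
  let ?d = "\<lambda>j \<omega>. \<eta> \<omega> \<bullet> (dW i (min (a j) r) (min (b j) r) \<omega> *\<^sub>R trunc_weight r a \<xi> j \<omega>)"
    and ?c = "\<lambda>j s t \<omega>. \<eta> \<omega> \<bullet> (dW i s t \<omega> *\<^sub>R \<xi> j \<omega>)"
  have I: "integrable M (\<lambda>\<omega>. ?c j s t \<omega>)" if "j < N" "0 \<le> s" "s \<le> t" "t \<le> T" for j s t
    using step_familyD(6)[OF f that(1)] sq_int_dW_scale[OF that(2-) step_familyD(5)[OF f that(1)]]
    by (intro sq_int_inner_integrable \<eta>) blast
  have Z: "(\<integral>\<omega>. ?c j s t \<omega> \<partial>M) = 0"
    if j: "j < N" and st: "r \<le> s" "a j \<le> s" "s \<le> t" "t \<le> T" for j s t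
  proof -
    obtain C where C: "\<forall>\<omega>\<in>space M. norm (\<xi> j \<omega>) \<le> C" using step_familyD(6)[OF f j] by auto
    have "sq_int M (\<lambda>\<omega>. 1 *\<^sub>R \<xi> j \<omega>)"
      by (rule sq_int_bounded_scale[OF sq_int_const step_familyD(5)[OF f j] C])
    then have "integrable M (\<lambda>\<omega>. \<eta> \<omega> \<bullet> \<xi> j \<omega>)" by (intro sq_int_inner_integrable \<eta>) simp
    moreover have "(\<lambda>\<omega>. \<eta> \<omega> \<bullet> \<xi> j \<omega>) \<in> borel_measurable (F s)"
      by (intro borel_measurable_inner F_measurable_mono[OF \<eta>(1) st(1)] F_measurable_mono[OF step_familyD(4)[OF f j] st(2)])
    ultimately show ?thesis
      using integral_F_dW(2)[of s t "\<lambda>\<omega>. \<eta> \<omega> \<bullet> \<xi> j \<omega>" i] st r by (simp add: mult.commute)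
  qed
  have eq: "(\<integral>\<omega>. ?c j (a j) (b j) \<omega> \<partial>M) =
    (\<integral>\<omega>. ?d j \<omega> \<partial>M)" if j: "j < N" for j
  proof -
    note D = step_familyD(1-3)[OF f j]
    \<comment> \<open>An interval lies before \<open>r\<close>, degenerates to the point
      \<open>r\<close>, lies after \<open>r\<close>, or straddles it. The degenerate case stands
      alone because its truncated weight is zero; only the last case is cut.\<close>
    consider "b j \<le> r" "a j < r" | "b j \<le> r" "a j = r" | "r < b j" "r \<le> a j" | "a j < r" "r < b j"
      using D by linarith
    then show ?thesis
    proof cases
      case 1 then show ?thesis using D by (simp add: trunc_weight_def min_def)
    next
      case 2 then show ?thesis using D by (simp add: trunc_weight_def)
    next
      case 3 then show ?thesis using D Z[of j "a j" "b j"] j by (simp add: trunc_weight_def)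
    next
      case 4
      have "(\<integral>\<omega>. ?c j (a j) (b j) \<omega> \<partial>M) =
        (\<integral>\<omega>. ?c j (a j) r \<omega> + ?c j r (b j) \<omega> \<partial>M)"
        unfolding dW_add[of i "a j" "b j" _ r] by (simp add: algebra_simps)
      also have "\<dots> = (\<integral>\<omega>. ?c j (a j) r \<omega> \<partial>M) + (\<integral>\<omega>. ?c j r (b j) \<omega> \<partial>M)"
        using 4 D j r by (intro Bochner_Integration.integral_add I) auto
      also have "(\<integral>\<omega>. ?c j r (b j) \<omega> \<partial>M) = 0" using 4 D j by (intro Z) auto
      finally show ?thesis using 4 D by (simp add: trunc_weight_def min_def)
    qed
  qed
  have I': "integrable M (\<lambda>\<omega>. ?d j \<omega>)" if j: "j < N" for j
    using I[OF j, of "min (a j) r" "min (b j) r"] step_familyD(1-3)[OF f j] r by (auto simp: trunc_weight_def)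
  have "(\<integral>\<omega>. \<eta> \<omega> \<bullet> step_integral i N a b \<xi> \<omega> \<partial>M) = (\<Sum>j<N. \<integral>\<omega>. ?c j (a j) (b j) \<omega> \<partial>M)"
    unfolding step_integral_def inner_sum_right
    using I step_familyD(1-3)[OF f] by (intro Bochner_Integration.integral_sum) auto
  also have "\<dots> = (\<Sum>j<N. \<integral>\<omega>. ?d j \<omega> \<partial>M)"
    by (intro sum.cong refl eq) simp
  also have "\<dots> = (\<integral>\<omega>. \<eta> \<omega> \<bullet> step_integral i N (\<lambda>j. min (a j) r) (\<lambda>j. min (b j) r) (trunc_weight r a \<xi>) \<omega> \<partial>M)"
    unfolding step_integral_def inner_sum_right
    using I' by (intro Bochner_Integration.integral_sum[symmetric]) auto
  finally show ?thesis .
qed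

section \<open>Stochastic integrals\<close>

text \<open>Integrands over different time intervals have to be compared on one product space. A
  process on \<open>{a..b}\<close> is constrained there only, so its other values are replaced by
  zero.\<close>

definition zero_ext :: "real \<Rightarrow> real \<Rightarrow> (real \<Rightarrow> 'w \<Rightarrow> 'a::euclidean_space) \<Rightarrow> real \<times> 'w \<Rightarrow> 'a" where
  "zero_ext a b H z = indicator {a..b} (fst z) *\<^sub>R H (fst z) (snd z)"

text \<open>An integrand is jointly measurable over \<open>{a..b}\<close> only. Clamping the time
  into this interval makes the composition measurable over \<open>{0..T}\<close>, and the indicator
  in \<open>zero_ext\<close> hides the change.\<close>

lemma clamp_measurable:
  assumes "a \<le> b"
  shows "(\<lambda>z. (max a (min b (fst z)), snd z)) \<in> measurable \<mu>M (restrict_space borel {a..b} \<Otimes>\<^sub>M M)"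
proof (rule measurable_Pair)
  have "(\<lambda>x::real. max a (min b x)) \<in> borel_measurable borel" by measurable
  from measurable_compose[OF fst_\<mu>M_measurable this]
  show "(\<lambda>z. max a (min b (fst z))) \<in> measurable \<mu>M (restrict_space borel {a..b})"
    using assms by (intro measurable_restrict_space2) auto
qed simp

lemma zero_ext_measurable:
  assumes "a \<le> b" and H: "(\<lambda>(t, \<omega>). H t \<omega>) \<in> borel_measurable (restrict_space borel {a..b} \<Otimes>\<^sub>M M)"
  shows "zero_ext a b H \<in> borel_measurable \<mu>M"
proof -
  have eq: "zero_ext a b H = (\<lambda>z. indicator {a..b} (fst z) *\<^sub>R H (max a (min b (fst z))) (snd z))"
    using assms(1) by (auto simp: zero_ext_def fun_eq_iff indicator_def)
  have "(\<lambda>z. H (max a (min b (fst z))) (snd z)) \<in> borel_measurable \<mu>M"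
    using measurable_compose[OF clamp_measurable[OF assms(1)] H] by simp
  then show ?thesis unfolding eq
    by (intro borel_measurable_scaleR indicator_fst_measurable) auto
qed

lemma nn_integral_\<mu>M:
  assumes "f \<in> borel_measurable \<mu>M"
  shows "(\<integral>\<^sup>+ z. f z \<partial>\<mu>M) = (\<integral>\<^sup>+ \<omega>. (\<integral>\<^sup>+ t\<in>{0..T}. f (t, \<omega>) \<partial>lborel) \<partial>M)"
  using TM.nn_integral_snd[OF assms] by (simp add: nn_integral_restrict_space)

text \<open>Brings the iterated integrals in the definitions of square integrability and of the
  stochastic integral to the product space.\<close>

lemma nn_integral_zero_ext:
  assumes ab: "0 \<le> a" "b \<le> T" and f: "f \<in> borel_measurable \<mu>M"
    and eq: "\<And>t \<omega>. t \<in> {a..b} \<Longrightarrow> f (t, \<omega>) = g t \<omega>"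
      "\<And>t \<omega>. t \<notin> {a..b} \<Longrightarrow> f (t, \<omega>) = 0"
  shows "(\<integral>\<^sup>+ \<omega>. (\<integral>\<^sup>+ t\<in>{a..b}. g t \<omega> \<partial>lborel) \<partial>M) = (\<integral>\<^sup>+ z. f z \<partial>\<mu>M)"
  unfolding nn_integral_\<mu>M[OF f]
proof (intro nn_integral_cong)
  fix \<omega> t
  show "g t \<omega> * indicator {a..b} t = f (t, \<omega>) * indicator {0..T} t"
    using ab eq[of t \<omega>] by (cases "t \<in> {a..b}") (auto simp: indicator_def)
qed

lemma sq_int_zero_ext:
  assumes ab: "0 \<le> a" "a \<le> b" "b \<le> T" and H: "square_integrable_process M F' a b H"
  shows "sq_int \<mu>M (zero_ext a b H)"
proof (rule sq_int_nn_integral)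
  show m: "zero_ext a b H \<in> borel_measurable \<mu>M"
    using H ab by (intro zero_ext_measurable) (auto simp: square_integrable_process_def adapted_process_def)
  have "(\<integral>\<^sup>+ \<omega>. (\<integral>\<^sup>+ t\<in>{a..b}. ennreal ((norm (H t \<omega>))\<^sup>2) \<partial>lborel) \<partial>M) =
     (\<integral>\<^sup>+ z. ennreal ((norm (zero_ext a b H z))\<^sup>2) \<partial>\<mu>M)"
  proof (rule nn_integral_zero_ext[OF ab(1,3)])
    show "(\<lambda>z. ennreal ((norm (zero_ext a b H z))\<^sup>2)) \<in> borel_measurable \<mu>M"
      using m by measurable
  qed (auto simp: zero_ext_def)
  then show "(\<integral>\<^sup>+ z. ennreal ((norm (zero_ext a b H z))\<^sup>2) \<partial>\<mu>M) < \<infinity>"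
    using H by (simp add: square_integrable_process_def)
qed

section \<open>Stochastic integrals as limits of step integrals\<close>

abbreviation ito :: "'d \<Rightarrow> real \<Rightarrow> real \<Rightarrow> (real \<Rightarrow> 'w \<Rightarrow> 'a::euclidean_space) \<Rightarrow> ('w \<Rightarrow> 'a) \<Rightarrow> bool" where
  "ito i a b H Z \<equiv> has_ito_integral M (augmented_filtration M W) (\<lambda>s \<omega>. W s \<omega> $ i) a b H Z"

lemma elementary_data_mono:
  assumes "elementary_data M F' a b N \<tau> \<xi>" "i \<le> j" "j \<le> N"
  shows "\<tau> i \<le> \<tau> j"
  using assms(2,3)
proof (induction j rule: dec_induct)
  case (step n)
  then have "\<tau> n \<le> \<tau> (Suc n)" using assms(1) by (auto simp: elementary_data_def)
  then show ?case using step by simp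
qed simp

text \<open>Consecutive partition points become the endpoints of a step family. The bound
  \<open>a \<le> l m j\<close> is a separate conclusion because a step family does not record where
  the partition starts, and orthogonality to the past of \<open>a\<close> rests on it.\<close>

lemma ito_approx:
  fixes H :: "real \<Rightarrow> 'w \<Rightarrow> 'a::euclidean_space"
  assumes ab: "0 \<le> a" "a \<le> b" "b \<le> T" and I: "ito i a b H Z"
  obtains N l r \<xi> where "\<And>m. step_family (N m) (l m) (r m) (\<xi> m)" "\<And>m j. j < N m \<Longrightarrow> a \<le> l m j"
    "l2_tendsto M (\<lambda>m. step_integral i (N m) (l m) (r m) (\<xi> m)) Z"
    "l2_tendsto \<mu>M (\<lambda>m. step_process (N m) (l m) (r m) (\<xi> m)) (zero_ext a b H)"
proof -
  from I obtain N \<tau> \<xi> where ed: "\<And>m::nat. elementary_data M F a b (N m) (\<tau> m) (\<xi> m)"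
    and pl: "(\<lambda>m. \<integral>\<^sup>+ \<omega>. (\<integral>\<^sup>+ t\<in>{a..b}. ennreal ((norm (elementary_process (N m) (\<tau> m) (\<xi> m) t \<omega> - H t \<omega>))\<^sup>2)
               \<partial>lborel) \<partial>M) \<longlonglongrightarrow> 0"
    and il: "(\<lambda>m. \<integral>\<^sup>+ \<omega>. ennreal ((norm (elementary_integral (\<lambda>s \<omega>. W s \<omega> $ i) (N m) (\<tau> m) (\<xi> m) \<omega> - Z \<omega>))\<^sup>2)
               \<partial>M) \<longlonglongrightarrow> 0"
    unfolding has_ito_integral_def by blast
  have H: "square_integrable_process M F a b H" and Z: "Z \<in> borel_measurable M"
    using I by (auto simp: has_ito_integral_def)
  have bnd: "a \<le> \<tau> m j" "\<tau> m j \<le> b" if "j \<le> N m" for m j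
    using elementary_data_mono[OF ed[of m], of 0 j] elementary_data_mono[OF ed[of m], of j "N m"] that ed[of m]
    by (auto simp: elementary_data_def)
  let ?r = "\<lambda>m j. \<tau> m (Suc j)"
  have ok: "step_family (N m) (\<tau> m) (?r m) (\<xi> m)" for m
    unfolding step_family_def
  proof (intro allI impI)
    fix j assume j: "j < N m"
    show "0 \<le> \<tau> m j \<and> \<tau> m j \<le> \<tau> m (Suc j) \<and> \<tau> m (Suc j) \<le> T \<and>
         \<xi> m j \<in> borel_measurable (F (\<tau> m j)) \<and> bounded (\<xi> m j ` space M)"
      using ed[of m] bnd[of j m] bnd[of "Suc j" m] j ab by (auto simp: elementary_data_def)
  qed
  let ?proc = "\<lambda>m. step_process (N m) (\<tau> m) (?r m) (\<xi> m)" and ?eproc = "\<lambda>m. elementary_process (N m) (\<tau> m) (\<xi> m)"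
    and ?eint = "\<lambda>m. elementary_integral (\<lambda>s \<omega>. W s \<omega> $ i) (N m) (\<tau> m) (\<xi> m)"
  have proc: "?proc m (t, \<omega>) = ?eproc m t \<omega>" for m t \<omega>
    by (simp add: step_process_def elementary_process_def)
  have proc0: "?proc m (t, \<omega>) = 0" if "t \<notin> {a..b}" for m t \<omega>
    unfolding step_process_def
  proof (intro sum.neutral ballI)
    fix j assume "j \<in> {..<N m}"
    then show "indicator {\<tau> m j<..\<tau> m (Suc j)} (fst (t, \<omega>)) *\<^sub>R \<xi> m j (snd (t, \<omega>)) = 0"
      using bnd[of j m] bnd[of "Suc j" m] that by (auto simp: indicator_def)
  qed
  have int: "step_integral i (N m) (\<tau> m) (?r m) (\<xi> m) \<omega> = ?eint m \<omega>" for m \<omega>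
    by (simp add: step_integral_def elementary_integral_def dW_def)
  show thesis
  proof
    show "step_family (N m) (\<tau> m) (?r m) (\<xi> m)" for m by (rule ok)
    show "a \<le> \<tau> m j" if "j < N m" for m j using bnd that by simp
    show "l2_tendsto M (\<lambda>m. step_integral i (N m) (\<tau> m) (?r m) (\<xi> m)) Z"
      using il by (intro l2_tendstoI_nn step_integral_sq_int ok Z) (simp add: int)
    have em: "zero_ext a b H \<in> borel_measurable \<mu>M"
      using sq_int_zero_ext[OF ab H] by (rule sq_int_measurable)
    show "l2_tendsto \<mu>M (\<lambda>m. ?proc m) (zero_ext a b H)"
    proof (rule l2_tendstoI_nn[OF step_process_sq_int[OF ok] em])
      have "(\<integral>\<^sup>+ \<omega>. (\<integral>\<^sup>+ t\<in>{a..b}. ennreal ((norm (?eproc m t \<omega> - H t \<omega>))\<^sup>2)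
               \<partial>lborel) \<partial>M) =
        (\<integral>\<^sup>+ z. ennreal ((norm (?proc m z - zero_ext a b H z))\<^sup>2) \<partial>\<mu>M)" for m
      proof (rule nn_integral_zero_ext[OF ab(1,3)])
        have fm: "?proc m \<in> borel_measurable \<mu>M"
          by (rule sq_int_measurable[OF step_process_sq_int[OF ok]])
        show "(\<lambda>z. ennreal ((norm (?proc m z - zero_ext a b H z))\<^sup>2)) \<in> borel_measurable \<mu>M"
          using fm em by measurable
      qed (auto simp: proc zero_ext_def proc0[unfolded proc])
      with pl show "(\<lambda>m. \<integral>\<^sup>+ z. ennreal ((norm (?proc m z - zero_ext a b H z))\<^sup>2) \<partial>\<mu>M) \<longlonglongrightarrow> 0"
        by simp
    qed
  qed
qed

lemma ito_sq_int:
  assumes "0 \<le> a" "a \<le> b" "b \<le> T" "ito i a b H Z"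
  shows "sq_int M Z"
  by (rule ito_approx[OF assms]) (simp add: l2_tendsto_def)

text \<open>Both sides are limits of pairings of the approximants. The two time intervals may
  differ, since zero extension confines the right-hand side to their overlap.\<close>

lemma ito_isometry:
  fixes B :: "'a::euclidean_space \<Rightarrow> 'b::euclidean_space \<Rightarrow> real"
  assumes B: "bounded_bilinear B"
    and ab: "0 \<le> a" "a \<le> b" "b \<le> T" "ito i a b H Z" and cd: "0 \<le> c" "c \<le> d" "d \<le> T" "ito j c d G Y"
  shows "(\<integral>\<omega>. B (Z \<omega>) (Y \<omega>) \<partial>M) =
    (if i = j then (\<integral>z. B (zero_ext a b H z) (zero_ext c d G z) \<partial>\<mu>M) else 0)"
proof -
  obtain N l r \<xi> where 1: "\<And>m. step_family (N m) (l m) (r m) (\<xi> m)" and "\<And>m j. j < N m \<Longrightarrow> a \<le> l m j"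
    and 11: "l2_tendsto M (\<lambda>m. step_integral i (N m) (l m) (r m) (\<xi> m)) Z"
    and 12: "l2_tendsto \<mu>M (\<lambda>m. step_process (N m) (l m) (r m) (\<xi> m)) (zero_ext a b H)"
    by (rule ito_approx[OF ab]) (rule that)
  obtain N' l' r' \<xi>' where 2: "\<And>m. step_family (N' m) (l' m) (r' m) (\<xi>' m)" and "\<And>m j. j < N' m \<Longrightarrow> c \<le> l' m j"
    and 21: "l2_tendsto M (\<lambda>m. step_integral j (N' m) (l' m) (r' m) (\<xi>' m)) Y"
    and 22: "l2_tendsto \<mu>M (\<lambda>m. step_process (N' m) (l' m) (r' m) (\<xi>' m)) (zero_ext c d G)"
    by (rule ito_approx[OF cd]) (rule that)
  note lim = l2_tendsto_bilinear[OF B 11 21, unfolded step_isometry[OF B 1 2]]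
  have "(\<lambda>m. if i = j then \<integral>z. B (step_process (N m) (l m) (r m) (\<xi> m) z) (step_process (N' m) (l' m) (r' m) (\<xi>' m) z) \<partial>\<mu>M else 0)
    \<longlonglongrightarrow> (if i = j then (\<integral>z. B (zero_ext a b H z) (zero_ext c d G z) \<partial>\<mu>M) else 0)"
    using l2_tendsto_bilinear[OF B 12 22] by simp
  with lim show ?thesis by (rule LIMSEQ_unique)
qed

text \<open>Every approximating interval starts at or after \<open>a\<close>, so truncation at
  \<open>a\<close> leaves nothing of the step integrals, and their orthogonality to
  \<open>\<eta>\<close> passes to the limit.\<close>

lemma ito_orth:
  fixes H :: "real \<Rightarrow> 'w \<Rightarrow> 'a::euclidean_space"
  assumes ab: "0 \<le> a" "a \<le> b" "b \<le> T" "ito i a b H Z"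
    and \<eta>: "\<eta> \<in> borel_measurable (F a)" "sq_int M \<eta>"
  shows "(\<integral>\<omega>. \<eta> \<omega> \<bullet> Z \<omega> \<partial>M) = 0"
proof -
  obtain N l r \<xi> where 1: "\<And>m. step_family (N m) (l m) (r m) (\<xi> m)" "\<And>m j. j < N m \<Longrightarrow> a \<le> l m j"
    "l2_tendsto M (\<lambda>m. step_integral i (N m) (l m) (r m) (\<xi> m)) Z"
    "l2_tendsto \<mu>M (\<lambda>m. step_process (N m) (l m) (r m) (\<xi> m)) (zero_ext a b H)"
    by (rule ito_approx[OF ab]) (rule that)
  have "(\<integral>\<omega>. \<eta> \<omega> \<bullet> step_integral i (N m) (l m) (r m) (\<xi> m) \<omega> \<partial>M) = 0" for m
  proof -
    have "step_integral i (N m) (\<lambda>j. min (l m j) a) (\<lambda>j. min (r m j) a) (trunc_weight a (l m) (\<xi> m)) \<omega> = 0" for \<omega>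
      unfolding step_integral_def
    proof (intro sum.neutral ballI)
      fix j assume "j \<in> {..<N m}"
      then have "\<not> l m j < a" using 1(2)[of j m] by auto
      then show "dW i (min (l m j) a) (min (r m j) a) \<omega> *\<^sub>R trunc_weight a (l m) (\<xi> m) j \<omega> = 0"
        by (simp add: trunc_weight_def)
    qed
    then show ?thesis using step_integral_trunc_integral[OF 1(1)[of m] _ _ \<eta>, of i] ab by simp
  qed
  with l2_tendsto_bilinear[OF bounded_bilinear_inner l2_tendsto_const[OF \<eta>(2)] 1(3)]
  show ?thesis by (simp add: LIMSEQ_const_iff)
qed

text \<open>\<open>Z\<close> and \<open>Y\<close> come with unrelated approximations. Truncating the
  first at \<open>r\<close> gives step processes that approximate the integrand on
  \<open>{0..r}\<close>, just as the second does; the step isometry turns this into closeness of the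
  integrals, so the truncated integrals converge to \<open>Y\<close>. Pairing with
  \<open>\<eta>\<close> does not notice the truncation.\<close>

lemma ito_martingale:
  fixes H :: "real \<Rightarrow> 'w \<Rightarrow> 'a::euclidean_space"
  assumes r: "0 \<le> r" "r \<le> T" and Z: "ito i 0 T H Z" and Y: "ito i 0 r H Y"
    and \<eta>: "\<eta> \<in> borel_measurable (F r)" "sq_int M \<eta>"
  shows "(\<integral>\<omega>. \<eta> \<omega> \<bullet> Z \<omega> \<partial>M) = (\<integral>\<omega>. \<eta> \<omega> \<bullet> Y \<omega> \<partial>M)"
proof -
  obtain N a b \<xi> where 1: "\<And>m. step_family (N m) (a m) (b m) (\<xi> m)"
    and "\<And>m j. j < N m \<Longrightarrow> 0 \<le> a m j" and 11: "l2_tendsto M (\<lambda>m. step_integral i (N m) (a m) (b m) (\<xi> m)) Z"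
    and 12: "l2_tendsto \<mu>M (\<lambda>m. step_process (N m) (a m) (b m) (\<xi> m)) (zero_ext 0 T H)"
    by (rule ito_approx[OF order_refl less_imp_le[OF T_pos] order_refl Z]) (rule that)
  obtain N' a' b' \<xi>' where 2: "\<And>m. step_family (N' m) (a' m) (b' m) (\<xi>' m)"
    and "\<And>m j. j < N' m \<Longrightarrow> 0 \<le> a' m j" and 21: "l2_tendsto M (\<lambda>m. step_integral i (N' m) (a' m) (b' m) (\<xi>' m)) Y"
    and 22: "l2_tendsto \<mu>M (\<lambda>m. step_process (N' m) (a' m) (b' m) (\<xi>' m)) (zero_ext 0 r H)"
    by (rule ito_approx[OF order_refl r(1) r(2) Y]) (rule that)
  let ?J = "\<lambda>m. step_integral i (N m) (\<lambda>j. min (a m j) r) (\<lambda>j. min (b m j) r) (trunc_weight r (a m) (\<xi> m))"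
  let ?P = "\<lambda>m. step_process (N m) (a m) (b m) (\<xi> m)"
  let ?P' = "\<lambda>m. step_process (N' m) (a' m) (b' m) (\<xi>' m)"
  let ?R = "\<lambda>m z. indicator {..r} (fst z) *\<^sub>R ?P m z" and ?I' = "\<lambda>m. step_integral i (N' m) (a' m) (b' m) (\<xi>' m)"
  have sqT: "sq_int \<mu>M (zero_ext 0 T H)" and sqr: "sq_int \<mu>M (zero_ext 0 r H)"
    using 12 22 by (auto simp: l2_tendsto_def)
  have extr: "zero_ext 0 r H z = indicator {..r} (fst z) *\<^sub>R zero_ext 0 T H z" for z
    using r by (auto simp: zero_ext_def indicator_def)
  have "l2_tendsto M ?J Y"
  proof (rule l2_tendsto_close[OF 21 step_integral_sq_int[OF step_family_trunc[OF 1 r(1)]]])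
    have eq: "(\<integral>\<omega>. (norm (?J m \<omega> - ?I' m \<omega>))\<^sup>2 \<partial>M) =
       (\<integral>z. (norm (?R m z - ?P' m z))\<^sup>2 \<partial>\<mu>M)" for m
      unfolding step_isometry_diff[OF step_family_trunc[OF 1 r(1)] 2] step_process_trunc ..
    have sqi: "sq_int \<mu>M (?R m)" for m
      by (intro sq_int_indicator_scale step_process_sq_int 1) simp
    have "l2_tendsto \<mu>M ?R (zero_ext 0 r H)"
      unfolding l2_tendsto_def
    proof (intro conjI allI sqi sqr)
      have "(\<integral>z. (norm (?R m z - zero_ext 0 r H z))\<^sup>2 \<partial>\<mu>M) \<le>
         (\<integral>z. (norm (?P m z - zero_ext 0 T H z))\<^sup>2 \<partial>\<mu>M)" for m
      proof (rule integral_mono)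
        show "integrable \<mu>M (\<lambda>z. (norm (?R m z - zero_ext 0 r H z))\<^sup>2)"
          by (intro sq_int_integrable_norm sq_int_diff sqi sqr)
        show "integrable \<mu>M (\<lambda>z. (norm (?P m z - zero_ext 0 T H z))\<^sup>2)"
          by (intro sq_int_integrable_norm sq_int_diff step_process_sq_int 1 sqT)
      qed (auto simp: extr indicator_def)
      then have "norm (\<integral>z. (norm (?R m z - zero_ext 0 r H z))\<^sup>2 \<partial>\<mu>M) \<le>
         (\<integral>z. (norm (?P m z - zero_ext 0 T H z))\<^sup>2 \<partial>\<mu>M)" for m by simp
      moreover have "(\<lambda>m. \<integral>z. (norm (?P m z - zero_ext 0 T H z))\<^sup>2 \<partial>\<mu>M) \<longlonglongrightarrow> 0"
        using 12 by (simp add: l2_tendsto_def)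
      ultimately show "(\<lambda>m. \<integral>z. (norm (?R m z - zero_ext 0 r H z))\<^sup>2 \<partial>\<mu>M) \<longlonglongrightarrow> 0"
        by (rule Lim_null_comparison[OF always_eventually, OF allI])
    qed
    note A = this
    have sqd: "sq_int \<mu>M (?R m)" "sq_int \<mu>M (?P' m)" for m
      by (intro sqi) (intro step_process_sq_int 2)
    have "(\<integral>z. (norm (?R m z - ?P' m z))\<^sup>2 \<partial>\<mu>M) =
       (\<integral>z. ?R m z \<bullet> ?R m z \<partial>\<mu>M)
       - 2 * (\<integral>z. ?R m z \<bullet> ?P' m z \<partial>\<mu>M) + (\<integral>z. ?P' m z \<bullet> ?P' m z \<partial>\<mu>M)" for m
      by (rule sq_norm_diff_integral[OF sqd])
    \<comment> \<open>All three pairings of the expanded square tend to the squared norm of one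
      limit, and 1 - 2 + 1 = 0.\<close>
    moreover have "(\<lambda>m. (\<integral>z. ?R m z \<bullet> ?R m z \<partial>\<mu>M)
       - 2 * (\<integral>z. ?R m z \<bullet> ?P' m z \<partial>\<mu>M) + (\<integral>z. ?P' m z \<bullet> ?P' m z \<partial>\<mu>M)) \<longlonglongrightarrow>
       (\<integral>z. zero_ext 0 r H z \<bullet> zero_ext 0 r H z \<partial>\<mu>M) - 2 * (\<integral>z. zero_ext 0 r H z \<bullet> zero_ext 0 r H z \<partial>\<mu>M) + (\<integral>z. zero_ext 0 r H z \<bullet> zero_ext 0 r H z \<partial>\<mu>M)"
      by (intro tendsto_intros l2_tendsto_bilinear[OF bounded_bilinear_inner] A 22)
    ultimately show "(\<lambda>m. \<integral>\<omega>. (norm (?J m \<omega> - ?I' m \<omega>))\<^sup>2 \<partial>M) \<longlonglongrightarrow> 0"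
      unfolding eq by simp
  qed
  from l2_tendsto_bilinear[OF bounded_bilinear_inner l2_tendsto_const[OF \<eta>(2)] this]
  have "(\<lambda>m. \<integral>\<omega>. \<eta> \<omega> \<bullet> step_integral i (N m) (a m) (b m) (\<xi> m) \<omega> \<partial>M) \<longlonglongrightarrow> (\<integral>\<omega>. \<eta> \<omega> \<bullet> Y \<omega> \<partial>M)"
    unfolding step_integral_trunc_integral[OF 1 r \<eta>, symmetric] .
  with l2_tendsto_bilinear[OF bounded_bilinear_inner l2_tendsto_const[OF \<eta>(2)] 11]
  show ?thesis by (rule LIMSEQ_unique)
qed

end

section \<open>Duality\<close>

lemma bounded_bilinear_matrix_vector_mult:
  "bounded_bilinear ((*v) :: real^'n^'m \<Rightarrow> real^'n \<Rightarrow> real^'m)"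
  unfolding bilinear_conv_bounded_bilinear[symmetric] bilinear_def
  by (auto intro!: linearI simp: matrix_vector_mult_add_rdistrib matrix_vector_right_distrib
      scaleR_matrix_vector_assoc matrix_vector_mult_scaleR)

context brownian
begin

abbreviation mean_inner :: "('w \<Rightarrow> 'a::euclidean_space) \<Rightarrow> ('w \<Rightarrow> 'a) \<Rightarrow> real" where
  "mean_inner f g \<equiv> \<integral>\<omega>. f \<omega> \<bullet> g \<omega> \<partial>M"

section \<open>Time integrals and Fubini on a triangle\<close>

definition tint :: "real \<Rightarrow> real \<Rightarrow> (real \<Rightarrow> 'a::euclidean_space) \<Rightarrow> 'a" where
  "tint s t f = (\<integral>r. indicator {s..t} r *\<^sub>R f r \<partial>\<mu>)"

lemma set_lebesgue_integral_eq_tint: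
  assumes "0 \<le> s" "t \<le> T"
  shows "(LINT r:{s..t}|lborel. f r) = tint s t f"
proof -
  have "indicator {0..T} r *\<^sub>R indicator {s..t} r *\<^sub>R f r = indicator {s..t} r *\<^sub>R f r" for r
    using assms by (auto simp: indicator_def)
  note eq = this
  have "tint s t f = (\<integral>r. indicator {0..T} r *\<^sub>R indicator {s..t} r *\<^sub>R f r \<partial>lborel)"
    unfolding tint_def by (rule integral_restrict_space) simp
  then show ?thesis
    unfolding set_lebesgue_integral_def by (simp only: eq)
qed

lemma indicator_\<mu>_measurable: "A \<in> sets borel \<Longrightarrow> (\<lambda>r. indicator A r :: real) \<in> borel_measurable \<mu>"
  by (rule measurable_compose[OF id_\<mu>_measurable]) simp

lemma integrable_indicator_scaleR:
  fixes f :: "real \<Rightarrow> 'a::euclidean_space"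
  assumes f: "integrable \<mu> f" and A: "A \<in> sets borel"
  shows "integrable \<mu> (\<lambda>r. indicator A r *\<^sub>R f r)"
  using f
proof (rule Bochner_Integration.integrable_bound)
  show "(\<lambda>r. indicator A r *\<^sub>R f r) \<in> borel_measurable \<mu>"
    using f by (intro borel_measurable_scaleR indicator_\<mu>_measurable A) auto
qed (auto simp: indicator_def)

lemma tint_cong: "(\<And>r. r \<in> {0..T} \<Longrightarrow> r \<in> {s..t} \<Longrightarrow> f r = g r) \<Longrightarrow> tint s t f = tint s t g"
  unfolding tint_def by (intro Bochner_Integration.integral_cong) (auto simp: indicator_def)

lemma tint_0_T: "tint 0 T f = (\<integral>r. f r \<partial>\<mu>)"
  unfolding tint_def by (intro Bochner_Integration.integral_cong) auto

lemma tint_diff: "integrable \<mu> f \<Longrightarrow> integrable \<mu> g \<Longrightarrow> tint s t (\<lambda>r. f r - g r) = tint s t f - tint s t g"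
  unfolding tint_def by (simp add: scaleR_diff_right integrable_indicator_scaleR)

lemma tint_linear:
  assumes "bounded_linear L" "integrable \<mu> f"
  shows "tint s t (\<lambda>r. L (f r)) = L (tint s t f)"
proof -
  interpret bounded_linear L by fact
  show ?thesis
    unfolding tint_def
    using integral_bounded_linear[OF assms(1) integrable_indicator_scaleR[OF assms(2), of "{s..t}"]]
    by (simp add: scaleR)
qed

lemma tint_split:
  assumes "0 \<le> s" "s \<le> r" and f: "integrable \<mu> f"
  shows "tint 0 r f = tint 0 s f + tint s r f"
proof -
  \<comment> \<open>The common endpoint \<open>s\<close> is counted twice on the right, which is
    harmless outside a null set.\<close>
  have "AE x in \<mu>. x \<noteq> s"
    using AE_lborel_singleton[of s] by (subst AE_restrict_space_iff) auto
  then have "AE x in \<mu>. indicator {0..r} x *\<^sub>R f x = indicator {0..s} x *\<^sub>R f x + indicator {s..r} x *\<^sub>R f x"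
    by eventually_elim (use assms in \<open>auto simp: indicator_def\<close>)
  then have "tint 0 r f = (\<integral>x. indicator {0..s} x *\<^sub>R f x + indicator {s..r} x *\<^sub>R f x \<partial>\<mu>)"
    unfolding tint_def
    using f by (intro integral_cong_AE borel_measurable_add borel_measurable_scaleR indicator_\<mu>_measurable) auto
  then show ?thesis
    unfolding tint_def using f by (simp add: integrable_indicator_scaleR)
qed

sublocale \<mu>\<mu>: pair_sigma_finite \<mu> \<mu> ..

lemma triangle_measurable: "(\<lambda>z. indicator {fst z..T} (snd z) :: real) \<in> borel_measurable (\<mu> \<Otimes>\<^sub>M \<mu>)"
proof -
  have [measurable]: "(\<lambda>z. fst z) \<in> borel_measurable (\<mu> \<Otimes>\<^sub>M \<mu>)" "(\<lambda>z. snd z) \<in> borel_measurable (\<mu> \<Otimes>\<^sub>M \<mu>)"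
    by (rule measurable_compose[OF measurable_fst id_\<mu>_measurable]
        measurable_compose[OF measurable_snd id_\<mu>_measurable])+
  have "(\<lambda>z. indicator {fst z..T} (snd z) :: real) = (\<lambda>z. if fst z \<le> snd z \<and> snd z \<le> T then 1 else 0)"
    by (auto simp: indicator_def fun_eq_iff)
  also have "\<dots> \<in> borel_measurable (\<mu> \<Otimes>\<^sub>M \<mu>)" by measurable
  finally show ?thesis .
qed

text \<open>Integration by parts for two absolutely continuous paths, in the form of an interchange
  over \<open>s \<le> q \<le> r \<le> T\<close>; the function \<open>h\<close> carries the indicator
  of that triangle. \<open>prod\<close> is later an inner product as well as a matrix-vector
  product.\<close>

lemma fubini_triangle:
  fixes prod :: "'a::euclidean_space \<Rightarrow> 'b::euclidean_space \<Rightarrow> 'c::euclidean_space"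
  assumes B: "bounded_bilinear prod" and a: "integrable \<mu> a" and b: "integrable \<mu> b" and s: "0 \<le> s"
  shows "tint s T (\<lambda>q. prod (tint q T a) (b q)) = tint s T (\<lambda>r. prod (a r) (tint s r b))"
proof -
  interpret bounded_bilinear prod by fact
  obtain K where K: "0 \<le> K" "\<And>a b. norm (prod a b) \<le> norm a * norm b * K" using nonneg_bounded by blast
  define h where "h = (\<lambda>q r. (indicator {s..T} q * indicator {q..T} r) *\<^sub>R prod (a r) (b q))"
  have am: "a \<in> borel_measurable \<mu>" and bm: "b \<in> borel_measurable \<mu>" using a b by auto
  have hm: "case_prod h \<in> borel_measurable (\<mu> \<Otimes>\<^sub>M \<mu>)"
    unfolding h_def case_prod_beta'
    by (intro borel_measurable_scaleR borel_measurable_times triangle_measurable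
        measurable_compose[OF measurable_fst indicator_\<mu>_measurable]
        bounded_bilinear_measurable[OF B] measurable_compose[OF measurable_snd am] measurable_compose[OF measurable_fst bm]) auto
  have hi: "integrable (\<mu> \<Otimes>\<^sub>M \<mu>) (case_prod h)"
  proof (rule Bochner_Integration.integrable_bound[OF _ hm])
    show "integrable (\<mu> \<Otimes>\<^sub>M \<mu>) (\<lambda>z. norm (a (snd z)) * norm (b (fst z)) * K)"
    proof (rule \<mu>\<mu>.Fubini_integrable)
      show "(\<lambda>z. norm (a (snd z)) * norm (b (fst z)) * K) \<in> borel_measurable (\<mu> \<Otimes>\<^sub>M \<mu>)"
      proof -
        note [measurable] = measurable_compose[OF measurable_snd am] measurable_compose[OF measurable_fst bm]
        show ?thesis by measurable
      qed
      show "integrable \<mu> (\<lambda>x. \<integral>y. norm (norm (a (snd (x, y))) * norm (b (fst (x, y))) * K) \<partial>\<mu>)"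
        using a b K by (simp add: abs_mult)
    qed (use a in auto)
    have "norm (case_prod h z) \<le> norm (norm (a (snd z)) * norm (b (fst z)) * K)" for z
    proof -
      have "norm (case_prod h z) \<le> norm (prod (a (snd z)) (b (fst z)))"
        by (auto simp: h_def case_prod_beta' indicator_def)
      also have "\<dots> \<le> norm (a (snd z)) * norm (b (fst z)) * K" by (rule K)
      finally show ?thesis by simp
    qed
    then show "AE z in \<mu> \<Otimes>\<^sub>M \<mu>. norm (case_prod h z) \<le> norm (norm (a (snd z)) * norm (b (fst z)) * K)" by simp
  qed
  have "tint s T (\<lambda>q. prod (tint q T a) (b q)) = (\<integral>q. (\<integral>r. h q r \<partial>\<mu>) \<partial>\<mu>)"
    unfolding tint_def[of s T]
  proof (intro Bochner_Integration.integral_cong refl)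
    fix q
    have "prod (tint q T a) (b q) = tint q T (\<lambda>r. prod (a r) (b q))"
      by (rule tint_linear[OF bounded_linear_left a, symmetric])
    then show "indicator {s..T} q *\<^sub>R prod (tint q T a) (b q) = (\<integral>r. h q r \<partial>\<mu>)"
      by (simp add: h_def tint_def flip: scaleR_scaleR)
  qed
  also have "\<dots> = (\<integral>r. (\<integral>q. h q r \<partial>\<mu>) \<partial>\<mu>)"
    by (rule \<mu>\<mu>.Fubini_integral[OF hi, symmetric])
  also have "\<dots> = tint s T (\<lambda>r. prod (a r) (tint s r b))"
    unfolding tint_def[of s T]
  proof (intro Bochner_Integration.integral_cong refl)
    fix r assume r: "r \<in> space \<mu>"
    have "prod (a r) (tint s r b) = tint s r (\<lambda>q. prod (a r) (b q))"
      by (rule tint_linear[OF bounded_linear_right b, symmetric])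
    moreover have "h q r = indicator {s..T} r *\<^sub>R indicator {s..r} q *\<^sub>R prod (a r) (b q)" for q
      using r by (auto simp: h_def indicator_def)
    ultimately show "(\<integral>q. h q r \<partial>\<mu>) = indicator {s..T} r *\<^sub>R prod (a r) (tint s r b)"
      by (simp add: tint_def flip: scaleR_scaleR)
  qed
  finally show ?thesis .
qed

section \<open>Square-integrable processes and their running integrals\<close>

abbreviation proc_sq :: "(real \<Rightarrow> 'w \<Rightarrow> 'a::euclidean_space) \<Rightarrow> bool" where
  "proc_sq H \<equiv> sq_int \<mu>M (\<lambda>z. H (fst z) (snd z))"

abbreviation proc_int :: "(real \<Rightarrow> 'w \<Rightarrow> 'a::euclidean_space) \<Rightarrow> bool" where
  "proc_int H \<equiv> integrable \<mu>M (\<lambda>z. H (fst z) (snd z))"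

lemma proc_sq_square_integrable_process:
  assumes "square_integrable_process M F' 0 T H"
  shows "proc_sq H"
proof (rule sq_int_cong_AE)
  show "sq_int \<mu>M (zero_ext 0 T H)" using sq_int_zero_ext[OF _ _ _ assms] T_pos by simp
  show "(\<lambda>z. H (fst z) (snd z)) \<in> borel_measurable \<mu>M"
    using assms by (simp add: measurable_\<mu>M_eq square_integrable_process_def adapted_process_def case_prod_beta')
  show "AE z in \<mu>M. zero_ext 0 T H z = H (fst z) (snd z)"
    by (intro AE_I2) (auto simp: zero_ext_def space_pair_measure)
qed

lemma proc_int_facts:
  assumes "proc_int H"
  shows "AE \<omega> in M. integrable \<mu> (\<lambda>t. H t \<omega>)" (is ?a) "AE t in \<mu>. integrable M (H t)" (is ?b)
    "integrable M (\<lambda>\<omega>. \<integral>t. H t \<omega> \<partial>\<mu>)" (is ?c) "(\<integral>\<omega>. (\<integral>t. H t \<omega> \<partial>\<mu>) \<partial>M) = (\<integral>z. H (fst z) (snd z) \<partial>\<mu>M)" (is ?d)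
    "integrable \<mu> (\<lambda>t. \<integral>\<omega>. H t \<omega> \<partial>M)" (is ?e) "(\<integral>t. (\<integral>\<omega>. H t \<omega> \<partial>M) \<partial>\<mu>) = (\<integral>z. H (fst z) (snd z) \<partial>\<mu>M)" (is ?f)
proof -
  have i: "integrable \<mu>M (case_prod H)" using assms by (simp add: case_prod_beta')
  show ?a ?b ?c ?d ?e ?f
    using TM.AE_integrable_snd[OF i] TM.AE_integrable_fst[OF i] TM.integrable_snd[OF i] TM.integral_snd[OF i]
      TM.integrable_fst[OF i] TM.integral_fst[OF i] by (simp_all add: case_prod_beta')
qed

text \<open>Joint square integrability controls almost every time only; fixed times such as
  \<open>0\<close> and \<open>T\<close> call for separate arguments from the state and adjoint
  equations.\<close>

lemma proc_sq_AE_sq_int: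
  assumes "proc_sq H"
  shows "AE t in \<mu>. sq_int M (H t)"
proof -
  have "proc_int (\<lambda>t \<omega>. (norm (H t \<omega>))\<^sup>2)" using assms by (rule sq_int_integrable_norm)
  from proc_int_facts(2)[OF this] show ?thesis
  proof (rule AE_mp, intro AE_I2 impI)
    fix t assume "t \<in> space \<mu>" "integrable M (\<lambda>\<omega>. (norm (H t \<omega>))\<^sup>2)"
    then show "sq_int M (H t)"
      using measurable_compose[OF measurable_Pair1' sq_int_measurable[OF assms], of t] by (simp add: sq_int_def)
  qed
qed

lemma proc_sq_const:
  fixes \<eta> :: "'w \<Rightarrow> 'a::euclidean_space"
  assumes "sq_int M \<eta>" shows "proc_sq (\<lambda>_. \<eta>)"
proof (rule sq_int_nn_integral)
  note [measurable] = sq_int_measurable[OF assms]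
  show m: "(\<lambda>z. \<eta> (snd z)) \<in> borel_measurable \<mu>M" by measurable
  have "(\<integral>\<^sup>+ z. ennreal ((norm (\<eta> (snd z)))\<^sup>2) \<partial>\<mu>M) = (\<integral>\<^sup>+ x. \<integral>\<^sup>+ y. ennreal ((norm (\<eta> y))\<^sup>2) \<partial>M \<partial>\<mu>)"
    using nn_integral_fst[of "\<lambda>z. ennreal ((norm (\<eta> (snd z)))\<^sup>2)" \<mu>] by simp
  also have "\<dots> < \<infinity>"
    using assms T_pos by (simp add: sq_int_def integrable_iff_bounded emeasure_\<mu> ennreal_mult_less_top)
  finally show "(\<integral>\<^sup>+ z. ennreal ((norm (\<eta> (snd z)))\<^sup>2) \<partial>\<mu>M) < \<infinity>" .
qed

text \<open>Cauchy-Schwarz in time against the constant 1 costs the factor \<open>T\<close>.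
  \<open>N\<close> is the scenario space for the integral over a fixed interval and the product
  space for one with a moving endpoint.\<close>

lemma sq_int_time_integral:
  fixes H :: "'x \<Rightarrow> real \<Rightarrow> 'a::euclidean_space"
  assumes N: "finite_measure N" and H: "(\<lambda>(x, r). H x r) \<in> borel_measurable (N \<Otimes>\<^sub>M \<mu>)"
    and fin: "(\<integral>\<^sup>+ x. (\<integral>\<^sup>+ r. ennreal ((norm (H x r))\<^sup>2) \<partial>\<mu>) \<partial>N) < \<infinity>"
  shows "sq_int N (\<lambda>x. \<integral>r. H x r \<partial>\<mu>)"
proof (rule sq_int_nn_integral)
  show "(\<lambda>x. \<integral>r. H x r \<partial>\<mu>) \<in> borel_measurable N"
    using H by (rule time.borel_measurable_lebesgue_integral)
  have bound: "ennreal ((norm (\<integral>r. H x r \<partial>\<mu>))\<^sup>2) \<le> ennreal T * (\<integral>\<^sup>+ r. ennreal ((norm (H x r))\<^sup>2) \<partial>\<mu>)"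
    if x: "x \<in> space N" for x
  proof (cases "integrable \<mu> (H x)")
    case True
    then have [measurable]: "H x \<in> borel_measurable \<mu>" by auto
    have "ennreal (norm (\<integral>r. H x r \<partial>\<mu>)) \<le> (\<integral>\<^sup>+ r. ennreal (norm (H x r)) \<partial>\<mu>)"
      by (rule integral_norm_bound_ennreal[OF True])
    then have "(ennreal (norm (\<integral>r. H x r \<partial>\<mu>)))\<^sup>2 \<le> (\<integral>\<^sup>+ r. 1 * ennreal (norm (H x r)) \<partial>\<mu>)\<^sup>2"
      by (simp add: power_mono)
    also have "\<dots> \<le> (\<integral>\<^sup>+ r. 1 ^ 2 \<partial>\<mu>) * (\<integral>\<^sup>+ r. (ennreal (norm (H x r)))\<^sup>2 \<partial>\<mu>)"
      by (rule Cauchy_Schwarz_nn_integral) auto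
    finally show ?thesis using T_pos by (simp add: ennreal_power emeasure_\<mu>)
  \<comment> \<open>For a path that is not integrable the Bochner integral is 0 by convention, and
    the bound is trivial.\<close>
  qed (simp add: not_integrable_integral_eq)
  have "(\<integral>\<^sup>+ x. ennreal ((norm (\<integral>r. H x r \<partial>\<mu>))\<^sup>2) \<partial>N) \<le>
    (\<integral>\<^sup>+ x. ennreal T * (\<integral>\<^sup>+ r. ennreal ((norm (H x r))\<^sup>2) \<partial>\<mu>) \<partial>N)"
    by (intro nn_integral_mono bound)
  also have "\<dots> = ennreal T * (\<integral>\<^sup>+ x. (\<integral>\<^sup>+ r. ennreal ((norm (H x r))\<^sup>2) \<partial>\<mu>) \<partial>N)"
  proof (rule nn_integral_cmult)
    have "(\<lambda>(x, r). ennreal ((norm (H x r))\<^sup>2)) \<in> borel_measurable (N \<Otimes>\<^sub>M \<mu>)"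
      using H unfolding case_prod_beta' by measurable
    then show "(\<lambda>x. \<integral>\<^sup>+ r. ennreal ((norm (H x r))\<^sup>2) \<partial>\<mu>) \<in> borel_measurable N"
      by (rule time.borel_measurable_nn_integral)
  qed
  also have "\<dots> < \<infinity>" using fin by (simp add: ennreal_mult_less_top)
  finally show "(\<integral>\<^sup>+ x. ennreal ((norm (\<integral>r. H x r \<partial>\<mu>))\<^sup>2) \<partial>N) < \<infinity>" .
qed

lemma proc_sq_swap_measurable:
  assumes "proc_sq H" shows "(\<lambda>(\<omega>, r). H r \<omega>) \<in> borel_measurable (M \<Otimes>\<^sub>M \<mu>)"
  using measurable_pair_swap[OF sq_int_measurable[OF assms]] by (simp add: case_prod_beta')

lemma proc_sq_nn_finite:
  assumes "proc_sq H"
  shows "(\<integral>\<^sup>+ \<omega>. (\<integral>\<^sup>+ r. ennreal ((norm (H r \<omega>))\<^sup>2) \<partial>\<mu>) \<partial>M) < \<infinity>"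
proof -
  note [measurable] = sq_int_measurable[OF assms]
  have "(\<integral>\<^sup>+ \<omega>. (\<integral>\<^sup>+ r. ennreal ((norm (H r \<omega>))\<^sup>2) \<partial>\<mu>) \<partial>M) = (\<integral>\<^sup>+ z. ennreal ((norm (H (fst z) (snd z)))\<^sup>2) \<partial>\<mu>M)"
    using TM.nn_integral_snd[of "\<lambda>z. ennreal ((norm (H (fst z) (snd z)))\<^sup>2)"] by simp
  also have "\<dots> < \<infinity>" using assms by (simp add: sq_int_def integrable_iff_bounded)
  finally show ?thesis .
qed

lemma sq_int_tint:
  assumes H: "proc_sq H"
  shows "sq_int M (\<lambda>\<omega>. tint s t (\<lambda>r. H r \<omega>))"
  unfolding tint_def
proof (rule sq_int_time_integral[OF finite_measure_axioms])
  have "proc_sq (\<lambda>r \<omega>. indicator {s..t} r *\<^sub>R H r \<omega>)" using sq_int_indicator_scale[OF H, of "{s..t}"] by simp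
  from proc_sq_swap_measurable[OF this] proc_sq_nn_finite[OF this]
  show "(\<lambda>(\<omega>, r). indicator {s..t} r *\<^sub>R H r \<omega>) \<in> borel_measurable (M \<Otimes>\<^sub>M \<mu>)"
    "(\<integral>\<^sup>+ \<omega>. (\<integral>\<^sup>+ r. ennreal ((norm (indicator {s..t} r *\<^sub>R H r \<omega>))\<^sup>2) \<partial>\<mu>) \<partial>M) < \<infinity>" by auto
qed

text \<open>With \<open>\<phi>\<close> the indicator of a triangle this covers both the integral
  from \<open>t\<close> to \<open>T\<close> and the one from \<open>0\<close> to
  \<open>t\<close>.\<close>

lemma proc_sq_weighted_integral:
  assumes H: "proc_sq H" and \<phi>: "case_prod \<phi> \<in> borel_measurable (\<mu> \<Otimes>\<^sub>M \<mu>)"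
    and b: "\<And>t r. \<bar>\<phi> t r\<bar> \<le> (1::real)"
  shows "proc_sq (\<lambda>t \<omega>. \<integral>r. \<phi> t r *\<^sub>R H r \<omega> \<partial>\<mu>)"
proof (rule sq_int_time_integral[OF finite_measure_\<mu>M])
  have m1: "(\<lambda>y. (fst (fst y), snd y)) \<in> measurable (\<mu>M \<Otimes>\<^sub>M \<mu>) (\<mu> \<Otimes>\<^sub>M \<mu>)"
    and m2: "(\<lambda>y. (snd (fst y), snd y)) \<in> measurable (\<mu>M \<Otimes>\<^sub>M \<mu>) (M \<Otimes>\<^sub>M \<mu>)" by measurable
  have m: "(\<lambda>y. \<phi> (fst (fst y)) (snd y) *\<^sub>R H (snd y) (snd (fst y))) \<in> borel_measurable (\<mu>M \<Otimes>\<^sub>M \<mu>)"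
    using measurable_compose[OF m1 \<phi>] measurable_compose[OF m2 proc_sq_swap_measurable[OF H]]
    by (intro borel_measurable_scaleR) auto
  then show "(\<lambda>(z, r). \<phi> (fst z) r *\<^sub>R H r (snd z)) \<in> borel_measurable (\<mu>M \<Otimes>\<^sub>M \<mu>)"
    by (simp add: case_prod_beta')
  note [measurable] = proc_sq_swap_measurable[OF H]
  have g: "(\<lambda>\<omega>. \<integral>\<^sup>+ r. ennreal ((norm (H r \<omega>))\<^sup>2) \<partial>\<mu>) \<in> borel_measurable M"
    by (rule time.borel_measurable_nn_integral) measurable
  have "(\<integral>\<^sup>+ z. (\<integral>\<^sup>+ r. ennreal ((norm (\<phi> (fst z) r *\<^sub>R H r (snd z)))\<^sup>2) \<partial>\<mu>) \<partial>\<mu>M) \<le>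
     (\<integral>\<^sup>+ z. (\<integral>\<^sup>+ r. ennreal ((norm (H r (snd z)))\<^sup>2) \<partial>\<mu>) \<partial>\<mu>M)"
  proof (intro nn_integral_mono ennreal_leI power_mono)
    fix z r show "norm (\<phi> (fst z) r *\<^sub>R H r (snd z)) \<le> norm (H r (snd z))"
      using b[of "fst z" r] by (simp add: mult_left_le_one_le)
  qed auto
  also have "\<dots> = (\<integral>\<^sup>+ x. \<integral>\<^sup>+ \<omega>. (\<integral>\<^sup>+ r. ennreal ((norm (H r \<omega>))\<^sup>2) \<partial>\<mu>) \<partial>M \<partial>\<mu>)"
    using nn_integral_fst[OF measurable_compose[OF measurable_snd g], of \<mu>] by simp
  also have "\<dots> < \<infinity>"
    using proc_sq_nn_finite[OF H] T_pos by (simp add: emeasure_\<mu> ennreal_mult_less_top)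
  finally show "(\<integral>\<^sup>+ z. (\<integral>\<^sup>+ r. ennreal ((norm (\<phi> (fst z) r *\<^sub>R H r (snd z)))\<^sup>2) \<partial>\<mu>) \<partial>\<mu>M) < \<infinity>" .
qed

lemma proc_sq_tail_integral:
  assumes H: "proc_sq H" shows "proc_sq (\<lambda>t \<omega>. tint t T (\<lambda>r. H r \<omega>))"
  unfolding tint_def
  by (rule proc_sq_weighted_integral[OF H])
     (use triangle_measurable in \<open>auto simp: case_prod_beta' indicator_def\<close>)

lemma proc_sq_integral:
  assumes H: "proc_sq H" shows "proc_sq (\<lambda>t \<omega>. tint 0 t (\<lambda>r. H r \<omega>))"
  unfolding tint_def
proof (rule proc_sq_weighted_integral[OF H])
  \<comment> \<open>Within the square, \<open>r \<in> {0..t}\<close> amounts to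
    \<open>t \<in> {r..T}\<close>, which is the known triangle with its coordinates
    exchanged.\<close>
  have "(\<lambda>z. indicator {fst z..T} (snd z) :: real) \<in> borel_measurable (\<mu> \<Otimes>\<^sub>M \<mu>)" by (rule triangle_measurable)
  from measurable_pair_swap[OF this]
  show "(\<lambda>(t, r). indicator {0..t} r :: real) \<in> borel_measurable (\<mu> \<Otimes>\<^sub>M \<mu>)"
    by (rule measurable_cong[THEN iffD1, rotated]) (auto simp: space_pair_measure indicator_def)
qed (auto simp: indicator_def)

lemmas proc_sq_inner = sq_int_inner_integrable[of \<mu>M]

text \<open>This replaces Ito's formula for \<open>p \<bullet> D\<close>. In the application \<open>\<beta>\<close> is the drift of \<open>D\<close>
  and \<open>Mt\<close> its martingale part, \<open>-f\<close> is the drift of \<open>p\<close>, and \<open>N s\<close> is the stochastic integral over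
  \<open>{s..T}\<close> in the backward equation \<open>p s = \<xi> + tint s T f - N s\<close>.\<close>

lemma duality:
  fixes D p f \<beta> N Mt :: "real \<Rightarrow> 'w \<Rightarrow> 'a::euclidean_space" and \<xi> :: "'w \<Rightarrow> 'a"
  assumes N_eq: "\<And>s \<omega>. N s \<omega> = \<xi> \<omega> + tint s T (\<lambda>r. f r \<omega>) - p s \<omega>"
    and Mt_eq: "\<And>t \<omega>. Mt t \<omega> = D t \<omega> - tint 0 t (\<lambda>r. \<beta> r \<omega>)"
    and sq: "proc_sq D" "proc_sq p" "proc_sq f" "proc_sq \<beta>"
    and sq': "sq_int M \<xi>" "sq_int M (D T)" "sq_int M (p 0)"
    and N: "AE s in \<mu>. mean_inner (N s) (\<beta> s) = 0"
    and Mart: "AE r in \<mu>. (\<integral>\<omega>. f r \<omega> \<bullet> (Mt r \<omega> - Mt T \<omega>) \<partial>M) = 0"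
    and p0: "mean_inner (p 0) (Mt T) = 0"
  shows "mean_inner \<xi> (D T) = mean_inner (N 0) (Mt T)
     + (\<integral>z. p (fst z) (snd z) \<bullet> \<beta> (fst z) (snd z) - f (fst z) (snd z) \<bullet> D (fst z) (snd z) \<partial>\<mu>M)"
proof -
  have N_def: "N = (\<lambda>s \<omega>. \<xi> \<omega> + tint s T (\<lambda>r. f r \<omega>) - p s \<omega>)"
    and Mt_def: "Mt = (\<lambda>t \<omega>. D t \<omega> - tint 0 t (\<lambda>r. \<beta> r \<omega>))"
    by (auto simp: N_eq Mt_eq fun_eq_iff)
  have Nsq: "proc_sq N" unfolding N_def
    by (intro sq_int_diff sq_int_add sq proc_sq_const[OF sq'(1)] proc_sq_tail_integral[OF sq(3)])
  have Msq: "proc_sq Mt" unfolding Mt_def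
    by (intro sq_int_diff sq proc_sq_integral[OF sq(4)])
  have MT: "sq_int M (Mt T)" unfolding Mt_def by (intro sq_int_diff sq' sq_int_tint sq)
  have N0: "sq_int M (N 0)" unfolding N_def by (intro sq_int_diff sq_int_add sq' sq_int_tint sq)
  have MTp: "proc_sq (\<lambda>r \<omega>. Mt r \<omega> - Mt T \<omega>)" by (intro sq_int_diff Msq proc_sq_const MT)
  let ?e1 = "\<lambda>\<omega>. \<integral>t. p t \<omega> \<bullet> \<beta> t \<omega> - f t \<omega> \<bullet> D t \<omega> \<partial>\<mu>" and ?e2 = "\<lambda>\<omega>. \<integral>t. N t \<omega> \<bullet> \<beta> t \<omega> \<partial>\<mu>"
    and ?e3 = "\<lambda>\<omega>. \<integral>t. f t \<omega> \<bullet> (Mt t \<omega> - Mt T \<omega>) \<partial>\<mu>"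
  have i1: "proc_int (\<lambda>t \<omega>. p t \<omega> \<bullet> \<beta> t \<omega>)" and i2: "proc_int (\<lambda>t \<omega>. f t \<omega> \<bullet> D t \<omega>)"
    and i3: "proc_int (\<lambda>t \<omega>. N t \<omega> \<bullet> \<beta> t \<omega>)" and i4: "proc_int (\<lambda>t \<omega>. f t \<omega> \<bullet> (Mt t \<omega> - Mt T \<omega>))"
    by (intro proc_sq_inner sq Nsq MTp)+
  have i5: "proc_int (\<lambda>t \<omega>. p t \<omega> \<bullet> \<beta> t \<omega> - f t \<omega> \<bullet> D t \<omega>)"
    using i1 i2 by simp
  have ib: "proc_int \<beta>" "proc_int f" by (intro TM.sq_int_integrable sq)+
  \<comment> \<open>The identity is first established path by path. The terms
    \<open>?e2 \<omega>\<close>, \<open>?e3 \<omega>\<close> and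
    \<open>p 0 \<omega> \<bullet> Mt T \<omega>\<close> are arranged so that the hypotheses make
    their expectations vanish.\<close>
  have path: "AE \<omega> in M. \<xi> \<omega> \<bullet> D T \<omega> = ?e1 \<omega> + ?e2 \<omega>
     + p 0 \<omega> \<bullet> Mt T \<omega> + N 0 \<omega> \<bullet> Mt T \<omega> + ?e3 \<omega>"
    using proc_int_facts(1)[OF i1] proc_int_facts(1)[OF i2] proc_int_facts(1)[OF i3] proc_int_facts(1)[OF i4]
      proc_int_facts(1)[OF ib(1)] proc_int_facts(1)[OF ib(2)]
  proof eventually_elim
    case (elim \<omega>)
    let ?K = "\<lambda>t. tint 0 t (\<lambda>r. \<beta> r \<omega>)" and ?L = "\<lambda>t. tint t T (\<lambda>r. f r \<omega>)"
    \<comment> \<open>\<open>?L t\<close> is a combination of \<open>N t \<omega>\<close>,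
      \<open>p t \<omega>\<close> and \<open>\<xi> \<omega>\<close>, whose products with
      \<open>\<beta> t \<omega>\<close> are already integrable.\<close>
    have L\<beta>: "integrable \<mu> (\<lambda>t. ?L t \<bullet> \<beta> t \<omega>)"
    proof -
      have "?L t \<bullet> \<beta> t \<omega> = N t \<omega> \<bullet> \<beta> t \<omega> + p t \<omega> \<bullet> \<beta> t \<omega> - \<xi> \<omega> \<bullet> \<beta> t \<omega>" for t
        by (simp add: N_def algebra_simps)
      then show ?thesis using elim by simp
    qed
    have fMT: "integrable \<mu> (\<lambda>t. f t \<omega> \<bullet> Mt T \<omega>)" using elim by simp
    \<comment> \<open>Fubini moves the inner integral from \<open>f\<close> to
      \<open>\<beta>\<close>, where it becomes \<open>?K t\<close>, that is
      \<open>D t \<omega> - Mt t \<omega>\<close>. Splitting off \<open>Mt T\<close> prepares the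
      use of the martingale hypothesis.\<close>
    have "(\<integral>t. ?L t \<bullet> \<beta> t \<omega> \<partial>\<mu>) = (\<integral>t. f t \<omega> \<bullet> ?K t \<partial>\<mu>)"
      using fubini_triangle[OF bounded_bilinear_inner elim(6,5), of 0] by (simp add: tint_0_T)
    also have "\<dots> = (\<integral>t. f t \<omega> \<bullet> D t \<omega> - (f t \<omega> \<bullet> (Mt t \<omega> - Mt T \<omega>) + f t \<omega> \<bullet> Mt T \<omega>) \<partial>\<mu>)"
      by (intro Bochner_Integration.integral_cong refl) (simp add: Mt_def algebra_simps)
    also have "\<dots> = (\<integral>t. f t \<omega> \<bullet> D t \<omega> \<partial>\<mu>) - (?e3 \<omega> + (\<integral>t. f t \<omega> \<bullet> Mt T \<omega> \<partial>\<mu>))"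
      using elim fMT by (subst Bochner_Integration.integral_diff Bochner_Integration.integral_add; simp)+
    finally have eq1: "(\<integral>t. ?L t \<bullet> \<beta> t \<omega> \<partial>\<mu>) = (\<integral>t. f t \<omega> \<bullet> D t \<omega> \<partial>\<mu>)
      - (?e3 \<omega> + (\<integral>t. f t \<omega> \<bullet> Mt T \<omega> \<partial>\<mu>))" .
    have "\<xi> \<omega> \<bullet> ?K T = (\<integral>t. \<xi> \<omega> \<bullet> \<beta> t \<omega> \<partial>\<mu>)"
      using elim by (simp add: tint_0_T)
    also have "\<dots> = (\<integral>t. p t \<omega> \<bullet> \<beta> t \<omega> + N t \<omega> \<bullet> \<beta> t \<omega> - ?L t \<bullet> \<beta> t \<omega> \<partial>\<mu>)"
      by (intro Bochner_Integration.integral_cong refl) (simp add: N_def algebra_simps)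
    also have "\<dots> = (\<integral>t. p t \<omega> \<bullet> \<beta> t \<omega> \<partial>\<mu>) + ?e2 \<omega> - (\<integral>t. ?L t \<bullet> \<beta> t \<omega> \<partial>\<mu>)"
      using elim L\<beta> by simp
    finally have eq2: "\<xi> \<omega> \<bullet> ?K T = (\<integral>t. p t \<omega> \<bullet> \<beta> t \<omega> \<partial>\<mu>) + ?e2 \<omega> - (\<integral>t. ?L t \<bullet> \<beta> t \<omega> \<partial>\<mu>)" .
    \<comment> \<open>\<open>N\<close> at time 0 brings in the integral of
      \<open>f t \<omega> \<bullet> Mt T \<omega>\<close> with the sign opposite to the one that
      \<open>eq1\<close> contributes through \<open>eq2\<close>, so the two cancel.\<close>
    have "\<xi> \<omega> = p 0 \<omega> + N 0 \<omega> - (\<integral>t. f t \<omega> \<partial>\<mu>)" by (simp add: N_def tint_0_T)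
    then have eq3: "\<xi> \<omega> \<bullet> Mt T \<omega> = p 0 \<omega> \<bullet> Mt T \<omega> + N 0 \<omega> \<bullet> Mt T \<omega> - (\<integral>t. f t \<omega> \<bullet> Mt T \<omega> \<partial>\<mu>)"
      using elim by (simp add: inner_diff_left inner_add_left)
    have "D T \<omega> = ?K T + Mt T \<omega>" by (simp add: Mt_def)
    then have "\<xi> \<omega> \<bullet> D T \<omega> = \<xi> \<omega> \<bullet> ?K T + \<xi> \<omega> \<bullet> Mt T \<omega>" by (simp only: inner_add_right)
    with eq1 eq2 eq3 elim show ?case by simp
  qed
  note e3 = proc_int_facts[OF i3] and e4 = proc_int_facts[OF i4] and e5 = proc_int_facts[OF i5]
  \<comment> \<open>Fubini passes from paths to fixed times, where the orthogonality hypotheses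
    live.\<close>
  have "(\<integral>\<omega>. ?e2 \<omega> \<partial>M) = (\<integral>t. mean_inner (N t) (\<beta> t) \<partial>\<mu>)"
    using e3(4,6) by simp
  also have "\<dots> = 0" using N by (rule integral_eq_zero_AE)
  finally have z1: "(\<integral>\<omega>. ?e2 \<omega> \<partial>M) = 0" .
  have "(\<integral>\<omega>. ?e3 \<omega> \<partial>M) = (\<integral>t. (\<integral>\<omega>. f t \<omega> \<bullet> (Mt t \<omega> - Mt T \<omega>) \<partial>M) \<partial>\<mu>)"
    using e4(4,6) by simp
  also have "\<dots> = 0" using Mart by (rule integral_eq_zero_AE)
  finally have z2: "(\<integral>\<omega>. ?e3 \<omega> \<partial>M) = 0" .
  have j: "integrable M (\<lambda>\<omega>. p 0 \<omega> \<bullet> Mt T \<omega>)" "integrable M (\<lambda>\<omega>. N 0 \<omega> \<bullet> Mt T \<omega>)" "integrable M (\<lambda>\<omega>. \<xi> \<omega> \<bullet> D T \<omega>)"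
    by (intro sq_int_inner_integrable sq' N0 MT)+
  have "mean_inner \<xi> (D T) = (\<integral>\<omega>. ?e1 \<omega> + ?e2 \<omega>
     + p 0 \<omega> \<bullet> Mt T \<omega> + N 0 \<omega> \<bullet> Mt T \<omega> + ?e3 \<omega> \<partial>M)"
    using j e3(3) e4(3) e5(3) by (intro integral_cong_AE path borel_measurable_add) auto
  also have "\<dots> = (\<integral>\<omega>. ?e1 \<omega> \<partial>M) + (\<integral>\<omega>. ?e2 \<omega> \<partial>M)
     + mean_inner (p 0) (Mt T) + mean_inner (N 0) (Mt T)
     + (\<integral>\<omega>. ?e3 \<omega> \<partial>M)"
    using j e3(3) e4(3) e5(3) by (simp only: Bochner_Integration.integral_add Bochner_Integration.integrable_add)
  finally show ?thesis using z1 z2 p0 e5(4) by simp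
qed

end

section \<open>Linear-quadratic control\<close>

lemma bounded_bilinear_matrix_mult:
  "bounded_bilinear ((**) :: real^'n^'m \<Rightarrow> real^'k^'n \<Rightarrow> real^'k^'m)"
  unfolding bilinear_conv_bounded_bilinear[symmetric] bilinear_def
  by (auto intro!: linearI simp: matrix_matrix_mult_def vec_eq_iff sum.distrib algebra_simps sum_distrib_left)

lemma bounded_linear_transpose: "bounded_linear (transpose :: real^'n^'m \<Rightarrow> real^'m^'n)"
  unfolding linear_conv_bounded_linear[symmetric]
  by (intro linearI) (simp_all add: transpose_def vec_eq_iff)

lemma bounded_linear_column: "bounded_linear (column i :: real^'n^'m \<Rightarrow> real^'m)"
  unfolding linear_conv_bounded_linear[symmetric]
  by (intro linearI) (simp_all add: column_def vec_eq_iff)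

definition outer :: "real^'n \<Rightarrow> real^'n \<Rightarrow> real^'n^'n" where
  "outer x y = (\<chi> i j. x $ i * y $ j)"

lemma bounded_bilinear_outer: "bounded_bilinear (outer :: real^'n \<Rightarrow> real^'n \<Rightarrow> real^'n^'n)"
  unfolding bilinear_conv_bounded_bilinear[symmetric] bilinear_def
  by (auto intro!: linearI simp: outer_def vec_eq_iff algebra_simps)

text \<open>The inner product on matrices is the Frobenius one, so a quadratic form becomes linear
  in the matrix and a deterministic \<open>G\<close> can be drawn out of an expectation.\<close>

lemma inner_outer: "G \<bullet> outer y x = (G *v x) \<bullet> y"
  by (simp add: outer_def inner_vec_def matrix_vector_mult_def sum_distrib_left sum_distrib_right ac_simps)

lemma bounded_bilinear_matrix_form:
  "bounded_bilinear (\<lambda>x y. (G *v x) \<bullet> (y :: real^'n))" for G :: "real^'n^'n"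
  unfolding bilinear_conv_bounded_bilinear[symmetric] bilinear_def
  by (auto intro!: linearI simp: matrix_vector_right_distrib inner_add_left inner_add_right matrix_vector_mult_scaleR)

lemma matrix_vector_inner_transpose: "(G *v x) \<bullet> y = x \<bullet> (transpose G *v y)" for G :: "real^'n^'n"
  by (metis dot_lmul_matrix inner_commute vector_transpose_matrix transpose_matrix_vector)

context brownian
begin

section \<open>Bounded deterministic coefficients\<close>

definition bounded_coeff :: "(real \<Rightarrow> 'a::euclidean_space) \<Rightarrow> bool" where
  "bounded_coeff G \<longleftrightarrow> G \<in> borel_measurable \<mu> \<and> (\<exists>C. \<forall>t\<in>{0..T}. norm (G t) \<le> C)"

lemma bounded_coeffI:
  "G \<in> borel_measurable (restrict_space borel {0..T}) \<Longrightarrow> bounded (G ` {0..T}) \<Longrightarrow> bounded_coeff G"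
  by (auto simp: bounded_coeff_def measurable_\<mu>_eq bounded_iff)

lemma bounded_coeff_integrable:
  assumes G: "bounded_coeff G" shows "integrable \<mu> G"
proof -
  obtain C where "\<forall>t\<in>{0..T}. norm (G t) \<le> C" using G by (auto simp: bounded_coeff_def)
  then show ?thesis
    using G by (intro time.integrable_const_bound[where B=C]) (auto simp: bounded_coeff_def)
qed

lemma bounded_coeff_add:
  assumes G: "bounded_coeff G" and H: "bounded_coeff H"
  shows "bounded_coeff (\<lambda>t. G t + H t)"
proof -
  obtain C D where "\<forall>t\<in>{0..T}. norm (G t) \<le> C" "\<forall>t\<in>{0..T}. norm (H t) \<le> D"
    using G H by (auto simp: bounded_coeff_def)
  then have "\<forall>t\<in>{0..T}. norm (G t + H t) \<le> C + D" by (auto intro: norm_triangle_mono)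
  moreover have "(\<lambda>t. G t + H t) \<in> borel_measurable \<mu>"
    using G H by (intro borel_measurable_add) (auto simp: bounded_coeff_def)
  ultimately show ?thesis unfolding bounded_coeff_def by blast
qed

lemma bounded_coeff_linear:
  fixes L :: "'a::euclidean_space \<Rightarrow> 'b::euclidean_space"
  assumes L: "bounded_linear L" and G: "bounded_coeff G"
  shows "bounded_coeff (\<lambda>t. L (G t))"
proof -
  obtain K where K: "\<And>x. norm (L x) \<le> norm x * K" "0 \<le> K" using bounded_linear.nonneg_bounded[OF L] by blast
  obtain C where C: "\<forall>t\<in>{0..T}. norm (G t) \<le> C" using G by (auto simp: bounded_coeff_def)
  have "norm (L (G t)) \<le> C * K" if "t \<in> {0..T}" for t
    using order_trans[OF K(1)[of "G t"] mult_right_mono[OF _ K(2)]] C that by blast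
  moreover have "L \<in> borel_measurable borel"
    using linear_continuous_on[OF L] by (rule borel_measurable_continuous_onI)
  ultimately show ?thesis using G measurable_compose[of G \<mu> borel L borel] unfolding bounded_coeff_def by blast
qed

lemma bounded_coeff_bilinear:
  fixes B :: "'a::euclidean_space \<Rightarrow> 'b::euclidean_space \<Rightarrow> 'c::euclidean_space"
  assumes B: "bounded_bilinear B" and G: "bounded_coeff G" and H: "bounded_coeff H"
  shows "bounded_coeff (\<lambda>t. B (G t) (H t))"
proof -
  obtain K where K: "0 \<le> K" "\<And>x y. norm (B x y) \<le> norm x * norm y * K"
    using bounded_bilinear.nonneg_bounded[OF B] by blast
  obtain C D where C: "\<forall>t\<in>{0..T}. norm (G t) \<le> C" and D: "\<forall>t\<in>{0..T}. norm (H t) \<le> D"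
    using G H by (auto simp: bounded_coeff_def)
  have "norm (B (G t) (H t)) \<le> C * D * K" if "t \<in> {0..T}" for t
  proof -
    have "norm (B (G t) (H t)) \<le> norm (G t) * norm (H t) * K" by (rule K)
    also have "\<dots> \<le> C * D * K"
      using C D K that by (intro mult_right_mono mult_mono) (auto intro: order_trans[OF norm_ge_zero])
    finally show ?thesis .
  qed
  then show ?thesis using bounded_bilinear_measurable[OF B] G H unfolding bounded_coeff_def by blast
qed

lemma proc_sq_bounded_bilinear:
  fixes B :: "'a::euclidean_space \<Rightarrow> 'b::euclidean_space \<Rightarrow> 'c::euclidean_space"
  assumes B: "bounded_bilinear B" and G: "bounded_coeff G" and H: "proc_sq H"
  shows "proc_sq (\<lambda>t \<omega>. B (G t) (H t \<omega>))"
proof -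
  obtain K where K: "0 \<le> K" "\<And>x y. norm (B x y) \<le> norm x * norm y * K"
    using bounded_bilinear.nonneg_bounded[OF B] by blast
  obtain C where C: "\<forall>t\<in>{0..T}. norm (G t) \<le> C" using G by (auto simp: bounded_coeff_def)
  show ?thesis
  proof (rule sq_int_bound[OF H])
    have "G \<in> borel_measurable \<mu>" using G by (simp add: bounded_coeff_def)
    from measurable_compose[OF measurable_fst this]
    show "(\<lambda>z. B (G (fst z)) (H (fst z) (snd z))) \<in> borel_measurable \<mu>M"
      by (rule bounded_bilinear_measurable[OF B _ sq_int_measurable[OF H]])
    have "norm (B (G t) y) \<le> (C * K) * norm y" if "t \<in> {0..T}" for t y
    proof -
      have "norm (B (G t) y) \<le> norm (G t) * norm y * K" by (rule K)
      also have "\<dots> \<le> C * norm y * K" using C that K by (intro mult_right_mono) auto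
      finally show ?thesis by (simp add: ac_simps)
    qed
    then show "AE z in \<mu>M. norm (B (G (fst z)) (H (fst z) (snd z))) \<le> (C * K) * norm (H (fst z) (snd z))"
      by (intro AE_I2) (auto simp: space_pair_measure)
  qed
qed

lemmas proc_sq_mult = proc_sq_bounded_bilinear[OF bounded_bilinear_matrix_vector_mult]

lemma bounded_coeff_proc_sq: "bounded_coeff G \<Longrightarrow> proc_sq (\<lambda>t \<omega>. G t)"
proof -
  assume G: "bounded_coeff G"
  obtain C where C: "\<forall>t\<in>{0..T}. norm (G t) \<le> C" using G by (auto simp: bounded_coeff_def)
  show ?thesis
  proof (rule TM.sq_int_bounded)
    show "(\<lambda>z. G (fst z)) \<in> borel_measurable \<mu>M"
      using G measurable_compose[OF measurable_fst, of G \<mu> borel M] by (simp add: bounded_coeff_def)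
  qed (use C in \<open>auto simp: space_pair_measure\<close>)
qed

lemma sq_int_linear:
  fixes L :: "'a::euclidean_space \<Rightarrow> 'b::euclidean_space"
  assumes L: "bounded_linear L" and f: "sq_int N f"
  shows "sq_int N (\<lambda>x. L (f x))"
proof -
  obtain K where K: "\<And>x. norm (L x) \<le> norm x * K" using bounded_linear.bounded[OF L] by blast
  show ?thesis
  proof (rule sq_int_bound[OF f, of _ K])
    show "(\<lambda>x. L (f x)) \<in> borel_measurable N"
      by (rule measurable_compose[OF sq_int_measurable[OF f] borel_measurable_continuous_onI[OF linear_continuous_on[OF L]]])
  qed (use K in \<open>auto simp: mult.commute\<close>)
qed

lemmas sq_int_mult = sq_int_linear[OF matrix_vector_mul_bounded_linear]

lemma F_measurable_mult: "f \<in> borel_measurable (F t) \<Longrightarrow> (\<lambda>\<omega>. G *v f \<omega>) \<in> borel_measurable (F t)"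
  for f :: "'w \<Rightarrow> real^'n" and G :: "real^'n^'m"
  by (rule measurable_compose[OF _ borel_measurable_continuous_onI[OF linear_continuous_on[OF matrix_vector_mul_bounded_linear]]])

text \<open>Fubini applies because \<open>\<eta>\<close>, seen as a process constant in time, is
  square integrable on the product space.\<close>

lemma integral_tint_inner:
  fixes g :: "real \<Rightarrow> 'w \<Rightarrow> 'a::euclidean_space"
  assumes g: "proc_sq g" and \<eta>: "sq_int M \<eta>"
  shows "(\<integral>\<omega>. tint s t (\<lambda>r. g r \<omega>) \<bullet> \<eta> \<omega> \<partial>M) = tint s t (\<lambda>r. \<integral>\<omega>. g r \<omega> \<bullet> \<eta> \<omega> \<partial>M)"
proof -
  have g': "proc_sq (\<lambda>r \<omega>. indicator {s..t} r *\<^sub>R g r \<omega>)" using sq_int_indicator_scale[OF g, of "{s..t}"] by simp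
  have i: "proc_int (\<lambda>r \<omega>. (indicator {s..t} r *\<^sub>R g r \<omega>) \<bullet> \<eta> \<omega>)"
    by (rule proc_sq_inner[OF g' proc_sq_const[OF \<eta>]])
  have "(\<integral>\<omega>. tint s t (\<lambda>r. g r \<omega>) \<bullet> \<eta> \<omega> \<partial>M) = (\<integral>\<omega>. (\<integral>r. (indicator {s..t} r *\<^sub>R g r \<omega>) \<bullet> \<eta> \<omega> \<partial>\<mu>) \<partial>M)"
  proof (rule integral_cong_AE)
    show "(\<lambda>\<omega>. tint s t (\<lambda>r. g r \<omega>) \<bullet> \<eta> \<omega>) \<in> borel_measurable M"
      by (intro borel_measurable_inner sq_int_measurable sq_int_tint g \<eta>)
    show "(\<lambda>\<omega>. \<integral>r. (indicator {s..t} r *\<^sub>R g r \<omega>) \<bullet> \<eta> \<omega> \<partial>\<mu>) \<in> borel_measurable M"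
      using proc_int_facts(3)[OF i] by auto
    have "AE \<omega> in M. integrable \<mu> (\<lambda>r. g r \<omega>)"
      by (rule proc_int_facts(1)[OF TM.sq_int_integrable[OF g]])
    then show "AE \<omega> in M. tint s t (\<lambda>r. g r \<omega>) \<bullet> \<eta> \<omega> = (\<integral>r. (indicator {s..t} r *\<^sub>R g r \<omega>) \<bullet> \<eta> \<omega> \<partial>\<mu>)"
    proof eventually_elim
      case (elim \<omega>)
      have "integrable \<mu> (\<lambda>r. indicator {s..t} r *\<^sub>R g r \<omega>)" by (rule integrable_indicator_scaleR[OF elim]) simp
      then show ?case unfolding tint_def by (intro integral_inner_left[symmetric]) 
    qed
  qed
  also have "\<dots> = (\<integral>r. (\<integral>\<omega>. (indicator {s..t} r *\<^sub>R g r \<omega>) \<bullet> \<eta> \<omega> \<partial>M) \<partial>\<mu>)"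
    using proc_int_facts(4,6)[OF i] by simp
  also have "\<dots> = tint s t (\<lambda>r. \<integral>\<omega>. g r \<omega> \<bullet> \<eta> \<omega> \<partial>M)"
    unfolding tint_def by (intro Bochner_Integration.integral_cong refl) simp
  finally show ?thesis .
qed

lemma tint_0_0: "tint 0 0 f = 0"
proof -
  have "AE x in \<mu>. x \<noteq> 0"
    using AE_lborel_singleton[of 0] by (subst AE_restrict_space_iff) auto
  then have "AE x in \<mu>. indicator {0..0} x *\<^sub>R f x = 0"
    by eventually_elim (auto simp: indicator_def)
  then show ?thesis
    unfolding tint_def by (rule integral_eq_zero_AE)
qed

lemma zero_ext_0: "z \<in> space \<mu>M \<Longrightarrow> zero_ext 0 r H z = indicator {..r} (fst z) *\<^sub>R H (fst z) (snd z)"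
  by (auto simp: zero_ext_def space_pair_measure indicator_def)

text \<open>Linearity of the stochastic integral in its integrand is bypassed: bilinearity expands
  the pairing into four instances of \<open>ito_isometry\<close>.\<close>

lemma ito_isometry_diff:
  fixes B :: "'a::euclidean_space \<Rightarrow> 'a::euclidean_space \<Rightarrow> real"
  assumes B: "bounded_bilinear B" and r: "r \<in> {0..T}" and t: "t \<in> {0..T}"
    and I: "ito i 0 r H I" "ito i 0 r G J" and I': "ito j 0 t H' I'" "ito j 0 t G' J'"
  shows "(\<integral>\<omega>. B (I \<omega> - J \<omega>) (I' \<omega> - J' \<omega>) \<partial>M) = (if i = j then
     (\<integral>z. B (zero_ext 0 r H z - zero_ext 0 r G z) (zero_ext 0 t H' z - zero_ext 0 t G' z) \<partial>\<mu>M) else 0)"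
proof -
  interpret bounded_bilinear B by fact
  have r': "0 \<le> r" "r \<le> T" "0 \<le> t" "t \<le> T" using r t by auto
  note sq = ito_sq_int[OF order_refl r'(1,2) I(1)] ito_sq_int[OF order_refl r'(1,2) I(2)]
    ito_sq_int[OF order_refl r'(3,4) I'(1)] ito_sq_int[OF order_refl r'(3,4) I'(2)]
  have e: "sq_int \<mu>M (zero_ext 0 r H)" "sq_int \<mu>M (zero_ext 0 r G)" "sq_int \<mu>M (zero_ext 0 t H')" "sq_int \<mu>M (zero_ext 0 t G')"
    using I I' r' by (auto simp: has_ito_integral_def intro!: sq_int_zero_ext)
  note bi = sq_int_bilinear_integrable[OF B]
  note iso = ito_isometry[OF B order_refl r'(1,2) _ order_refl r'(3,4)]
  have "(\<integral>\<omega>. B (I \<omega> - J \<omega>) (I' \<omega> - J' \<omega>) \<partial>M) =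
    (\<integral>\<omega>. B (I \<omega>) (I' \<omega>) - B (I \<omega>) (J' \<omega>) - (B (J \<omega>) (I' \<omega>) - B (J \<omega>) (J' \<omega>)) \<partial>M)"
    by (simp add: diff_left diff_right algebra_simps)
  also have "\<dots> = (\<integral>\<omega>. B (I \<omega>) (I' \<omega>) \<partial>M) - (\<integral>\<omega>. B (I \<omega>) (J' \<omega>) \<partial>M)
     - ((\<integral>\<omega>. B (J \<omega>) (I' \<omega>) \<partial>M) - (\<integral>\<omega>. B (J \<omega>) (J' \<omega>) \<partial>M))"
    by (simp add: bi sq)
  also have "\<dots> = (if i = j then (\<integral>z. B (zero_ext 0 r H z) (zero_ext 0 t H' z) \<partial>\<mu>M) - (\<integral>z. B (zero_ext 0 r H z) (zero_ext 0 t G' z) \<partial>\<mu>M)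
     - ((\<integral>z. B (zero_ext 0 r G z) (zero_ext 0 t H' z) \<partial>\<mu>M) - (\<integral>z. B (zero_ext 0 r G z) (zero_ext 0 t G' z) \<partial>\<mu>M)) else 0)"
    by (simp add: iso[OF I(1) I'(1)] iso[OF I(1) I'(2)] iso[OF I(2) I'(1)] iso[OF I(2) I'(2)])
  also have "\<dots> = (if i = j then (\<integral>z. B (zero_ext 0 r H z) (zero_ext 0 t H' z) - B (zero_ext 0 r H z) (zero_ext 0 t G' z)
     - (B (zero_ext 0 r G z) (zero_ext 0 t H' z) - B (zero_ext 0 r G z) (zero_ext 0 t G' z)) \<partial>\<mu>M) else 0)"
    by (simp add: bi e)
  also have "\<dots> = (if i = j then
     (\<integral>z. B (zero_ext 0 r H z - zero_ext 0 r G z) (zero_ext 0 t H' z - zero_ext 0 t G' z) \<partial>\<mu>M) else 0)"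
    by (simp add: diff_left diff_right algebra_simps)
  finally show ?thesis .
qed

end

section \<open>Coefficients, the matrix process \<open>P\<close> and a single state\<close>

locale lq_coefficients = brownian M T W for M :: "'w measure" and T and W :: "real \<Rightarrow> 'w \<Rightarrow> real^'d" +
  fixes x0 :: "real^'n" and b1 A :: "real \<Rightarrow> real^'n^'n" and b2 :: "real \<Rightarrow> real^'n"
    and \<sigma> :: "real \<Rightarrow> real^'k \<Rightarrow> real^'d^'n" and \<Gamma> :: "real^'n^'n" and P :: "real \<Rightarrow> real^'n^'n"
    and B :: "real \<Rightarrow> real^'k^'k"
  assumes b1: "bounded_coeff b1" and A: "bounded_coeff A" and b2: "bounded_coeff b2" and B: "bounded_coeff B"
    and \<Gamma>_sym: "transpose \<Gamma> = \<Gamma>" and A_sym: "t \<in> {0..T} \<Longrightarrow> transpose (A t) = A t"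
    and P: "second_adjoint T b1 A \<Gamma> P"
begin

abbreviation state where "state \<equiv> state_process M T W x0 b1 b2 \<sigma>"

abbreviation diffusion :: "(real \<Rightarrow> 'w \<Rightarrow> real^'k) \<Rightarrow> 'd \<Rightarrow> real \<Rightarrow> 'w \<Rightarrow> real^'n" where
  "diffusion u i s \<omega> \<equiv> column i (\<sigma> s (u s \<omega>))"

text \<open>The integrand of the backward equation for \<open>P\<close>, hence minus its time
  derivative.\<close>

definition P_rate :: "real \<Rightarrow> real^'n^'n" where
  "P_rate s = transpose (b1 s) ** P s + P s ** b1 s + A s"

lemma P_coeff: "bounded_coeff P"
proof (rule bounded_coeffI)
  have c: "continuous_on {0..T} P" using P by (simp add: second_adjoint_def)
  show "P \<in> borel_measurable (restrict_space borel {0..T})"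
    using c by (rule borel_measurable_continuous_on_restrict)
  show "bounded (P ` {0..T})"
    by (intro compact_imp_bounded compact_continuous_image c) simp
qed

lemma P_rate_coeff: "bounded_coeff P_rate"
  unfolding P_rate_def[abs_def]
  by (intro bounded_coeff_add bounded_coeff_bilinear[OF bounded_bilinear_matrix_mult]
      bounded_coeff_linear[OF bounded_linear_transpose] b1 P_coeff A)

lemma P_eq: "t \<in> {0..T} \<Longrightarrow> P t = \<Gamma> + tint t T P_rate"
  using P unfolding second_adjoint_def P_rate_def[abs_def]
  by (simp add: set_lebesgue_integral_eq_tint)

lemma state_sq: "state u X \<Longrightarrow> proc_sq X"
  unfolding state_process_def by (blast intro: proc_sq_square_integrable_process)

lemma state_adapted: "state u X \<Longrightarrow> t \<in> {0..T} \<Longrightarrow> X t \<in> borel_measurable (F t)"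
  by (simp add: state_process_def square_integrable_process_def adapted_process_def)

lemma state_eq:
  assumes "state u X" "t \<in> {0..T}"
  obtains I where "\<And>i. ito i 0 t (diffusion u i) (I i)"
    "AE \<omega> in M. X t \<omega> = x0 + tint 0 t (\<lambda>s. b1 s *v X s \<omega> + b2 s) + (\<Sum>i\<in>UNIV. I i \<omega>)"
proof -
  obtain I where "\<And>i. ito i 0 t (diffusion u i) (I i)"
    "AE \<omega> in M. X t \<omega> = x0 + (LINT s:{0..t}|lborel. b1 s *v X s \<omega> + b2 s) + (\<Sum>i\<in>UNIV. I i \<omega>)"
    using assms unfolding state_process_def by blast
  then show thesis using assms(2) by (intro that) (simp_all add: set_lebesgue_integral_eq_tint)
qed

lemma state_drift_sq: "state u X \<Longrightarrow> proc_sq (\<lambda>s \<omega>. b1 s *v X s \<omega> + b2 s)"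
  by (rule sq_int_add[OF proc_sq_mult[OF b1 state_sq] bounded_coeff_proc_sq[OF b2]])

text \<open>The bound at one fixed time comes from the state equation, whose three terms are square
  integrable there, and not from joint integrability.\<close>

lemma state_sq_int:
  assumes X: "state u X" and t: "t \<in> {0..T}"
  shows "sq_int M (X t)"
proof -
  obtain I where I: "\<And>i. ito i 0 t (diffusion u i) (I i)"
    "AE \<omega> in M. X t \<omega> = x0 + tint 0 t (\<lambda>s. b1 s *v X s \<omega> + b2 s) + (\<Sum>i\<in>UNIV. I i \<omega>)"
    by (rule state_eq[OF X t]) (rule that)
  have t': "0 \<le> t" "t \<le> T" using t by auto
  have "sq_int M (\<lambda>\<omega>. x0 + tint 0 t (\<lambda>s. b1 s *v X s \<omega> + b2 s) + (\<Sum>i\<in>UNIV. I i \<omega>))"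
    by (intro sq_int_add sq_int_const sq_int_tint[OF state_drift_sq[OF X]] sq_int_sum ito_sq_int[OF order_refl t' I(1)])
  then show ?thesis
    by (rule sq_int_cong_AE) (use I(2) F_measurable_M[OF state_adapted[OF X t] t'(2)] in auto)
qed

text \<open>The state equation at time \<open>T\<close> contains the stochastic integral of this
  coefficient over all of \<open>{0..T}\<close>, and \<open>has_ito_integral\<close> includes square
  integrability of the integrand.\<close>

lemma state_diffusion_sq:
  assumes X: "state u X" shows "proc_sq (diffusion u i)"
proof -
  have T: "T \<in> {0..T}" using T_pos by simp
  obtain I where I: "\<And>i. ito i 0 T (diffusion u i) (I i)"
    and "AE \<omega> in M. X T \<omega> = x0 + tint 0 T (\<lambda>s. b1 s *v X s \<omega> + b2 s) + (\<Sum>i\<in>UNIV. I i \<omega>)"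
    by (rule state_eq[OF X T]) (rule that)
  then show ?thesis by (intro proc_sq_square_integrable_process) (auto simp: has_ito_integral_def)
qed

end

section \<open>Difference of two states and its martingale part\<close>

locale lq_pair = lq_coefficients M T W x0 b1 A b2 \<sigma> \<Gamma> P B
  for M :: "'w measure" and T and W :: "real \<Rightarrow> 'w \<Rightarrow> real^'d"
    and x0 :: "real^'n" and b1 A b2 and \<sigma> :: "real \<Rightarrow> real^'k \<Rightarrow> real^'d^'n" and \<Gamma> P B +
  fixes u v :: "real \<Rightarrow> 'w \<Rightarrow> real^'k" and X Y :: "real \<Rightarrow> 'w \<Rightarrow> real^'n"
  assumes X: "state u X" and Y: "state v Y"
begin

text \<open>\<open>Mt t\<close> is the sum of the stochastic integrals of \<open>\<Delta>\<close> up to \<open>t\<close>. These are defined only for each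
  \<open>t\<close> separately and up to null sets, so \<open>Mt\<close> is introduced as \<open>D\<close> minus its drift, which is
  jointly measurable.\<close>

definition D :: "real \<Rightarrow> 'w \<Rightarrow> real^'n" where "D t \<omega> = Y t \<omega> - X t \<omega>"
definition \<beta> :: "real \<Rightarrow> 'w \<Rightarrow> real^'n" where "\<beta> t \<omega> = b1 t *v D t \<omega>"
definition Mt :: "real \<Rightarrow> 'w \<Rightarrow> real^'n" where "Mt t \<omega> = D t \<omega> - tint 0 t (\<lambda>r. \<beta> r \<omega>)"
definition \<Delta> :: "'d \<Rightarrow> real \<times> 'w \<Rightarrow> real^'n" where
  "\<Delta> i z = diffusion v i (fst z) (snd z) - diffusion u i (fst z) (snd z)"

lemma D_sq: "proc_sq D" unfolding D_def by (rule sq_int_diff[OF state_sq[OF Y] state_sq[OF X]])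
lemma \<beta>_sq: "proc_sq \<beta>" unfolding \<beta>_def by (rule proc_sq_mult[OF b1 D_sq])
lemma Mt_sq: "proc_sq Mt" unfolding Mt_def by (rule sq_int_diff[OF D_sq proc_sq_integral[OF \<beta>_sq]])
lemma \<Delta>_sq: "sq_int \<mu>M (\<Delta> i)" unfolding \<Delta>_def[abs_def]
  by (rule sq_int_diff[OF state_diffusion_sq[OF Y] state_diffusion_sq[OF X]])

lemma D_sq_int: "t \<in> {0..T} \<Longrightarrow> sq_int M (D t)"
  unfolding D_def[abs_def] by (intro sq_int_diff state_sq_int[OF X] state_sq_int[OF Y])

lemma D_adapted: "t \<in> {0..T} \<Longrightarrow> D t \<in> borel_measurable (F t)"
  unfolding D_def[abs_def] by (intro borel_measurable_diff state_adapted[OF X] state_adapted[OF Y])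

lemma Mt_sq_int: "t \<in> {0..T} \<Longrightarrow> sq_int M (Mt t)"
  unfolding Mt_def[abs_def] by (intro sq_int_diff D_sq_int sq_int_tint \<beta>_sq)

text \<open>Ties \<open>Mt\<close> at a single time to versions of the stochastic integrals. Those
  for \<open>v\<close> and for \<open>u\<close> stay separate, so that each result on stochastic
  integrals applies to them individually.\<close>

definition Mt_rep where
  "Mt_rep t I J \<longleftrightarrow> (\<forall>i. ito i 0 t (diffusion v i) (I i) \<and> ito i 0 t (diffusion u i) (J i)) \<and>
     (AE \<omega> in M. Mt t \<omega> = (\<Sum>i\<in>UNIV. I i \<omega> - J i \<omega>))"

lemma Mt_repD:
  assumes "Mt_rep t I J"
  shows "ito i 0 t (diffusion v i) (I i)" "ito i 0 t (diffusion u i) (J i)"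
    "AE \<omega> in M. Mt t \<omega> = (\<Sum>i\<in>UNIV. I i \<omega> - J i \<omega>)"
  using assms by (simp_all add: Mt_rep_def)

text \<open>The initial value \<open>x0\<close> and the inhomogeneity \<open>b2\<close> are common
  to both states and cancel, so the difference of the drifts is linear in \<open>D\<close>.\<close>

lemma Mt_rep_exists:
  assumes t: "t \<in> {0..T}"
  shows "\<exists>I J. Mt_rep t I J"
proof -
  obtain I where I: "\<And>i. ito i 0 t (diffusion v i) (I i)"
    "AE \<omega> in M. Y t \<omega> = x0 + tint 0 t (\<lambda>s. b1 s *v Y s \<omega> + b2 s) + (\<Sum>i\<in>UNIV. I i \<omega>)"
    by (rule state_eq[OF Y t]) (rule that)
  obtain J where J: "\<And>i. ito i 0 t (diffusion u i) (J i)"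
    "AE \<omega> in M. X t \<omega> = x0 + tint 0 t (\<lambda>s. b1 s *v X s \<omega> + b2 s) + (\<Sum>i\<in>UNIV. J i \<omega>)"
    by (rule state_eq[OF X t]) (rule that)
  have "AE \<omega> in M. integrable \<mu> (\<lambda>s. b1 s *v Y s \<omega> + b2 s)" "AE \<omega> in M. integrable \<mu> (\<lambda>s. b1 s *v X s \<omega> + b2 s)"
    by (rule proc_int_facts(1)[OF TM.sq_int_integrable[OF state_drift_sq[OF Y]]]
        proc_int_facts(1)[OF TM.sq_int_integrable[OF state_drift_sq[OF X]]])+
  then have "AE \<omega> in M. Mt t \<omega> = (\<Sum>i\<in>UNIV. I i \<omega> - J i \<omega>)"
    using I(2) J(2)
  proof eventually_elim
    case (elim \<omega>)
    have "tint 0 t (\<lambda>r. \<beta> r \<omega>) = tint 0 t (\<lambda>s. (b1 s *v Y s \<omega> + b2 s) - (b1 s *v X s \<omega> + b2 s))"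
      by (simp add: \<beta>_def D_def matrix_vector_mult_diff_distrib)
    also have "\<dots> = tint 0 t (\<lambda>s. b1 s *v Y s \<omega> + b2 s) - tint 0 t (\<lambda>s. b1 s *v X s \<omega> + b2 s)"
      by (rule tint_diff[OF elim(1,2)])
    finally show ?case using elim by (simp add: Mt_def D_def sum_subtractf)
  qed
  with I(1) J(1) show ?thesis unfolding Mt_rep_def by blast
qed

lemma integral_inner_Mt:
  assumes \<eta>: "sq_int M \<eta>" and t: "t \<in> {0..T}"
    and IJ: "Mt_rep t I J"
  shows "mean_inner \<eta> (Mt t) =
    (\<Sum>i\<in>UNIV. mean_inner \<eta> (I i) - mean_inner \<eta> (J i))"
proof -
  have t': "0 \<le> t" "t \<le> T" using t by auto
  note IJ = Mt_repD[OF IJ]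
  have sq: "sq_int M (I i)" "sq_int M (J i)" for i
    by (rule ito_sq_int[OF order_refl t' IJ(1)] ito_sq_int[OF order_refl t' IJ(2)])+
  have i: "integrable M (\<lambda>\<omega>. \<eta> \<omega> \<bullet> I i \<omega>)" "integrable M (\<lambda>\<omega>. \<eta> \<omega> \<bullet> J i \<omega>)" for i
    by (rule sq_int_inner_integrable[OF \<eta> sq(1)] sq_int_inner_integrable[OF \<eta> sq(2)])+
  have "mean_inner \<eta> (Mt t) = (\<integral>\<omega>. (\<Sum>i\<in>UNIV. \<eta> \<omega> \<bullet> I i \<omega> - \<eta> \<omega> \<bullet> J i \<omega>) \<partial>M)"
  proof (rule integral_cong_AE)
    show "(\<lambda>\<omega>. \<eta> \<omega> \<bullet> Mt t \<omega>) \<in> borel_measurable M"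
      using sq_int_inner_integrable[OF \<eta> Mt_sq_int[OF t]] by auto
    show "(\<lambda>\<omega>. \<Sum>i\<in>UNIV. \<eta> \<omega> \<bullet> I i \<omega> - \<eta> \<omega> \<bullet> J i \<omega>) \<in> borel_measurable M"
      using i by (intro borel_measurable_sum borel_measurable_diff) auto
    show "AE \<omega> in M. \<eta> \<omega> \<bullet> Mt t \<omega> = (\<Sum>i\<in>UNIV. \<eta> \<omega> \<bullet> I i \<omega> - \<eta> \<omega> \<bullet> J i \<omega>)"
      using IJ(3) by eventually_elim (simp add: inner_sum_right inner_diff_right)
  qed
  then show ?thesis using i by simp
qed

text \<open>The representations at \<open>T\<close> and at \<open>s\<close> use unrelated versions;
  \<open>ito_martingale\<close> matches them component by component inside the pairing with
  \<open>\<eta>\<close>.\<close>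

lemma Mt_martingale:
  assumes s: "s \<in> {0..T}" and \<eta>: "\<eta> \<in> borel_measurable (F s)" "sq_int M \<eta>"
  shows "mean_inner \<eta> (Mt T) = mean_inner \<eta> (Mt s)"
proof -
  have T: "T \<in> {0..T}" and s': "0 \<le> s" "s \<le> T" using s T_pos by auto
  obtain I J where R: "Mt_rep T I J" using Mt_rep_exists[OF T] by blast
  note IJ = Mt_repD[OF this]
  obtain I' J' where R': "Mt_rep s I' J'" using Mt_rep_exists[OF s] by blast
  note IJ' = Mt_repD[OF this]
  show ?thesis
    unfolding integral_inner_Mt[OF \<eta>(2) T R] integral_inner_Mt[OF \<eta>(2) s R']
      ito_martingale[OF s' IJ(1) IJ'(1) \<eta>] ito_martingale[OF s' IJ(2) IJ'(2) \<eta>] ..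
qed

lemma Mt_orth0:
  assumes \<eta>: "\<eta> \<in> borel_measurable (F 0)" "sq_int M \<eta>"
  shows "mean_inner \<eta> (Mt T) = 0"
proof -
  have T: "T \<in> {0..T}" and T0: "0 \<le> T" using T_pos by auto
  obtain I J where R: "Mt_rep T I J" using Mt_rep_exists[OF T] by blast
  note IJ = Mt_repD[OF this]
  show ?thesis
    unfolding integral_inner_Mt[OF \<eta>(2) T R]
    by (simp add: ito_orth[OF order_refl T0 order_refl IJ(1) \<eta>] ito_orth[OF order_refl T0 order_refl IJ(2) \<eta>])
qed

text \<open>Integrals against different Brownian components are orthogonal, which removes the
  off-diagonal pairs; the zero extension of the integrands up to \<open>r\<close> leaves the
  indicator.\<close>

lemma Mt_isometry:
  fixes B' :: "real^'n \<Rightarrow> real^'n \<Rightarrow> real"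
  assumes B: "bounded_bilinear B'" and r: "r \<in> {0..T}"
  shows "(\<integral>\<omega>. B' (Mt r \<omega>) (Mt T \<omega>) \<partial>M) = (\<integral>z. indicator {..r} (fst z) * (\<Sum>i\<in>UNIV. B' (\<Delta> i z) (\<Delta> i z)) \<partial>\<mu>M)"
proof -
  interpret bounded_bilinear B' by fact
  have T: "T \<in> {0..T}" and T0: "0 \<le> T" and r': "0 \<le> r" "r \<le> T" using T_pos r by auto
  obtain I J where R: "Mt_rep r I J" using Mt_rep_exists[OF r] by blast
  note IJ = Mt_repD[OF this]
  obtain I' J' where R': "Mt_rep T I' J'" using Mt_rep_exists[OF T] by blast
  note IJ' = Mt_repD[OF this]
  let ?Z = "\<lambda>i \<omega>. I i \<omega> - J i \<omega>" and ?Z' = "\<lambda>i \<omega>. I' i \<omega> - J' i \<omega>"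
    and ?v = "\<lambda>i r. zero_ext 0 r (diffusion v i)" and ?u = "\<lambda>i r. zero_ext 0 r (diffusion u i)"
  have sq: "sq_int M (?Z i)" "sq_int M (?Z' i)" for i
    by (intro sq_int_diff ito_sq_int[OF order_refl r' IJ(1)] ito_sq_int[OF order_refl r' IJ(2)]
        ito_sq_int[OF order_refl T0 order_refl IJ'(1)] ito_sq_int[OF order_refl T0 order_refl IJ'(2)])+
  note bi = sq_int_bilinear_integrable[OF B]
  have "(\<integral>\<omega>. B' (Mt r \<omega>) (Mt T \<omega>) \<partial>M) = (\<integral>\<omega>. B' (\<Sum>i\<in>UNIV. ?Z i \<omega>) (\<Sum>i\<in>UNIV. ?Z' i \<omega>) \<partial>M)"
  proof (rule integral_cong_AE)
    show "(\<lambda>\<omega>. B' (Mt r \<omega>) (Mt T \<omega>)) \<in> borel_measurable M"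
      by (rule bounded_bilinear_measurable[OF B sq_int_measurable[OF Mt_sq_int[OF r]] sq_int_measurable[OF Mt_sq_int[OF T]]])
    show "(\<lambda>\<omega>. B' (\<Sum>i\<in>UNIV. ?Z i \<omega>) (\<Sum>i\<in>UNIV. ?Z' i \<omega>)) \<in> borel_measurable M"
      by (rule bounded_bilinear_measurable[OF B]; rule sq_int_measurable; rule sq_int_sum; rule sq)
    show "AE \<omega> in M. B' (Mt r \<omega>) (Mt T \<omega>) = B' (\<Sum>i\<in>UNIV. ?Z i \<omega>) (\<Sum>i\<in>UNIV. ?Z' i \<omega>)"
      using IJ(3) IJ'(3) by eventually_elim simp
  qed
  also have "\<dots> = (\<integral>\<omega>. (\<Sum>i\<in>UNIV. \<Sum>j\<in>UNIV. B' (?Z i \<omega>) (?Z' j \<omega>)) \<partial>M)"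
    unfolding sum_left unfolding sum_right ..
  also have "\<dots> = (\<Sum>i\<in>UNIV. \<Sum>j\<in>UNIV. (\<integral>\<omega>. B' (?Z i \<omega>) (?Z' j \<omega>) \<partial>M))"
    by (simp add: Bochner_Integration.integral_sum Bochner_Integration.integrable_sum bi[OF sq(1) sq(2)])
  also have "\<dots> = (\<Sum>i\<in>UNIV. \<integral>z. indicator {..r} (fst z) * B' (\<Delta> i z) (\<Delta> i z) \<partial>\<mu>M)"
  proof (intro sum.cong refl)
    fix i
    have "(\<Sum>j\<in>UNIV. (\<integral>\<omega>. B' (?Z i \<omega>) (?Z' j \<omega>) \<partial>M)) =
       (\<integral>z. B' (?v i r z - ?u i r z)
         (?v i T z - ?u i T z) \<partial>\<mu>M)"
      unfolding ito_isometry_diff[OF B r T IJ(1) IJ(2) IJ'(1) IJ'(2)] by simp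
    also have "\<dots> = (\<integral>z. indicator {..r} (fst z) * B' (\<Delta> i z) (\<Delta> i z) \<partial>\<mu>M)"
    proof (intro Bochner_Integration.integral_cong refl)
      fix z assume z: "z \<in> space \<mu>M"
      have "indicator {..T} (fst z) = (1::real)" using z by (auto simp: space_pair_measure)
      then show "B' (?v i r z - ?u i r z)
         (?v i T z - ?u i T z) = indicator {..r} (fst z) * B' (\<Delta> i z) (\<Delta> i z)"
        unfolding zero_ext_0[OF z] by (simp add: \<Delta>_def scaleR_left flip: scaleR_diff_right)
    qed
    finally show "(\<Sum>j\<in>UNIV. (\<integral>\<omega>. B' (?Z i \<omega>) (?Z' j \<omega>) \<partial>M)) =
      (\<integral>z. indicator {..r} (fst z) * B' (\<Delta> i z) (\<Delta> i z) \<partial>\<mu>M)" .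
  qed
  also have "\<dots> = (\<integral>z. (\<Sum>i\<in>UNIV. indicator {..r} (fst z) * B' (\<Delta> i z) (\<Delta> i z)) \<partial>\<mu>M)"
  proof (rule Bochner_Integration.integral_sum[symmetric])
    fix i
    have "integrable \<mu>M (\<lambda>z. B' (indicator {..r} (fst z) *\<^sub>R \<Delta> i z) (\<Delta> i z))"
      by (intro bi sq_int_indicator_scale \<Delta>_sq) simp
    then show "integrable \<mu>M (\<lambda>z. indicator {..r} (fst z) * B' (\<Delta> i z) (\<Delta> i z))"
      by (simp add: scaleR_left)
  qed
  finally show ?thesis by (simp add: sum_distrib_left)
qed

section \<open>The second-order adjoint process\<close>

lemma T_in: "T \<in> {0..T}" and zero_in: "0 \<in> {0..T}"
  using T_pos by auto

text \<open>Transposing \<open>G\<close> onto \<open>\<eta>\<close> gives a variable that is still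
  known at \<open>s\<close>, hence also at \<open>r\<close>, and both sides equal its pairing with
  \<open>Mt T\<close>.\<close>

lemma Mt_martingale_matrix:
  fixes G :: "real^'n^'n"
  assumes s: "s \<in> {0..T}" and r: "r \<in> {s..T}" and \<eta>: "\<eta> \<in> borel_measurable (F s)" "sq_int M \<eta>"
  shows "mean_inner (\<lambda>\<omega>. G *v Mt r \<omega>) \<eta> = mean_inner (\<lambda>\<omega>. G *v Mt s \<omega>) \<eta>"
proof -
  let ?\<eta> = "\<lambda>\<omega>. transpose G *v \<eta> \<omega>"
  have r': "r \<in> {0..T}" "s \<le> r" using s r by auto
  have m: "?\<eta> \<in> borel_measurable (F s)" by (rule F_measurable_mult[OF \<eta>(1)])
  have sq: "sq_int M ?\<eta>" by (rule sq_int_mult[OF \<eta>(2)])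
  have "mean_inner (\<lambda>\<omega>. G *v Mt t \<omega>) \<eta> = (\<integral>\<omega>. ?\<eta> \<omega> \<bullet> Mt t \<omega> \<partial>M)" for t
    by (intro Bochner_Integration.integral_cong refl) (rule trans[OF matrix_vector_inner_transpose inner_commute])
  then show ?thesis
    using Mt_martingale[OF s m sq] Mt_martingale[OF r'(1) F_measurable_mono[OF m r'(2)] sq] by simp
qed

text \<open>The process \<open>P t *v D t\<close> solves the first-order adjoint equation with \<open>D\<close> in place of the state:
  its drift is \<open>-drift2\<close> and its stochastic integral over \<open>{s..T}\<close> is \<open>noise2 s\<close>. Hence \<open>duality\<close> also yields the
  quadratic terms.\<close>

definition drift2 :: "real \<Rightarrow> 'w \<Rightarrow> real^'n" where
  "drift2 r \<omega> = transpose (b1 r) *v (P r *v D r \<omega>) + A r *v D r \<omega>"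

definition noise2 :: "real \<Rightarrow> 'w \<Rightarrow> real^'n" where
  "noise2 s \<omega> = \<Gamma> *v D T \<omega> + tint s T (\<lambda>r. drift2 r \<omega>) - P s *v D s \<omega>"

lemma drift2_sq: "proc_sq drift2"
  unfolding drift2_def
  by (rule sq_int_add[OF proc_sq_mult[OF bounded_coeff_linear[OF bounded_linear_transpose b1] proc_sq_mult[OF P_coeff D_sq]]
        proc_sq_mult[OF A D_sq]])

text \<open>The summand \<open>P r ** b1 r\<close> of \<open>P_rate r\<close> acts on
  \<open>D r \<omega>\<close> as \<open>P r\<close> does on \<open>\<beta> r \<omega>\<close>. So
  \<open>drift2\<close> is minus the drift that a product rule predicts for
  \<open>P r *v D r \<omega>\<close>.\<close>

lemma drift2_eq: "drift2 r \<omega> = P_rate r *v D r \<omega> - P r *v \<beta> r \<omega>"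
  by (simp add: drift2_def P_rate_def \<beta>_def matrix_vector_mult_add_rdistrib matrix_vector_mul_assoc)

text \<open>With \<open>D\<close> written as accumulated drift plus \<open>Mt\<close>, the
  contributions of the accumulated drift cancel, by integration by parts between that drift and
  \<open>P\<close>. What is left involves \<open>Mt\<close> alone, about which pairings are known.
  The exceptional set concerns only integrability of paths in time, so one set serves all
  \<open>s\<close>.\<close>

lemma noise2_path:
  "AE \<omega> in M. \<forall>s\<in>{0..T}. noise2 s \<omega> = \<Gamma> *v Mt T \<omega> - P s *v Mt s \<omega> + tint s T (\<lambda>r. P_rate r *v Mt r \<omega>)"
proof -
  have "AE \<omega> in M. integrable \<mu> (\<lambda>r. \<beta> r \<omega>)" "AE \<omega> in M. integrable \<mu> (\<lambda>r. P_rate r *v D r \<omega>)"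
    "AE \<omega> in M. integrable \<mu> (\<lambda>r. P r *v \<beta> r \<omega>)" "AE \<omega> in M. integrable \<mu> (\<lambda>r. P_rate r *v Mt r \<omega>)"
    by (rule proc_int_facts(1)[OF TM.sq_int_integrable[OF \<beta>_sq]]
        proc_int_facts(1)[OF TM.sq_int_integrable[OF proc_sq_mult[OF P_rate_coeff D_sq]]]
        proc_int_facts(1)[OF TM.sq_int_integrable[OF proc_sq_mult[OF P_coeff \<beta>_sq]]]
        proc_int_facts(1)[OF TM.sq_int_integrable[OF proc_sq_mult[OF P_rate_coeff Mt_sq]]])+
  then show ?thesis
  proof eventually_elim
    case (elim \<omega>)
    show ?case
    proof
      fix s assume s: "s \<in> {0..T}"
      let ?K = "\<lambda>t. tint 0 t (\<lambda>r. \<beta> r \<omega>)"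
      \<comment> \<open>The following chain evaluates a difference; \<open>gen\<close> solves it for
        the first term.\<close>
      have gen: "a = b + c - d" if "a - b = c - d" for a b c d :: "real^'n"
      proof -
        have "a = b + (a - b)" by simp
        also have "\<dots> = b + c - d" unfolding that by simp
        finally show ?thesis .
      qed
      let ?h = "\<lambda>f. tint s T (\<lambda>r. P_rate r *v f r)"
      have hi: "integrable \<mu> P_rate" by (rule bounded_coeff_integrable[OF P_rate_coeff])
      have D_eq: "D t \<omega> = ?K t + Mt t \<omega>" for t by (simp add: Mt_def)
      have hK_eq: "P_rate r *v D r \<omega> - P_rate r *v Mt r \<omega> = P_rate r *v ?K r" for r
        by (simp add: D_eq matrix_vector_right_distrib)
      have hK: "integrable \<mu> (\<lambda>r. P_rate r *v ?K r)"
        unfolding hK_eq[symmetric] using elim by simp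
      have hKs: "integrable \<mu> (\<lambda>r. P_rate r *v x)" for x
        by (rule bounded_coeff_integrable[OF bounded_coeff_linear[OF
            bounded_bilinear.bounded_linear_left[OF bounded_bilinear_matrix_vector_mult] P_rate_coeff]])
      have G\<beta>: "integrable \<mu> (\<lambda>r. \<Gamma> *v \<beta> r \<omega>)"
        by (rule integrable_bounded_linear[OF matrix_vector_mul_bounded_linear elim(1)])
      \<comment> \<open>\<open>P q - \<Gamma>\<close> is the integral of \<open>P_rate\<close> from
        \<open>q\<close> to \<open>T\<close>, the shape in which \<open>fubini_triangle\<close>
        applies.\<close>
      have "tint s T (\<lambda>q. P q *v \<beta> q \<omega>) - \<Gamma> *v tint s T (\<lambda>q. \<beta> q \<omega>) =
        tint s T (\<lambda>q. P q *v \<beta> q \<omega> - \<Gamma> *v \<beta> q \<omega>)"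
        using tint_linear[OF matrix_vector_mul_bounded_linear elim(1), of s T \<Gamma>] tint_diff[OF elim(3) G\<beta>, of s T] by simp
      also have "\<dots> = tint s T (\<lambda>q. tint q T P_rate *v \<beta> q \<omega>)"
        by (rule tint_cong) (simp add: P_eq matrix_vector_mult_add_rdistrib)
      also have "\<dots> = tint s T (\<lambda>r. P_rate r *v tint s r (\<lambda>q. \<beta> q \<omega>))"
        using s by (intro fubini_triangle[OF bounded_bilinear_matrix_vector_mult hi elim(1)]) auto
      \<comment> \<open>The inner integral starts at \<open>s\<close> while \<open>?K\<close> starts
        at 0. The constant \<open>?K s\<close> accounts for this and will carry the factor
        \<open>P s - \<Gamma>\<close>.\<close>
      also have "\<dots> = tint s T (\<lambda>r. P_rate r *v ?K r - P_rate r *v ?K s)"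
      proof (rule tint_cong)
        fix r assume "r \<in> {s..T}"
        then have "?K r = ?K s + tint s r (\<lambda>q. \<beta> q \<omega>)"
          using s by (intro tint_split elim(1)) auto
        then show "P_rate r *v tint s r (\<lambda>q. \<beta> q \<omega>) = P_rate r *v ?K r - P_rate r *v ?K s"
          by (simp only: matrix_vector_right_distrib add_diff_cancel_left')
      qed
      also have "\<dots> = ?h ?K - ?h (\<lambda>_. ?K s)"
        by (rule tint_diff[OF hK hKs])
      also have "?h (\<lambda>_. ?K s) = tint s T P_rate *v ?K s"
        by (rule tint_linear[OF bounded_bilinear.bounded_linear_left[OF bounded_bilinear_matrix_vector_mult] hi])
      also have "tint s T P_rate = P s - \<Gamma>" using P_eq[OF s] by simp
      finally have 1: "tint s T (\<lambda>q. P q *v \<beta> q \<omega>) = \<Gamma> *v tint s T (\<lambda>q. \<beta> q \<omega>) + ?h ?K - (P s - \<Gamma>) *v ?K s"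
        by (rule gen)
      have 2: "tint s T (\<lambda>q. \<beta> q \<omega>) = ?K T - ?K s"
        using tint_split[OF _ _ elim(1), of s T] s by (simp only: atLeastAtMost_iff) simp
      have "tint s T (\<lambda>r. drift2 r \<omega>) = ?h (\<lambda>r. D r \<omega>) - tint s T (\<lambda>r. P r *v \<beta> r \<omega>)"
        unfolding drift2_eq by (rule tint_diff[OF elim(2,3)])
      moreover have "?h (\<lambda>r. D r \<omega>) - ?h (\<lambda>r. Mt r \<omega>) = ?h ?K"
        unfolding hK_eq[symmetric] by (rule tint_diff[OF elim(2,4), symmetric])
      ultimately show "noise2 s \<omega> = \<Gamma> *v Mt T \<omega> - P s *v Mt s \<omega> + ?h (\<lambda>r. Mt r \<omega>)"
        unfolding noise2_def D_eq[of T] D_eq[of s] 1 2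
        by (simp only: matrix_vector_right_distrib matrix_vector_mult_diff_distrib matrix_vector_mult_diff_rdistrib)
           (simp only: algebra_simps)
    qed
  qed
qed

lemma noise2_sq_int: "s \<in> {0..T} \<Longrightarrow> sq_int M (noise2 s)"
  unfolding noise2_def[abs_def]
  by (rule sq_int_diff[OF sq_int_add[OF sq_int_mult[OF D_sq_int[OF T_in]] sq_int_tint[OF drift2_sq]] sq_int_mult[OF D_sq_int]])

lemma integral_noise2_inner:
  assumes s: "s \<in> {0..T}" and \<eta>: "sq_int M \<eta>"
  shows "mean_inner (noise2 s) \<eta> = mean_inner (\<lambda>\<omega>. \<Gamma> *v Mt T \<omega>) \<eta> - mean_inner (\<lambda>\<omega>. P s *v Mt s \<omega>) \<eta>
    + tint s T (\<lambda>r. \<integral>\<omega>. (P_rate r *v Mt r \<omega>) \<bullet> \<eta> \<omega> \<partial>M)"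
proof -
  have hM: "proc_sq (\<lambda>r \<omega>. P_rate r *v Mt r \<omega>)" by (rule proc_sq_mult[OF P_rate_coeff Mt_sq])
  have sq: "sq_int M (\<lambda>\<omega>. \<Gamma> *v Mt T \<omega>)" "sq_int M (\<lambda>\<omega>. P s *v Mt s \<omega>)" "sq_int M (\<lambda>\<omega>. tint s T (\<lambda>r. P_rate r *v Mt r \<omega>))"
    by (rule sq_int_mult[OF Mt_sq_int[OF T_in]] sq_int_mult[OF Mt_sq_int[OF s]] sq_int_tint[OF hM])+
  note i = sq_int_inner_integrable[OF sq(1) \<eta>] sq_int_inner_integrable[OF sq(2) \<eta>] sq_int_inner_integrable[OF sq(3) \<eta>]
  let ?f = "\<lambda>\<omega>. (\<Gamma> *v Mt T \<omega>) \<bullet> \<eta> \<omega> - (P s *v Mt s \<omega>) \<bullet> \<eta> \<omega> + tint s T (\<lambda>r. P_rate r *v Mt r \<omega>) \<bullet> \<eta> \<omega>"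
  have "mean_inner (noise2 s) \<eta> = (\<integral>\<omega>. ?f \<omega> \<partial>M)"
  proof (rule integral_cong_AE)
    show "(\<lambda>\<omega>. noise2 s \<omega> \<bullet> \<eta> \<omega>) \<in> borel_measurable M"
      using sq_int_inner_integrable[OF noise2_sq_int[OF s] \<eta>] by auto
    show "?f \<in> borel_measurable M"
      using i by auto
    show "AE \<omega> in M. noise2 s \<omega> \<bullet> \<eta> \<omega> = ?f \<omega>"
      using noise2_path by eventually_elim (use s in \<open>simp add: inner_diff_left inner_add_left\<close>)
  qed
  also have "\<dots> = mean_inner (\<lambda>\<omega>. \<Gamma> *v Mt T \<omega>) \<eta> - mean_inner (\<lambda>\<omega>. P s *v Mt s \<omega>) \<eta>
    + (\<integral>\<omega>. tint s T (\<lambda>r. P_rate r *v Mt r \<omega>) \<bullet> \<eta> \<omega> \<partial>M)"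
    using i by simp
  finally show ?thesis unfolding integral_tint_inner[OF hM \<eta>] .
qed

text \<open>Against a variable known at \<open>s\<close>, every later \<open>Mt r\<close>, and
  \<open>Mt T\<close>, may be replaced by \<open>Mt s\<close>. The matrix then acting on
  \<open>Mt s\<close> is \<open>\<Gamma> - P s\<close> plus the integral of \<open>P_rate\<close>
  over \<open>{s..T}\<close>, which is zero by the equation for \<open>P\<close>.\<close>

lemma noise2_orth:
  assumes s: "s \<in> {0..T}" and \<eta>: "\<eta> \<in> borel_measurable (F s)" "sq_int M \<eta>"
  shows "mean_inner (noise2 s) \<eta> = 0"
proof -
  have Ms: "sq_int M (Mt s)" by (rule Mt_sq_int[OF s])
  have hMs: "proc_sq (\<lambda>r \<omega>. P_rate r *v Mt s \<omega>)" by (rule proc_sq_mult[OF P_rate_coeff proc_sq_const[OF Ms]])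
  have i: "integrable M (\<lambda>\<omega>. (G *v Mt s \<omega>) \<bullet> \<eta> \<omega>)" for G :: "real^'n^'n"
    by (rule sq_int_inner_integrable[OF sq_int_mult[OF Ms] \<eta>(2)])
  have "tint s T (\<lambda>r. \<integral>\<omega>. (P_rate r *v Mt r \<omega>) \<bullet> \<eta> \<omega> \<partial>M) = tint s T (\<lambda>r. \<integral>\<omega>. (P_rate r *v Mt s \<omega>) \<bullet> \<eta> \<omega> \<partial>M)"
    by (rule tint_cong) (rule Mt_martingale_matrix[OF s _ \<eta>])
  also have "\<dots> = (\<integral>\<omega>. tint s T (\<lambda>r. P_rate r *v Mt s \<omega>) \<bullet> \<eta> \<omega> \<partial>M)"
    by (rule integral_tint_inner[OF hMs \<eta>(2), symmetric])
  also have "\<dots> = (\<integral>\<omega>. (P s *v Mt s \<omega>) \<bullet> \<eta> \<omega> - (\<Gamma> *v Mt s \<omega>) \<bullet> \<eta> \<omega> \<partial>M)"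
  proof (intro Bochner_Integration.integral_cong refl)
    fix \<omega>
    have "tint s T (\<lambda>r. P_rate r *v Mt s \<omega>) = tint s T P_rate *v Mt s \<omega>"
      by (rule tint_linear[OF bounded_bilinear.bounded_linear_left[OF bounded_bilinear_matrix_vector_mult]
            bounded_coeff_integrable[OF P_rate_coeff]])
    then show "tint s T (\<lambda>r. P_rate r *v Mt s \<omega>) \<bullet> \<eta> \<omega> = (P s *v Mt s \<omega>) \<bullet> \<eta> \<omega> - (\<Gamma> *v Mt s \<omega>) \<bullet> \<eta> \<omega>"
      using P_eq[OF s] by (simp add: matrix_vector_mult_add_rdistrib inner_add_left)
  qed
  also have "\<dots> = mean_inner (\<lambda>\<omega>. P s *v Mt s \<omega>) \<eta> - mean_inner (\<lambda>\<omega>. \<Gamma> *v Mt s \<omega>) \<eta>"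
    using i by simp
  finally show ?thesis
    unfolding integral_noise2_inner[OF s \<eta>(2)]
    using Mt_martingale_matrix[OF s _ \<eta>, of T \<Gamma>] s by simp
qed

text \<open>The density of the matrix-valued quadratic variation of \<open>Mt\<close>. Keeping the
  matrix, rather than one quadratic form of it, allows weights that vary in time to be applied after
  the expectation.\<close>

definition outer\<Delta> :: "real \<times> 'w \<Rightarrow> real^'n^'n" where
  "outer\<Delta> z = (\<Sum>i\<in>UNIV. outer (\<Delta> i z) (\<Delta> i z))"

lemma outer\<Delta>_integrable: "integrable \<mu>M outer\<Delta>"
  unfolding outer\<Delta>_def[abs_def]
  by (intro Bochner_Integration.integrable_sum sq_int_bilinear_integrable[OF bounded_bilinear_outer] \<Delta>_sq)

lemma inner_outer\<Delta>: "G \<bullet> outer\<Delta> z = (\<Sum>i\<in>UNIV. (G *v \<Delta> i z) \<bullet> \<Delta> i z)"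
  by (simp add: outer\<Delta>_def inner_sum_right inner_outer)

text \<open>With \<open>G\<close> taken out, the dependence on \<open>r\<close> sits in the limit of
  a time integral, so that Fubini on the triangle can be used when \<open>G\<close> is
  \<open>P_rate r\<close>.\<close>

lemma Mt_isometry_matrix:
  assumes r: "r \<in> {0..T}"
  shows "mean_inner (\<lambda>\<omega>. G *v Mt r \<omega>) (Mt T) = G \<bullet> tint 0 r (\<lambda>q. \<integral>\<omega>. outer\<Delta> (q, \<omega>) \<partial>M)"
proof -
  have O: "proc_int (\<lambda>q \<omega>. outer\<Delta> (q, \<omega>))" using outer\<Delta>_integrable by simp
  have O': "proc_int (\<lambda>q \<omega>. indicator {..r} q *\<^sub>R outer\<Delta> (q, \<omega>))"
    using O
  proof (rule Bochner_Integration.integrable_bound)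
    show "(\<lambda>z. indicator {..r} (fst z) *\<^sub>R outer\<Delta> (fst z, snd z)) \<in> borel_measurable \<mu>M"
      using O by (intro borel_measurable_scaleR indicator_fst_measurable) auto
  qed (auto simp: indicator_def)
  have "mean_inner (\<lambda>\<omega>. G *v Mt r \<omega>) (Mt T) = (\<integral>z. G \<bullet> (indicator {..r} (fst z) *\<^sub>R outer\<Delta> (fst z, snd z)) \<partial>\<mu>M)"
    unfolding Mt_isometry[OF bounded_bilinear_matrix_form r] by (simp add: inner_outer\<Delta>)
  also have "\<dots> = G \<bullet> (\<integral>z. indicator {..r} (fst z) *\<^sub>R outer\<Delta> (fst z, snd z) \<partial>\<mu>M)"
    using O' by (rule integral_inner_right)
  also have "(\<integral>z. indicator {..r} (fst z) *\<^sub>R outer\<Delta> (fst z, snd z) \<partial>\<mu>M)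
     = (\<integral>q. (\<integral>\<omega>. indicator {..r} q *\<^sub>R outer\<Delta> (q, \<omega>) \<partial>M) \<partial>\<mu>)"
    by (rule proc_int_facts(6)[OF O', symmetric])
  also have "\<dots> = tint 0 r (\<lambda>q. \<integral>\<omega>. outer\<Delta> (q, \<omega>) \<partial>M)"
    unfolding tint_def by (intro Bochner_Integration.integral_cong refl) (auto simp: indicator_def)
  finally show ?thesis .
qed

lemma P_outer\<Delta>_integrable: "proc_int (\<lambda>q \<omega>. P q \<bullet> outer\<Delta> (q, \<omega>))"
proof -
  have "integrable \<mu>M (\<lambda>z. (P (fst z) *v \<Delta> i z) \<bullet> \<Delta> i z)" for i
  proof -
    have "proc_sq (\<lambda>t \<omega>. \<Delta> i (t, \<omega>))" using \<Delta>_sq[of i] by simp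
    from proc_sq_inner[OF proc_sq_mult[OF P_coeff this] this] show ?thesis by simp
  qed
  then show ?thesis by (simp add: inner_outer\<Delta>)
qed

text \<open>The isometry evaluates each term of \<open>integral_noise2_inner\<close> at
  \<open>s = 0\<close>. Fubini then turns the weight at time \<open>q\<close> into
  \<open>\<Gamma>\<close> plus the integral of \<open>P_rate\<close> from \<open>q\<close> to
  \<open>T\<close>, that is \<open>P q\<close>.\<close>

lemma integral_noise2_0: "mean_inner (noise2 0) (Mt T) = (\<integral>z. P (fst z) \<bullet> outer\<Delta> z \<partial>\<mu>M)"
proof -
  let ?o = "\<lambda>q. \<integral>\<omega>. outer\<Delta> (q, \<omega>) \<partial>M"
  have O: "proc_int (\<lambda>q \<omega>. outer\<Delta> (q, \<omega>))" using outer\<Delta>_integrable by simp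
  have o: "integrable \<mu> ?o" by (rule proc_int_facts(5)[OF O])
  have hi: "integrable \<mu> P_rate" by (rule bounded_coeff_integrable[OF P_rate_coeff])
  have "mean_inner (noise2 0) (Mt T) = \<Gamma> \<bullet> tint 0 T ?o - P 0 \<bullet> tint 0 0 ?o + tint 0 T (\<lambda>r. P_rate r \<bullet> tint 0 r ?o)"
  proof -
    have "tint 0 T (\<lambda>r. \<integral>\<omega>. (P_rate r *v Mt r \<omega>) \<bullet> Mt T \<omega> \<partial>M) = tint 0 T (\<lambda>r. P_rate r \<bullet> tint 0 r ?o)"
      by (rule tint_cong) (rule Mt_isometry_matrix)
    then show ?thesis
      unfolding integral_noise2_inner[OF zero_in Mt_sq_int[OF T_in]]
        Mt_isometry_matrix[OF T_in] Mt_isometry_matrix[OF zero_in] by simp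
  qed
  also have "\<dots> = \<Gamma> \<bullet> tint 0 T ?o + tint 0 T (\<lambda>q. tint q T P_rate \<bullet> ?o q)"
    by (simp add: tint_0_0 fubini_triangle[OF bounded_bilinear_inner hi o])
  also have "\<dots> = tint 0 T (\<lambda>q. P q \<bullet> ?o q)"
  proof -
    have e: "tint 0 T (\<lambda>q. \<Gamma> \<bullet> ?o q) = \<Gamma> \<bullet> tint 0 T ?o"
      by (rule tint_linear[OF bounded_linear_inner_right o])
    have "AE q in \<mu>. integrable M (\<lambda>\<omega>. outer\<Delta> (q, \<omega>))" by (rule proc_int_facts(2)[OF O])
    then have "AE q in \<mu>. (\<integral>\<omega>. P q \<bullet> outer\<Delta> (q, \<omega>) \<partial>M) = P q \<bullet> ?o q"
      by eventually_elim (rule integral_inner_right)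
    \<comment> \<open>Integrability is inherited from the expectation of
      \<open>P q \<bullet> outer\<Delta> (q, \<omega>)\<close>, which agrees with this product at
      almost every time.\<close>
    then have Pq: "integrable \<mu> (\<lambda>q. P q \<bullet> ?o q)"
      using proc_int_facts(5)[OF P_outer\<Delta>_integrable]
      by (rule integrable_cong_AE_imp[rotated 2]) 
         (use P_coeff o in \<open>auto simp: bounded_coeff_def intro!: borel_measurable_inner\<close>)
    have "tint 0 T (\<lambda>q. tint q T P_rate \<bullet> ?o q) = tint 0 T (\<lambda>q. P q \<bullet> ?o q - \<Gamma> \<bullet> ?o q)"
      by (rule tint_cong) (simp add: P_eq inner_add_left)
    also have "\<dots> = tint 0 T (\<lambda>q. P q \<bullet> ?o q) - tint 0 T (\<lambda>q. \<Gamma> \<bullet> ?o q)"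
      by (rule tint_diff[OF Pq]) (use o in simp)
    finally show ?thesis by (simp add: e)
  qed
  also have "\<dots> = (\<integral>q. (\<integral>\<omega>. P q \<bullet> outer\<Delta> (q, \<omega>) \<partial>M) \<partial>\<mu>)"
    unfolding tint_0_T
  proof (rule integral_cong_AE)
    show "(\<lambda>q. P q \<bullet> ?o q) \<in> borel_measurable \<mu>"
      using P_coeff o by (intro borel_measurable_inner) (auto simp: bounded_coeff_def)
    show "(\<lambda>q. \<integral>\<omega>. P q \<bullet> outer\<Delta> (q, \<omega>) \<partial>M) \<in> borel_measurable \<mu>"
      using proc_int_facts(5)[OF P_outer\<Delta>_integrable] by auto
    show "AE q in \<mu>. P q \<bullet> ?o q = (\<integral>\<omega>. P q \<bullet> outer\<Delta> (q, \<omega>) \<partial>M)"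
      using proc_int_facts(2)[OF O] by eventually_elim (rule integral_inner_right[symmetric])
  qed
  also have "\<dots> = (\<integral>z. P (fst z) \<bullet> outer\<Delta> z \<partial>\<mu>M)"
    unfolding proc_int_facts(6)[OF P_outer\<Delta>_integrable] by simp
  finally show ?thesis .
qed

section \<open>The two duality identities\<close>

lemma AE_martingale_orth:
  assumes f: "proc_sq f" and ad: "\<And>r. r \<in> {0..T} \<Longrightarrow> f r \<in> borel_measurable (F r)"
  shows "AE r in \<mu>. (\<integral>\<omega>. f r \<omega> \<bullet> (Mt r \<omega> - Mt T \<omega>) \<partial>M) = 0"
  using proc_sq_AE_sq_int[OF f]
proof (rule AE_mp, intro AE_I2 impI)
  fix r assume "r \<in> space \<mu>" and sq: "sq_int M (f r)"
  then have r: "r \<in> {0..T}" by simp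
  show "(\<integral>\<omega>. f r \<omega> \<bullet> (Mt r \<omega> - Mt T \<omega>) \<partial>M) = 0"
    using Mt_martingale[OF r ad[OF r] sq]
      sq_int_inner_integrable[OF sq Mt_sq_int[OF r]] sq_int_inner_integrable[OF sq Mt_sq_int[OF T_in]]
    by (simp add: inner_diff_right)
qed

text \<open>\<open>duality\<close> is applied with \<open>P t *v D t \<omega>\<close> as the adjoint
  of \<open>D\<close> itself. In the drift integrand the two terms with \<open>b1\<close> cancel by
  transposition, and only \<open>A\<close> survives.\<close>

lemma dual_second:
  "mean_inner (\<lambda>\<omega>. \<Gamma> *v D T \<omega>) (D T) = (\<integral>z. P (fst z) \<bullet> outer\<Delta> z \<partial>\<mu>M)
    - (\<integral>z. (A (fst z) *v D (fst z) (snd z)) \<bullet> D (fst z) (snd z) \<partial>\<mu>M)"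
proof -
  let ?D = "\<lambda>z. D (fst z) (snd z)" and ?A = "\<lambda>z. A (fst z)" and ?P = "\<lambda>z. P (fst z)"
  have PD: "proc_sq (\<lambda>t \<omega>. P t *v D t \<omega>)" by (rule proc_sq_mult[OF P_coeff D_sq])
  have "mean_inner (\<lambda>\<omega>. \<Gamma> *v D T \<omega>) (D T) = mean_inner (noise2 0) (Mt T)
     + (\<integral>z. (?P z *v ?D z) \<bullet> \<beta> (fst z) (snd z) - drift2 (fst z) (snd z) \<bullet> ?D z \<partial>\<mu>M)"
  proof (rule duality[OF noise2_def Mt_def D_sq PD drift2_sq \<beta>_sq])
    show "sq_int M (\<lambda>\<omega>. \<Gamma> *v D T \<omega>)" "sq_int M (\<lambda>\<omega>. P 0 *v D 0 \<omega>)" "sq_int M (D T)"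
      by (rule sq_int_mult[OF D_sq_int[OF T_in]] sq_int_mult[OF D_sq_int[OF zero_in]] D_sq_int[OF T_in])+
    show "AE s in \<mu>. mean_inner (noise2 s) (\<beta> s) = 0"
    proof (intro AE_I2)
      fix s assume "s \<in> space \<mu>"
      then have s: "s \<in> {0..T}" by simp
      show "mean_inner (noise2 s) (\<beta> s) = 0"
        unfolding \<beta>_def by (rule noise2_orth[OF s F_measurable_mult[OF D_adapted[OF s]] sq_int_mult[OF D_sq_int[OF s]]])
    qed
    show "AE r in \<mu>. (\<integral>\<omega>. drift2 r \<omega> \<bullet> (Mt r \<omega> - Mt T \<omega>) \<partial>M) = 0"
      by (rule AE_martingale_orth[OF drift2_sq])
         (unfold drift2_def[abs_def], rule borel_measurable_add[OF F_measurable_mult[OF F_measurable_mult[OF D_adapted]]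
            F_measurable_mult[OF D_adapted]])
    show "mean_inner (\<lambda>\<omega>. P 0 *v D 0 \<omega>) (Mt T) = 0"
      by (rule Mt_orth0[OF F_measurable_mult[OF D_adapted[OF zero_in]] sq_int_mult[OF D_sq_int[OF zero_in]]])
  qed
  also have "(\<integral>z. (?P z *v ?D z) \<bullet> \<beta> (fst z) (snd z) - drift2 (fst z) (snd z) \<bullet> ?D z \<partial>\<mu>M)
    = (\<integral>z. - ((?A z *v ?D z) \<bullet> ?D z) \<partial>\<mu>M)"
  proof (intro Bochner_Integration.integral_cong refl)
    fix z :: "real \<times> 'w"
    have "(transpose (b1 (fst z)) *v (?P z *v ?D z)) \<bullet> ?D z
      = (?P z *v ?D z) \<bullet> (b1 (fst z) *v ?D z)"
      using matrix_vector_inner_transpose[of "transpose (b1 (fst z))"] unfolding transpose_transpose by blast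
    then show "(?P z *v ?D z) \<bullet> \<beta> (fst z) (snd z) - drift2 (fst z) (snd z) \<bullet> ?D z =
       - ((?A z *v ?D z) \<bullet> ?D z)"
      unfolding drift2_def \<beta>_def inner_add_left by linarith
  qed
  finally show ?thesis by (simp add: integral_noise2_0)
qed

text \<open>\<open>duality\<close> is applied with the given pair. The terms with \<open>b1\<close>
  again cancel; the noise at time 0 is the sum of the stochastic integrals of the columns of
  \<open>q\<close>, and its pairing with \<open>Mt T\<close> produces the terms linear in
  \<open>\<Delta>\<close>.\<close>

lemma dual_first:
  assumes pq: "first_adjoint M T W b1 A \<Gamma> X p q"
  shows "mean_inner (\<lambda>\<omega>. \<Gamma> *v X T \<omega>) (D T) = (\<integral>z. (\<Sum>i\<in>UNIV. column i (q (fst z) (snd z)) \<bullet> \<Delta> i z) \<partial>\<mu>M)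
    - (\<integral>z. (A (fst z) *v X (fst z) (snd z)) \<bullet> D (fst z) (snd z) \<partial>\<mu>M)"
proof -
  let ?Q = "\<lambda>i s \<omega>. column i (q s \<omega>)"
  let ?D = "\<lambda>z. D (fst z) (snd z)" and ?p = "\<lambda>z. p (fst z) (snd z)" and ?A = "\<lambda>z. A (fst z)"
    and ?v = "\<lambda>i z. diffusion v i (fst z) (snd z)" and ?u = "\<lambda>i z. diffusion u i (fst z) (snd z)"
    and ?q = "\<lambda>i z. ?Q i (fst z) (snd z)"
  define f where "f r \<omega> = transpose (b1 r) *v p r \<omega> + A r *v X r \<omega>" for r \<omega>
  define N where "N s \<omega> = \<Gamma> *v X T \<omega> + tint s T (\<lambda>r. f r \<omega>) - p s \<omega>" for s \<omega>
  have p_sq: "proc_sq p" and p_ad: "\<And>t. t \<in> {0..T} \<Longrightarrow> p t \<in> borel_measurable (F t)"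
    using pq by (auto simp: first_adjoint_def square_integrable_process_def adapted_process_def
        intro!: proc_sq_square_integrable_process)
  have f_sq: "proc_sq f" unfolding f_def
    by (rule sq_int_add[OF proc_sq_mult[OF bounded_coeff_linear[OF bounded_linear_transpose b1] p_sq]
          proc_sq_mult[OF A state_sq[OF X]]])
  have rep: "\<exists>I. (\<forall>i. ito i s T (?Q i) (I i)) \<and> (AE \<omega> in M. N s \<omega> = (\<Sum>i\<in>UNIV. I i \<omega>))" if s: "s \<in> {0..T}" for s
  proof -
    obtain I where I: "\<forall>i. ito i s T (?Q i) (I i)"
      "AE \<omega> in M. p s \<omega> = \<Gamma> *v X T \<omega> + (LINT r:{s..T}|lborel. transpose (b1 r) *v p r \<omega> + A r *v X r \<omega>) - (\<Sum>i\<in>UNIV. I i \<omega>)"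
      using pq s unfolding first_adjoint_def by blast
    have "AE \<omega> in M. N s \<omega> = (\<Sum>i\<in>UNIV. I i \<omega>)"
      using I(2) by eventually_elim (use s in \<open>simp add: N_def f_def set_lebesgue_integral_eq_tint\<close>)
    with I(1) show ?thesis by blast
  qed
  \<comment> \<open>The backward equation gives square integrability at each fixed time, in
    particular at 0.\<close>
  have p_sq_int: "sq_int M (p s)" if s: "s \<in> {0..T}" for s
  proof -
    obtain I where I: "\<And>i. ito i s T (?Q i) (I i)" "AE \<omega> in M. N s \<omega> = (\<Sum>i\<in>UNIV. I i \<omega>)" using rep[OF s] by blast
    have s': "0 \<le> s" "s \<le> T" using s by auto
    have "sq_int M (\<lambda>\<omega>. \<Gamma> *v X T \<omega> + tint s T (\<lambda>r. f r \<omega>) - (\<Sum>i\<in>UNIV. I i \<omega>))"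
      by (rule sq_int_diff[OF sq_int_add[OF sq_int_mult[OF state_sq_int[OF X T_in]] sq_int_tint[OF f_sq]]
            sq_int_sum[OF ito_sq_int[OF s' order_refl I(1)]]])
    then show ?thesis
    proof (rule sq_int_cong_AE)
      show "p s \<in> borel_measurable M" by (rule F_measurable_M[OF p_ad[OF s] s'(2)])
      show "AE \<omega> in M. \<Gamma> *v X T \<omega> + tint s T (\<lambda>r. f r \<omega>) - (\<Sum>i\<in>UNIV. I i \<omega>) = p s \<omega>"
        using I(2) by eventually_elim (simp add: N_def algebra_simps)
    qed
  qed
  have N_sq_int: "sq_int M (N s)" if s: "s \<in> {0..T}" for s
    unfolding N_def[abs_def]
    by (rule sq_int_diff[OF sq_int_add[OF sq_int_mult[OF state_sq_int[OF X T_in]] sq_int_tint[OF f_sq]] p_sq_int[OF s]])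
  have N_inner: "mean_inner (N s) \<eta> = (\<Sum>i\<in>UNIV. mean_inner (I i) \<eta>)"
    if s: "s \<in> {0..T}" and I: "\<And>i. ito i s T (?Q i) (I i)" "AE \<omega> in M. N s \<omega> = (\<Sum>i\<in>UNIV. I i \<omega>)"
      and \<eta>: "sq_int M \<eta>" for s I \<eta>
  proof -
    have s': "0 \<le> s" "s \<le> T" using s by auto
    have i: "integrable M (\<lambda>\<omega>. I i \<omega> \<bullet> \<eta> \<omega>)" for i
      by (rule sq_int_inner_integrable[OF ito_sq_int[OF s' order_refl I(1)] \<eta>])
    have "mean_inner (N s) \<eta> = (\<integral>\<omega>. (\<Sum>i\<in>UNIV. I i \<omega> \<bullet> \<eta> \<omega>) \<partial>M)"
    proof (rule integral_cong_AE)
      show "(\<lambda>\<omega>. N s \<omega> \<bullet> \<eta> \<omega>) \<in> borel_measurable M"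
        using sq_int_inner_integrable[OF N_sq_int[OF s] \<eta>] by auto
      show "(\<lambda>\<omega>. \<Sum>i\<in>UNIV. I i \<omega> \<bullet> \<eta> \<omega>) \<in> borel_measurable M"
        using i by (intro borel_measurable_sum) auto
      show "AE \<omega> in M. N s \<omega> \<bullet> \<eta> \<omega> = (\<Sum>i\<in>UNIV. I i \<omega> \<bullet> \<eta> \<omega>)"
        using I(2) by eventually_elim (simp add: inner_sum_left)
    qed
    then show ?thesis using i by simp
  qed
  have "mean_inner (\<lambda>\<omega>. \<Gamma> *v X T \<omega>) (D T) = mean_inner (N 0) (Mt T)
     + (\<integral>z. ?p z \<bullet> \<beta> (fst z) (snd z) - f (fst z) (snd z) \<bullet> ?D z \<partial>\<mu>M)"
  proof (rule duality[OF N_def Mt_def D_sq p_sq f_sq \<beta>_sq])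
    show "sq_int M (\<lambda>\<omega>. \<Gamma> *v X T \<omega>)" "sq_int M (p 0)" "sq_int M (D T)"
      by (rule sq_int_mult[OF state_sq_int[OF X T_in]] p_sq_int[OF zero_in] D_sq_int[OF T_in])+
    show "AE s in \<mu>. mean_inner (N s) (\<beta> s) = 0"
    proof (intro AE_I2)
      fix s assume "s \<in> space \<mu>"
      then have s: "s \<in> {0..T}" and s': "0 \<le> s" "s \<le> T" by auto
      obtain I where I: "\<And>i. ito i s T (?Q i) (I i)" "AE \<omega> in M. N s \<omega> = (\<Sum>i\<in>UNIV. I i \<omega>)" using rep[OF s] by blast
      have \<eta>: "\<beta> s \<in> borel_measurable (F s)" "sq_int M (\<beta> s)"
        unfolding \<beta>_def[abs_def] by (rule F_measurable_mult[OF D_adapted[OF s]] sq_int_mult[OF D_sq_int[OF s]])+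
      \<comment> \<open>\<open>\<beta> s\<close> is known at \<open>s\<close>, while all integrals
        that make up \<open>N s\<close> run over \<open>{s..T}\<close>.\<close>
      show "mean_inner (N s) (\<beta> s) = 0"
        unfolding N_inner[OF s I \<eta>(2)]
        using ito_orth[OF s' order_refl I(1) \<eta>] by (simp add: inner_commute)
    qed
    show "AE r in \<mu>. (\<integral>\<omega>. f r \<omega> \<bullet> (Mt r \<omega> - Mt T \<omega>) \<partial>M) = 0"
      by (rule AE_martingale_orth[OF f_sq])
         (unfold f_def[abs_def], rule borel_measurable_add[OF F_measurable_mult[OF p_ad]
            F_measurable_mult[OF state_adapted[OF X]]])
    show "mean_inner (p 0) (Mt T) = 0"
      by (rule Mt_orth0[OF p_ad[OF zero_in] p_sq_int[OF zero_in]])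
  qed
  also have "(\<integral>z. ?p z \<bullet> \<beta> (fst z) (snd z) - f (fst z) (snd z) \<bullet> ?D z \<partial>\<mu>M)
    = (\<integral>z. - ((?A z *v X (fst z) (snd z)) \<bullet> ?D z) \<partial>\<mu>M)"
  proof (intro Bochner_Integration.integral_cong refl)
    fix z :: "real \<times> 'w"
    have "(transpose (b1 (fst z)) *v ?p z) \<bullet> ?D z
      = ?p z \<bullet> (b1 (fst z) *v ?D z)"
      using matrix_vector_inner_transpose[of "transpose (b1 (fst z))"] unfolding transpose_transpose by blast
    then show "?p z \<bullet> \<beta> (fst z) (snd z) - f (fst z) (snd z) \<bullet> ?D z =
       - ((?A z *v X (fst z) (snd z)) \<bullet> ?D z)"
      unfolding f_def \<beta>_def inner_add_left by linarith
  qed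
  also have "mean_inner (N 0) (Mt T) = (\<integral>z. (\<Sum>i\<in>UNIV. ?q i z \<bullet> \<Delta> i z) \<partial>\<mu>M)"
  proof -
    have T0: "0 \<le> T" using T_pos by simp
    obtain I where I: "\<And>i. ito i 0 T (?Q i) (I i)" "AE \<omega> in M. N 0 \<omega> = (\<Sum>i\<in>UNIV. I i \<omega>)" using rep[OF zero_in] by blast
    obtain V U where R: "Mt_rep T V U" using Mt_rep_exists[OF T_in] by blast
    note VU = Mt_repD[OF this]
    note T3 = order_refl[of "0::real"] T0 order_refl[of T]
    have sqI: "sq_int M (I i)" for i by (rule ito_sq_int[OF T3 I(1)])
    have Qsq: "proc_sq (?Q i)" for i
    proof -
      have "square_integrable_process M (augmented_filtration M W) 0 T (?Q i)"
        using I(1)[of i] by (simp add: has_ito_integral_def)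
      then show ?thesis by (rule proc_sq_square_integrable_process)
    qed
    \<comment> \<open>Only integrals against the same Brownian component interact, so column
      \<open>i\<close> of \<open>q\<close> meets column \<open>i\<close> of the diffusions.\<close>
    have iso: "mean_inner (I i) (V j) = (if i = j then (\<integral>z. ?q i z \<bullet> ?v j z \<partial>\<mu>M) else 0)"
      "mean_inner (I i) (U j) = (if i = j then (\<integral>z. ?q i z \<bullet> ?u j z \<partial>\<mu>M) else 0)" for i j
      unfolding ito_isometry[OF bounded_bilinear_inner T3 I(1) T3 VU(1)] ito_isometry[OF bounded_bilinear_inner T3 I(1) T3 VU(2)]
      by (auto intro!: Bochner_Integration.integral_cong simp: zero_ext_def space_pair_measure)
    have e: "mean_inner (I i) (Mt T) = (\<integral>z. ?q i z \<bullet> \<Delta> i z \<partial>\<mu>M)" for i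
    proof -
      have "mean_inner (I i) (Mt T) = (\<Sum>j\<in>UNIV. mean_inner (I i) (V j) - mean_inner (I i) (U j))"
        by (rule integral_inner_Mt[OF sqI T_in R])
      also have "\<dots> = (\<integral>z. ?q i z \<bullet> ?v i z \<partial>\<mu>M)
          - (\<integral>z. ?q i z \<bullet> ?u i z \<partial>\<mu>M)"
        unfolding iso sum_subtractf by simp
      also have "\<dots> = (\<integral>z. ?q i z \<bullet> \<Delta> i z \<partial>\<mu>M)"
        using proc_sq_inner[OF Qsq state_diffusion_sq[OF Y]] proc_sq_inner[OF Qsq state_diffusion_sq[OF X]]
        by (simp add: \<Delta>_def inner_diff_right)
      finally show ?thesis .
    qed
    have "mean_inner (N 0) (Mt T) = (\<Sum>i\<in>UNIV. (\<integral>z. ?q i z \<bullet> \<Delta> i z \<partial>\<mu>M))"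
      unfolding N_inner[OF zero_in I Mt_sq_int[OF T_in]] e ..
    also have "\<dots> = (\<integral>z. (\<Sum>i\<in>UNIV. ?q i z \<bullet> \<Delta> i z) \<partial>\<mu>M)"
      by (intro Bochner_Integration.integral_sum[symmetric] sq_int_inner_integrable[OF Qsq \<Delta>_sq])
    finally show ?thesis .
  qed
  finally show ?thesis by simp
qed

end

section \<open>The cost gap and the minimizing update\<close>

lemma symmetric_quadratic_expansion:
  fixes G :: "real^'n^'n"
  assumes "transpose G = G"
  shows "(x + d) \<bullet> (G *v (x + d)) - x \<bullet> (G *v x) = 2 * ((G *v x) \<bullet> d) + (G *v d) \<bullet> d"
proof -
  have "x \<bullet> (G *v d) = (G *v x) \<bullet> d"
    using matrix_vector_inner_transpose[of G x d] assms by simp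
  moreover have "d \<bullet> (G *v x) = (G *v x) \<bullet> d" "d \<bullet> (G *v d) = (G *v d) \<bullet> d" by (simp_all only: inner_commute)
  ultimately show ?thesis
    by (simp add: matrix_vector_right_distrib inner_add_left inner_add_right)
qed

text \<open>The uniform eighth moment controls the second one through
  \<open>x\<^sup>2 \<le> 1 + x ^ 8\<close>, and the finite length of the time interval does the
  rest.\<close>

lemma (in brownian) admissible_proc_sq:
  fixes u :: "real \<Rightarrow> 'w \<Rightarrow> real^'k"
  assumes u: "u \<in> admissible_controls M T W U"
  shows "proc_sq u"
proof (rule sq_int_nn_integral)
  show m: "(\<lambda>z. u (fst z) (snd z)) \<in> borel_measurable \<mu>M"
    using u by (simp add: admissible_controls_def adapted_process_def measurable_\<mu>M_eq case_prod_beta')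
  define S where "S = (SUP t\<in>{0..T}. \<integral>\<^sup>+ \<omega>. ennreal ((norm (u t \<omega>)) ^ 8) \<partial>M)"
  have S: "S < \<infinity>" using u by (simp add: admissible_controls_def S_def)
  have le: "(x::real)\<^sup>2 \<le> 1 + x ^ 8" for x
  proof (cases "\<bar>x\<bar> \<le> 1")
    case True
    then have "x\<^sup>2 \<le> 1" by (simp add: abs_square_le_1)
    moreover have "0 \<le> x ^ 8" by simp
    ultimately show ?thesis by linarith
  next
    case False
    then have "\<bar>x\<bar> ^ 2 \<le> \<bar>x\<bar> ^ 8" by (intro power_increasing) auto
    then show ?thesis by simp
  qed
  have "(\<integral>\<^sup>+ z. ennreal ((norm (u (fst z) (snd z)))\<^sup>2) \<partial>\<mu>M) = (\<integral>\<^sup>+ t. (\<integral>\<^sup>+ \<omega>. ennreal ((norm (u t \<omega>))\<^sup>2) \<partial>M) \<partial>\<mu>)"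
    using nn_integral_fst[of "\<lambda>z. ennreal ((norm (u (fst z) (snd z)))\<^sup>2)" \<mu>] m by simp
  also have "\<dots> \<le> (\<integral>\<^sup>+ t. 1 + S \<partial>\<mu>)"
  proof (rule nn_integral_mono)
    fix t assume t: "t \<in> space \<mu>"
    have [measurable]: "u t \<in> borel_measurable M"
      using measurable_compose[OF measurable_Pair1' m, of t] t by simp
    have "(\<integral>\<^sup>+ \<omega>. ennreal ((norm (u t \<omega>))\<^sup>2) \<partial>M) \<le> (\<integral>\<^sup>+ \<omega>. 1 + ennreal ((norm (u t \<omega>)) ^ 8) \<partial>M)"
      using le by (intro nn_integral_mono) (auto simp flip: ennreal_1 ennreal_plus intro!: ennreal_leI)
    also have "\<dots> = 1 + (\<integral>\<^sup>+ \<omega>. ennreal ((norm (u t \<omega>)) ^ 8) \<partial>M)"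
      by (subst nn_integral_add) (auto simp: emeasure_space_1)
    also have "\<dots> \<le> 1 + S"
      unfolding S_def using t by (intro add_left_mono SUP_upper) auto
    finally show "(\<integral>\<^sup>+ \<omega>. ennreal ((norm (u t \<omega>))\<^sup>2) \<partial>M) \<le> 1 + S" .
  qed
  also have "\<dots> < \<infinity>" using S T_pos by (simp add: emeasure_\<mu> ennreal_mult_less_top)
  finally show "(\<integral>\<^sup>+ z. ennreal ((norm (u (fst z) (snd z)))\<^sup>2) \<partial>\<mu>M) < \<infinity>" .
qed

text \<open>Separates the terminal, state and control costs, with the time integrals on the product
  space, so that costs of two controls can be subtracted term by term.\<close>

lemma (in lq_coefficients) cost_of_pair_eq:
  assumes Z: "state w Z" and w: "proc_sq w"
  shows "proc_int (\<lambda>t \<omega>. Z t \<omega> \<bullet> (A t *v Z t \<omega>))" (is ?i1)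
    "proc_int (\<lambda>t \<omega>. w t \<omega> \<bullet> (B t *v w t \<omega>))" (is ?i2)
    "integrable M (\<lambda>\<omega>. Z T \<omega> \<bullet> (\<Gamma> *v Z T \<omega>))" (is ?i3)
    "cost_of_pair M T A B \<Gamma> Z w = (1/2) * ((\<integral>\<omega>. Z T \<omega> \<bullet> (\<Gamma> *v Z T \<omega>) \<partial>M)
      + (\<integral>z. Z (fst z) (snd z) \<bullet> (A (fst z) *v Z (fst z) (snd z)) \<partial>\<mu>M)
      + (\<integral>z. w (fst z) (snd z) \<bullet> (B (fst z) *v w (fst z) (snd z)) \<partial>\<mu>M))" (is ?cost)
proof -
  have T: "T \<in> {0..T}" using T_pos by simp
  show i1: ?i1
    by (rule proc_sq_inner[OF state_sq[OF Z] proc_sq_mult[OF A state_sq[OF Z]]])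
  show i2: ?i2
    by (rule proc_sq_inner[OF w proc_sq_mult[OF B w]])
  show i3: ?i3
    by (rule sq_int_inner_integrable[OF state_sq_int[OF Z T] sq_int_mult[OF state_sq_int[OF Z T]]])
  have i: "proc_int (\<lambda>t \<omega>. Z t \<omega> \<bullet> (A t *v Z t \<omega>) + w t \<omega> \<bullet> (B t *v w t \<omega>))" using i1 i2 by simp
  have "cost_of_pair M T A B \<Gamma> Z w = (1/2) * (\<integral>\<omega>. Z T \<omega> \<bullet> (\<Gamma> *v Z T \<omega>) +
    (\<integral>t. Z t \<omega> \<bullet> (A t *v Z t \<omega>) + w t \<omega> \<bullet> (B t *v w t \<omega>) \<partial>\<mu>) \<partial>M)"
    unfolding cost_of_pair_def by (simp add: set_lebesgue_integral_eq_tint tint_0_T)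
  also have "\<dots> = (1/2) * ((\<integral>\<omega>. Z T \<omega> \<bullet> (\<Gamma> *v Z T \<omega>) \<partial>M) +
    (\<integral>z. Z (fst z) (snd z) \<bullet> (A (fst z) *v Z (fst z) (snd z)) + w (fst z) (snd z) \<bullet> (B (fst z) *v w (fst z) (snd z)) \<partial>\<mu>M))"
    using i3 proc_int_facts(3)[OF i] by (simp add: proc_int_facts(4)[OF i])
  finally show ?cost
    using i1 i2 by simp
qed

text \<open>What survives in the Hamiltonian difference between \<open>v\<close> and
  \<open>u\<close>: the terms in \<open>p\<close> and \<open>x\<close> do not contain the control,
  and the correction with \<open>P\<close> vanishes at \<open>u\<close>. The matrix stands on the
  left factor to agree with \<open>inner_outer\<Delta>\<close>.\<close>

definition hamiltonian_gap ::
  "(real \<Rightarrow> real^'k \<Rightarrow> real^'d^'n) \<Rightarrow> (real \<Rightarrow> real^'k^'k) \<Rightarrow> real \<Rightarrow> real^'d^'n \<Rightarrow> real^'n^'n \<Rightarrow> real^'k \<Rightarrow> real^'k \<Rightarrow> real" where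
  "hamiltonian_gap \<sigma> B t q P v u =
     (\<Sum>i\<in>UNIV. column i q \<bullet> (column i (\<sigma> t v) - column i (\<sigma> t u)))
     + (1/2) * (v \<bullet> (B t *v v) - u \<bullet> (B t *v u))
     + (1/2) * (\<Sum>i\<in>UNIV. (P *v (column i (\<sigma> t v) - column i (\<sigma> t u))) \<bullet> (column i (\<sigma> t v) - column i (\<sigma> t u)))"

lemma hamiltonian_gap_eq:
  "hamiltonian b1 b2 \<sigma> A B t x p q P v u - hamiltonian b1 b2 \<sigma> A B t x p q P u u = hamiltonian_gap \<sigma> B t q P v u"
proof -
  have "(column i (\<sigma> t v) - column i (\<sigma> t u)) \<bullet> (P *v (column i (\<sigma> t v) - column i (\<sigma> t u)))
     = (P *v (column i (\<sigma> t v) - column i (\<sigma> t u))) \<bullet> (column i (\<sigma> t v) - column i (\<sigma> t u))" for i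
    by (rule inner_commute)
  then show ?thesis
    unfolding hamiltonian_def hamiltonian_gap_def
    by (simp add: inner_diff_right[of "column _ q"] sum_subtractf right_diff_distrib distrib_left)
qed

text \<open>Expanding the terminal and running state costs around \<open>X\<close> gives terms in
  \<open>\<Gamma>\<close> and in \<open>A\<close>. In \<open>dual_first\<close> and
  \<open>dual_second\<close> these occur with opposite signs, so their sums in the cost are exactly
  the integrals of \<open>?L\<close> and \<open>?S\<close>. The factor 1/2 of the cost cancels the 2
  of the linear terms and becomes the 1/2 in front of \<open>P\<close>.\<close>

lemma (in lq_pair) cost_gap:
  assumes uv: "proc_sq u" "proc_sq v" and pq: "first_adjoint M T W b1 A \<Gamma> X p q"
  shows "proc_int (\<lambda>t \<omega>. hamiltonian_gap \<sigma> B t (q t \<omega>) (P t) (v t \<omega>) (u t \<omega>))"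
    "cost_of_pair M T A B \<Gamma> Y v - cost_of_pair M T A B \<Gamma> X u =
      (\<integral>z. hamiltonian_gap \<sigma> B (fst z) (q (fst z) (snd z)) (P (fst z)) (v (fst z) (snd z)) (u (fst z) (snd z)) \<partial>\<mu>M)"
proof -
  let ?D = "\<lambda>z. D (fst z) (snd z)" and ?X = "\<lambda>z. X (fst z) (snd z)" and ?Y = "\<lambda>z. Y (fst z) (snd z)"
    and ?u = "\<lambda>z. u (fst z) (snd z)" and ?v = "\<lambda>z. v (fst z) (snd z)" and ?B = "\<lambda>z. B (fst z)"
    and ?g = "\<lambda>z. hamiltonian_gap \<sigma> B (fst z) (q (fst z) (snd z)) (P (fst z)) (v (fst z) (snd z)) (u (fst z) (snd z))"
    and ?S = "\<lambda>z. P (fst z) \<bullet> outer\<Delta> z"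
    and ?L = "\<lambda>z. \<Sum>i\<in>UNIV. column i (q (fst z) (snd z)) \<bullet> \<Delta> i z"
    and ?A = "\<lambda>z. A (fst z)"
  have qs: "proc_sq q"
    using pq by (auto simp: first_adjoint_def intro!: proc_sq_square_integrable_process)
  have i1: "integrable \<mu>M ?L"
    by (intro Bochner_Integration.integrable_sum sq_int_inner_integrable[OF sq_int_linear[OF bounded_linear_column qs] \<Delta>_sq])
  have i2: "integrable \<mu>M ?S"
    using P_outer\<Delta>_integrable by simp
  note cX = cost_of_pair_eq[OF X uv(1)] and cY = cost_of_pair_eq[OF Y uv(2)]
  have gap: "?g z =
     ?L z + (1/2) * (?v z \<bullet> (?B z *v ?v z) - ?u z \<bullet> (?B z *v ?u z))
     + (1/2) * ?S z" for z
    by (simp add: hamiltonian_gap_def inner_outer\<Delta> \<Delta>_def)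
  show "proc_int (\<lambda>t \<omega>. hamiltonian_gap \<sigma> B t (q t \<omega>) (P t) (v t \<omega>) (u t \<omega>))"
    unfolding gap using i1 i2 cX(2) cY(2) by simp
  have "(\<integral>\<omega>. Y T \<omega> \<bullet> (\<Gamma> *v Y T \<omega>) \<partial>M) - (\<integral>\<omega>. X T \<omega> \<bullet> (\<Gamma> *v X T \<omega>) \<partial>M) =
    (\<integral>\<omega>. Y T \<omega> \<bullet> (\<Gamma> *v Y T \<omega>) - X T \<omega> \<bullet> (\<Gamma> *v X T \<omega>) \<partial>M)"
    using cX(3) cY(3) by simp
  also have "\<dots> = (\<integral>\<omega>. 2 * ((\<Gamma> *v X T \<omega>) \<bullet> D T \<omega>) + (\<Gamma> *v D T \<omega>) \<bullet> D T \<omega> \<partial>M)"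
  proof (intro Bochner_Integration.integral_cong refl)
    fix \<omega>
    from symmetric_quadratic_expansion[OF \<Gamma>_sym, of "X T \<omega>" "D T \<omega>"]
    show "Y T \<omega> \<bullet> (\<Gamma> *v Y T \<omega>) - X T \<omega> \<bullet> (\<Gamma> *v X T \<omega>) = 2 * ((\<Gamma> *v X T \<omega>) \<bullet> D T \<omega>) + (\<Gamma> *v D T \<omega>) \<bullet> D T \<omega>"
      by (simp add: D_def)
  qed
  also have "\<dots> = 2 * mean_inner (\<lambda>\<omega>. \<Gamma> *v X T \<omega>) (D T) + mean_inner (\<lambda>\<omega>. \<Gamma> *v D T \<omega>) (D T)"
    using sq_int_inner_integrable[OF sq_int_mult[OF state_sq_int[OF X T_in], of \<Gamma>] D_sq_int[OF T_in]]
      sq_int_inner_integrable[OF sq_int_mult[OF D_sq_int[OF T_in], of \<Gamma>] D_sq_int[OF T_in]] by simp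
  finally have e1: "(\<integral>\<omega>. Y T \<omega> \<bullet> (\<Gamma> *v Y T \<omega>) \<partial>M) - (\<integral>\<omega>. X T \<omega> \<bullet> (\<Gamma> *v X T \<omega>) \<partial>M) =
    2 * mean_inner (\<lambda>\<omega>. \<Gamma> *v X T \<omega>) (D T) + mean_inner (\<lambda>\<omega>. \<Gamma> *v D T \<omega>) (D T)" .
  have "(\<integral>z. ?Y z \<bullet> (?A z *v ?Y z) \<partial>\<mu>M) - (\<integral>z. ?X z \<bullet> (?A z *v ?X z) \<partial>\<mu>M) =
    (\<integral>z. ?Y z \<bullet> (?A z *v ?Y z) - ?X z \<bullet> (?A z *v ?X z) \<partial>\<mu>M)"
    using cX(1) cY(1) by simp
  also have "\<dots> = (\<integral>z. 2 * ((?A z *v ?X z) \<bullet> ?D z) + (?A z *v ?D z) \<bullet> ?D z \<partial>\<mu>M)"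
  proof (intro Bochner_Integration.integral_cong refl)
    fix z assume "z \<in> space \<mu>M"
    then have "fst z \<in> {0..T}" by (auto simp: space_pair_measure)
    from symmetric_quadratic_expansion[OF A_sym[OF this], of "?X z" "?D z"]
    show "?Y z \<bullet> (?A z *v ?Y z) - ?X z \<bullet> (?A z *v ?X z) =
      2 * ((?A z *v ?X z) \<bullet> ?D z) + (?A z *v ?D z) \<bullet> ?D z" by (simp add: D_def)
  qed
  also have "\<dots> = 2 * (\<integral>z. (?A z *v ?X z) \<bullet> ?D z \<partial>\<mu>M) + (\<integral>z. (?A z *v ?D z) \<bullet> ?D z \<partial>\<mu>M)"
    using proc_sq_inner[OF proc_sq_mult[OF A state_sq[OF X]] D_sq] proc_sq_inner[OF proc_sq_mult[OF A D_sq] D_sq] by simp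
  finally have e2: "(\<integral>z. ?Y z \<bullet> (?A z *v ?Y z) \<partial>\<mu>M) - (\<integral>z. ?X z \<bullet> (?A z *v ?X z) \<partial>\<mu>M) =
    2 * (\<integral>z. (?A z *v ?X z) \<bullet> ?D z \<partial>\<mu>M) + (\<integral>z. (?A z *v ?D z) \<bullet> ?D z \<partial>\<mu>M)" .
  have e3: "(\<integral>z. ?g z \<partial>\<mu>M) =
     (\<integral>z. ?L z \<partial>\<mu>M)
     + (1/2) * ((\<integral>z. ?v z \<bullet> (?B z *v ?v z) \<partial>\<mu>M) - (\<integral>z. ?u z \<bullet> (?B z *v ?u z) \<partial>\<mu>M))
     + (1/2) * (\<integral>z. ?S z \<partial>\<mu>M)"
    unfolding gap using i1 i2 cX(2) cY(2) by simp
  show "cost_of_pair M T A B \<Gamma> Y v - cost_of_pair M T A B \<Gamma> X u =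
      (\<integral>z. ?g z \<partial>\<mu>M)"
    unfolding e3 cX(4) cY(4) using e1 e2 dual_second dual_first[OF pq] by argo
qed

text \<open>The value at \<open>u\<close> subtracted in both gaps is the same, so minimality at
  \<open>v\<close> orders the gaps pointwise. \<open>Y\<close> and \<open>Z\<close> are arbitrary
  states of their controls, which allows them to be the ones that \<open>cost_functional\<close>
  selects.\<close>

lemma (in lq_coefficients) cost_minimizing_update:
  assumes X: "state u X" and Y: "state v Y" and Z: "state w Z"
    and sq: "proc_sq u" "proc_sq v" "proc_sq w"
    and pq: "first_adjoint M T W b1 A \<Gamma> X p q"
    and w: "\<And>t \<omega>. t \<in> {0..T} \<Longrightarrow> \<omega> \<in> space M \<Longrightarrow> w t \<omega> \<in> U"
    and min: "AE t in lborel. t \<in> {0..T} \<longrightarrow> (AE \<omega> in M.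
           is_arg_min (\<lambda>a. hamiltonian b1 b2 \<sigma> A B t (X t \<omega>) (p t \<omega>) (q t \<omega>) (P t) a (u t \<omega>))
             (\<lambda>a. a \<in> U) (v t \<omega>))"
  shows "cost_of_pair M T A B \<Gamma> Y v \<le> cost_of_pair M T A B \<Gamma> Z w"
proof -
  interpret Y: lq_pair M T W x0 b1 A b2 \<sigma> \<Gamma> P B u v X Y using X Y by unfold_locales
  interpret Z: lq_pair M T W x0 b1 A b2 \<sigma> \<Gamma> P B u w X Z using X Z by unfold_locales
  note gY = Y.cost_gap[OF sq(1,2) pq] and gZ = Z.cost_gap[OF sq(1,3) pq]
  let ?g = "\<lambda>a z. hamiltonian_gap \<sigma> B (fst z) (q (fst z) (snd z)) (P (fst z)) (a (fst z) (snd z)) (u (fst z) (snd z))"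
  let ?H = "\<lambda>t \<omega> a. hamiltonian b1 b2 \<sigma> A B t (X t \<omega>) (p t \<omega>) (q t \<omega>) (P t) a (u t \<omega>)"
  have "AE t in \<mu>. AE \<omega> in M. ?g v (t, \<omega>) \<le> ?g w (t, \<omega>)"
  proof -
    have "AE t in \<mu>. AE \<omega> in M. is_arg_min (?H t \<omega>)
             (\<lambda>a. a \<in> U) (v t \<omega>)"
      using min by (subst AE_restrict_space_iff) auto
    then show ?thesis using AE_space
    proof eventually_elim
      case (elim t)
      from elim(1) AE_space show ?case
      proof eventually_elim
        case (elim \<omega>)
        then have "?H t \<omega> (v t \<omega>)
           \<le> ?H t \<omega> (w t \<omega>)"
          using w[of t \<omega>] \<open>t \<in> space \<mu>\<close> by (force simp: is_arg_min_def not_less)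
        then show ?case
          unfolding hamiltonian_gap_eq[of b1 b2 \<sigma> A B t "X t \<omega>" "p t \<omega>", symmetric] fst_conv snd_conv by simp
      qed
    qed
  qed
  note ae = this
  \<comment> \<open>Minimality is given for almost every \<open>t\<close> and then almost every
    \<open>\<omega>\<close>. Measurability of the comparison set, available from integrability of
    the gaps, turns this into a statement for the product measure.\<close>
  have "{z \<in> space \<mu>M. ?g v z \<le> ?g w z} \<in> sets \<mu>M"
    using gY(1) gZ(1) by (intro borel_measurable_le) auto
  from TM.AE_pair_measure[OF this ae] have "AE z in \<mu>M. ?g v z \<le> ?g w z" .
  with gY(1) gZ(1) have "(\<integral>z. ?g v z \<partial>\<mu>M) \<le> (\<integral>z. ?g w z \<partial>\<mu>M)" by (rule integral_mono_AE)
  with gY(2) gZ(2) show ?thesis by linarith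
qed

theorem theorem3p8:
  fixes M :: "'w measure" and T L1 :: real
    and W :: "real \<Rightarrow> 'w \<Rightarrow> real^'d"
    and U :: "(real^'k) set"
    and x0 :: "real^'n" and \<Gamma> :: "real^'n^'n"
    and b1 A P :: "real \<Rightarrow> real^'n^'n" and b2 :: "real \<Rightarrow> real^'n"
    and B :: "real \<Rightarrow> real^'k^'k"
    and \<sigma> :: "real \<Rightarrow> real^'k \<Rightarrow> real^'d^'n"
    and ubar :: "real \<Rightarrow> 'w \<Rightarrow> real^'k" and Xbar :: "real \<Rightarrow> 'w \<Rightarrow> real^'n"
    and u :: "nat \<Rightarrow> real \<Rightarrow> 'w \<Rightarrow> real^'k"
    and X p :: "nat \<Rightarrow> real \<Rightarrow> 'w \<Rightarrow> real^'n"
    and q :: "nat \<Rightarrow> real \<Rightarrow> 'w \<Rightarrow> real^'d^'n"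
  defines "J \<equiv> cost_functional M T W x0 b1 b2 \<sigma> A B \<Gamma>"
  assumes "T > 0"
    and "prob_space M" and "complete_measure M"
    and "standard_brownian_motion M T W"
    and "U \<noteq> {}"
    and "transpose \<Gamma> = \<Gamma>"
    and "\<And>t. t \<in> {0..T} \<Longrightarrow> transpose (A t) = A t"
    and "\<And>t. t \<in> {0..T} \<Longrightarrow> transpose (B t) = B t"
    and "b1 \<in> borel_measurable (restrict_space borel {0..T})" and "bounded (b1 ` {0..T})"
    and "b2 \<in> borel_measurable (restrict_space borel {0..T})" and "bounded (b2 ` {0..T})"
    and "A \<in> borel_measurable (restrict_space borel {0..T})" and "bounded (A ` {0..T})"
    and "B \<in> borel_measurable (restrict_space borel {0..T})" and "bounded (B ` {0..T})"
    and "(\<lambda>(t, v). \<sigma> t v) \<in> borel_measurable (restrict_space borel ({0..T} \<times> U))"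
    and "\<And>t. t \<in> {0..T} \<Longrightarrow> continuous_on U (\<sigma> t)"
    and "L1 > 0" and "\<And>t v. t \<in> {0..T} \<Longrightarrow> v \<in> U \<Longrightarrow> norm (\<sigma> t v) \<le> L1 * (1 + norm v)"
    and "ubar \<in> admissible_controls M T W U"
    and "state_process M T W x0 b1 b2 \<sigma> ubar Xbar"
    and "\<And>v. v \<in> admissible_controls M T W U \<Longrightarrow> J ubar \<le> J v"
    and "second_adjoint T b1 A \<Gamma> P"
    and "\<And>m. u m \<in> admissible_controls M T W U"
    and "\<And>m. m \<ge> 1 \<Longrightarrow> state_process M T W x0 b1 b2 \<sigma> (u (m - 1)) (X m)"
    and "\<And>m. m \<ge> 1 \<Longrightarrow> first_adjoint M T W b1 A \<Gamma> (X m) (p m) (q m)"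
    \<comment> \<open>\<open>q\<close> is only determined almost everywhere, and so is the update\<close>
    and "\<And>m. m \<ge> 1 \<Longrightarrow> AE t in lborel. t \<in> {0..T} \<longrightarrow> (AE \<omega> in M.
           is_arg_min
             (\<lambda>v. hamiltonian b1 b2 \<sigma> A B t (X m t \<omega>) (p m t \<omega>) (q m t \<omega>) (P t)
                    v (u (m - 1) t \<omega>))
             (\<lambda>v. v \<in> U) (u m t \<omega>))"
  shows "\<exists>m0\<ge>1. \<forall>m\<ge>m0.
           0 \<le> J (u (m - 1)) - J ubar \<and>
           J (u (m - 1)) - J ubar \<le> max (J (u (m0 - 1)) - J ubar) 1 / real m"
proof -
  interpret prob_space M by fact
  interpret brownian M T W by unfold_locales fact+
  interpret lq_coefficients M T W x0 b1 A b2 \<sigma> \<Gamma> P B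
    by unfold_locales (fact | rule bounded_coeffI)+
  \<comment> \<open>\<open>cost_functional\<close> takes the cost at a selected state; the existence
    of any state shows that the selection is one.\<close>
  have some: "state w (SOME X. state w X)" if "state w X'" for w X' by (rule someI[of "state w", OF that])
  have J: "J w = cost_of_pair M T A B \<Gamma> (SOME X. state w X) w" for w
    by (simp add: J_def cost_functional_def)
  have ubar_U: "\<And>t \<omega>. t \<in> {0..T} \<Longrightarrow> \<omega> \<in> space M \<Longrightarrow> ubar t \<omega> \<in> U"
    using \<open>ubar \<in> admissible_controls M T W U\<close> by (auto simp: admissible_controls_def)
  have opt: "J (u m) = J ubar" if "m \<ge> 1" for m
  proof (rule antisym)
    have "state (u m) (X (m + 1))"
      using \<open>\<And>m. m \<ge> 1 \<Longrightarrow> state_process M T W x0 b1 b2 \<sigma> (u (m - 1)) (X m)\<close>[of "m + 1"] by simp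
    \<comment> \<open>The base is the previous control with its state \<open>X m\<close> and its
      adjoint pair. \<open>X (m + 1)\<close> and \<open>Xbar\<close> only witness that
      \<open>u m\<close> and \<open>ubar\<close> have states.\<close>
    then show "J (u m) \<le> J ubar"
      unfolding J using that
      by (intro cost_minimizing_update[of "u (m - 1)" "X m" _ _ _ _ "p m" "q m" U] some[of _ Xbar] some[of _ "X (m + 1)"]
          admissible_proc_sq[of _ U] ubar_U assms) auto
    show "J ubar \<le> J (u m)" by (intro assms)
  qed
  \<comment> \<open>For \<open>m \<ge> 2\<close> the control \<open>u (m - 1)\<close> has been
    through at least one update, so its gap is zero, and the maximum with 1 keeps the bound
    nonnegative.\<close>
  have "0 \<le> J (u (m - 1)) - J ubar \<and> J (u (m - 1)) - J ubar \<le> max (J (u (2 - 1)) - J ubar) 1 / real m" if "m \<ge> 2" for m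
    using opt[of "m - 1"] that by simp
  then show ?thesis by (intro exI[of _ 2]) auto
qed

end
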